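(* If $\mathcal{C}$ is a homotopy extensive path category, then its homotopy exact completion $\mathrm{Hex}(\mathcal{C})$ is a pretopos.
   Context: A path category is a category $\mathcal{C}$ with two classes of maps, fibrations and weak equivalences (maps in both classes are called acyclic fibrations), such that: (1) fibrations are closed under composition; (2) the pullback of a fibration along any map exists and is a fibration; (3) the pullback of an acyclic fibration along any map is an acyclic fibration; (4) 2-out-of-6: if $f:A\to B$, $g:B\to C$, $h:C\to D$ and $gf$, $hg$ are weak equivalences, then so are $f,g,h,hgf$; (5) isomorphisms are acyclic fibrations and every acyclic fibration has a section; (6) every object $B$ has a path object, i.e. a factorisation of the diagonal $B \to B\times B$ as a weak equivalence $r: B \to PB$ followed by a fibration $(s,t): PB \to B \times B$; (7) there is a terminal object $1$ and every map $X \to 1$ is a fibration. In a path category, $f,g: Y \to X$ are homotopic, $f \simeq g$, if for some path object $PX$ there is $h: Y \to PX$ with $sh = f$, $th = g$; this is a congruence independent of the choice of path object, and the homotopy category $\mathrm{Ho}(\mathcal{C})$ is the quotient of $\mathcal{C}$ by $\simeq$. A homotopy equivalence is a map that becomes an isomorphism in $\mathrm{Ho}(\mathcal{C})$. Homotopy pullbacks: for $f: A \to I$, $g: B \to I$, let $A\times_I^hB$ be the pullback of $f\times g: A\times B\to I\times I$ and $(s,t): PI\to I\times I$, with projections $p_1,p_2$ to $A,B$. A square given by $q_1: C\to A$, $q_2: C\to B$ with $fq_1\simeq gq_2$ is a homotopy pullback if there is a homotopy equivalence $h: C\to A\times_I^hB$ with $q_i = p_ih$. An object $0$ is homotopy initial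 if for every object $A$ there is a map $0\to A$, and any two such maps are homotopic. A homotopy sum (homotopy coproduct) of $A$ and $B$ is an object $A+B$ with maps $i_A: A\to A+B$, $i_B: B\to A+B$ such that for all $f: A\to X$, $g: B\to X$ there is $h: A+B\to X$, unique up to homotopy, with $hi_A\simeq f$, $hi_B\simeq g$. A homotopy sum $A+B$ is stable if, for any diagram with top row $C\to X\leftarrow D$, bottom row $A\xrightarrow{i_A} A+B\xleftarrow{i_B} B$ and vertical maps $C\to A$, $X\to A+B$, $D\to B$, the top row is a homotopy coproduct whenever both squares are homotopy pullbacks. It is disjoint if the square with $0\to B$, $0\to A$, $i_B$, $i_A$ is a homotopy pullback, where $0$ is homotopy initial. $\mathcal{C}$ is homotopy extensive if it has a homotopy initial object and (binary) homotopy sums which are all stable and disjoint. A homotopy equivalence relation on $X$ in $\mathcal{C}$ is a fibration $p=(p_1,p_2): R \to X \times X$ such that there exist: $\rho: X \to R$ with $p\rho = \Delta_X$; $\sigma: R \to R$ with $p_1\sigma = p_2$, $p_2\sigma = p_1$; and, for the pullback $R\times_X R$ of $p_2$ and $p_1$ with projections $q_1,q_2$ (so $p_2q_1 = p_1q_2$), a map $\tau: R\times_X R \to R$ with $p_1\tau = p_1q_1$ and $p_2\tau = p_2q_2$. The homotopy exact completion $\mathrm{Hex}(\mathcal{C})$ has as objects the pairs $(X, \rho: R \to X\times X)$ with $\rho$ a homotopy equivalence relation in $\mathcal{C}$. A morphism $(X,\rho:R\to X\times X) \to (Y,\sigma: S\to Y\times Y)$ is an equivalence class of maps $f: X \to Y$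 in $\mathcal{C}$ for which there is $\varphi: R \to S$ with $\sigma\varphi = (f\times f)\rho$; two such $f,g$ are identified if there is $H: X \to S$ with $\sigma H = (f,g)$. A pretopos is a category that is both exact (regular, with every equivalence relation a kernel pair) and extensive (finite sums which are disjoint and stable under pullback). *)

theory Defs
  imports Main
begin

section \<open>Categories\<close>

record ('o, 'm) cat =
  Obj :: "'o set"
  Arr :: "'m set"
  Dom :: "'m \<Rightarrow> 'o"
  Cod :: "'m \<Rightarrow> 'o"
  Ident :: "'o \<Rightarrow> 'm"
  Comp :: "'m \<Rightarrow> 'm \<Rightarrow> 'm"  (infixr "\<cdot>\<index>" 70)

definition Hom :: "('o, 'm, 'z) cat_scheme \<Rightarrow> 'o \<Rightarrow> 'o \<Rightarrow> 'm set" where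
  "Hom C A B = {f \<in> Arr C. Dom C f = A \<and> Cod C f = B}"

locale category =
  fixes C :: "('o, 'm, 'z) cat_scheme" (structure)
  assumes Dom_Obj: "f \<in> Arr C \<Longrightarrow> Dom C f \<in> Obj C"
    and Cod_Obj: "f \<in> Arr C \<Longrightarrow> Cod C f \<in> Obj C"
    and Ident_Hom: "A \<in> Obj C \<Longrightarrow> Ident C A \<in> Hom C A A"
    and Comp_Hom: "f \<in> Hom C A B \<Longrightarrow> g \<in> Hom C B D \<Longrightarrow> g \<cdot> f \<in> Hom C A D"
    and Comp_Ident_left: "f \<in> Hom C A B \<Longrightarrow> Ident C B \<cdot> f = f"
    and Comp_Ident_right: "f \<in> Hom C A B \<Longrightarrow> f \<cdot> Ident C A = f"
    and Comp_assoc: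
      "f \<in> Hom C A B \<Longrightarrow> g \<in> Hom C B D \<Longrightarrow> h \<in> Hom C D E \<Longrightarrow> h \<cdot> (g \<cdot> f) = (h \<cdot> g) \<cdot> f"

definition is_iso :: "('o, 'm, 'z) cat_scheme \<Rightarrow> 'm \<Rightarrow> bool" where
  "is_iso C f \<longleftrightarrow> f \<in> Arr C \<and>
    (\<exists>g \<in> Hom C (Cod C f) (Dom C f).
       g \<cdot>\<^bsub>C\<^esub> f = Ident C (Dom C f) \<and> f \<cdot>\<^bsub>C\<^esub> g = Ident C (Cod C f))"

definition monic :: "('o, 'm, 'z) cat_scheme \<Rightarrow> 'm \<Rightarrow> bool" where
  "monic C m \<longleftrightarrow> m \<in> Arr C \<and>
    (\<forall>Y. \<forall>u \<in> Hom C Y (Dom C m). \<forall>v \<in> Hom C Y (Dom C m).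
       m \<cdot>\<^bsub>C\<^esub> u = m \<cdot>\<^bsub>C\<^esub> v \<longrightarrow> u = v)"

definition terminal :: "('o, 'm, 'z) cat_scheme \<Rightarrow> 'o \<Rightarrow> bool" where
  "terminal C T \<longleftrightarrow> T \<in> Obj C \<and> (\<forall>A \<in> Obj C. \<exists>!f. f \<in> Hom C A T)"

definition initial :: "('o, 'm, 'z) cat_scheme \<Rightarrow> 'o \<Rightarrow> bool" where
  "initial C Z \<longleftrightarrow> Z \<in> Obj C \<and> (\<forall>A \<in> Obj C. \<exists>!f. f \<in> Hom C Z A)"

definition is_product :: "('o, 'm, 'z) cat_scheme \<Rightarrow> 'o \<Rightarrow> 'o \<Rightarrow> 'm \<Rightarrow> 'm \<Rightarrow> bool" where
  "is_product C A B p q \<longleftrightarrow>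
    p \<in> Hom C (Dom C p) A \<and> q \<in> Hom C (Dom C p) B \<and>
    (\<forall>Y. \<forall>f \<in> Hom C Y A. \<forall>g \<in> Hom C Y B.
       \<exists>!h. h \<in> Hom C Y (Dom C p) \<and> p \<cdot>\<^bsub>C\<^esub> h = f \<and> q \<cdot>\<^bsub>C\<^esub> h = g)"

definition is_coproduct :: "('o, 'm, 'z) cat_scheme \<Rightarrow> 'o \<Rightarrow> 'o \<Rightarrow> 'm \<Rightarrow> 'm \<Rightarrow> bool" where
  "is_coproduct C A B i j \<longleftrightarrow>
    i \<in> Hom C A (Cod C i) \<and> j \<in> Hom C B (Cod C i) \<and>
    (\<forall>Y. \<forall>f \<in> Hom C A Y. \<forall>g \<in> Hom C B Y.
       \<exists>!h. h \<in> Hom C (Cod C i) Y \<and> h \<cdot>\<^bsub>C\<^esub> i = f \<and> h \<cdot>\<^bsub>C\<^esub> j = g)"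

text \<open>
  In \<open>is_pullback C f g p q\<close> the cospan is \<open>f\<close>, \<open>g\<close>, the projections are \<open>p\<close>, \<open>q\<close>, and
  \<open>f \<cdot> p = g \<cdot> q\<close>; so \<open>q\<close> is the pullback of \<open>f\<close> along \<open>g\<close>.
\<close>

definition is_pullback :: "('o, 'm, 'z) cat_scheme \<Rightarrow> 'm \<Rightarrow> 'm \<Rightarrow> 'm \<Rightarrow> 'm \<Rightarrow> bool" where
  "is_pullback C f g p q \<longleftrightarrow>
    f \<in> Arr C \<and> g \<in> Hom C (Dom C g) (Cod C f) \<and>
    p \<in> Hom C (Dom C p) (Dom C f) \<and> q \<in> Hom C (Dom C p) (Dom C g) \<and>
    f \<cdot>\<^bsub>C\<^esub> p = g \<cdot>\<^bsub>C\<^esub> q \<and>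
    (\<forall>Y. \<forall>u \<in> Hom C Y (Dom C f). \<forall>v \<in> Hom C Y (Dom C g).
       f \<cdot>\<^bsub>C\<^esub> u = g \<cdot>\<^bsub>C\<^esub> v \<longrightarrow>
       (\<exists>!h. h \<in> Hom C Y (Dom C p) \<and> p \<cdot>\<^bsub>C\<^esub> h = u \<and> q \<cdot>\<^bsub>C\<^esub> h = v))"

definition is_coequalizer :: "('o, 'm, 'z) cat_scheme \<Rightarrow> 'm \<Rightarrow> 'm \<Rightarrow> 'm \<Rightarrow> bool" where
  "is_coequalizer C u v e \<longleftrightarrow>
    u \<in> Arr C \<and> v \<in> Hom C (Dom C u) (Cod C u) \<and> e \<in> Hom C (Cod C u) (Cod C e) \<and>
    e \<cdot>\<^bsub>C\<^esub> u = e \<cdot>\<^bsub>C\<^esub> v \<and>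
    (\<forall>Y. \<forall>f \<in> Hom C (Cod C u) Y.
       f \<cdot>\<^bsub>C\<^esub> u = f \<cdot>\<^bsub>C\<^esub> v \<longrightarrow> (\<exists>!h. h \<in> Hom C (Cod C e) Y \<and> h \<cdot>\<^bsub>C\<^esub> e = f))"

text \<open>
  A choice of binary products, so that \<open>X \<times> X\<close> denotes an object.  It is only used in path
  categories, where binary products exist (pull back \<open>A \<rightarrow> 1\<close> along \<open>B \<rightarrow> 1\<close>); as isomorphisms
  are fibrations, nothing below depends on which products are chosen, up to isomorphism of the
  resulting categories.
\<close>

definition prod_proj :: "('o, 'm, 'z) cat_scheme \<Rightarrow> 'o \<Rightarrow> 'o \<Rightarrow> 'm \<times> 'm" where
  "prod_proj C A B = (SOME pq. is_product C A B (fst pq) (snd pq))"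

definition pr1 :: "('o, 'm, 'z) cat_scheme \<Rightarrow> 'o \<Rightarrow> 'o \<Rightarrow> 'm" where
  "pr1 C A B = fst (prod_proj C A B)"

definition pr2 :: "('o, 'm, 'z) cat_scheme \<Rightarrow> 'o \<Rightarrow> 'o \<Rightarrow> 'm" where
  "pr2 C A B = snd (prod_proj C A B)"

definition Prod :: "('o, 'm, 'z) cat_scheme \<Rightarrow> 'o \<Rightarrow> 'o \<Rightarrow> 'o" where
  "Prod C A B = Dom C (pr1 C A B)"

definition pairing :: "('o, 'm, 'z) cat_scheme \<Rightarrow> 'm \<Rightarrow> 'm \<Rightarrow> 'm" where
  "pairing C f g = (THE h. h \<in> Hom C (Dom C f) (Prod C (Cod C f) (Cod C g)) \<and>
     pr1 C (Cod C f) (Cod C g) \<cdot>\<^bsub>C\<^esub> h = f \<and> pr2 C (Cod C f) (Cod C g) \<cdot>\<^bsub>C\<^esub> h = g)"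

definition prod_map :: "('o, 'm, 'z) cat_scheme \<Rightarrow> 'm \<Rightarrow> 'm \<Rightarrow> 'm" where
  "prod_map C f g =
     pairing C (f \<cdot>\<^bsub>C\<^esub> pr1 C (Dom C f) (Dom C g)) (g \<cdot>\<^bsub>C\<^esub> pr2 C (Dom C f) (Dom C g))"

definition diag :: "('o, 'm, 'z) cat_scheme \<Rightarrow> 'o \<Rightarrow> 'm" where
  "diag C A = pairing C (Ident C A) (Ident C A)"

text \<open>
  Quotient of a category by a congruence \<open>E\<close>, a relation between parallel arrows; the arrows
  are the \<open>E\<close>-classes.
\<close>

definition quotient_cat :: "('o, 'm, 'z) cat_scheme \<Rightarrow> ('m \<times> 'm) set \<Rightarrow> ('o, 'm set) cat" where
  "quotient_cat C E = \<lparr>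
     Obj = Obj C,
     Arr = Arr C // E,
     Dom = (\<lambda>\<alpha>. the_elem (Dom C ` \<alpha>)),
     Cod = (\<lambda>\<alpha>. the_elem (Cod C ` \<alpha>)),
     Ident = (\<lambda>A. E `` {Ident C A}),
     Comp = (\<lambda>\<beta> \<alpha>. E `` {g \<cdot>\<^bsub>C\<^esub> f | g f. g \<in> \<beta> \<and> f \<in> \<alpha>}) \<rparr>"


section \<open>Path categories\<close>

record ('o, 'm) path_cat = "('o, 'm) cat" +
  Fib :: "'m set"
  Weq :: "'m set"

text \<open>
  A path object for \<open>B\<close> is given by \<open>r : B \<rightarrow> PB\<close> and \<open>st = (s, t) : PB \<rightarrow> B \<times> B\<close>.
\<close>

definition path_object :: "('o, 'm, 'z) path_cat_scheme \<Rightarrow> 'o \<Rightarrow> 'm \<Rightarrow> 'm \<Rightarrow> bool" where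
  "path_object C B r st \<longleftrightarrow>
    r \<in> Hom C B (Dom C st) \<and> r \<in> Weq C \<and>
    st \<in> Hom C (Dom C st) (Prod C B B) \<and> st \<in> Fib C \<and>
    st \<cdot>\<^bsub>C\<^esub> r = diag C B"

locale path_category = category C
  for C :: "('o, 'm, 'z) path_cat_scheme" (structure) +
  assumes Fib_Arr: "Fib C \<subseteq> Arr C"
    and Weq_Arr: "Weq C \<subseteq> Arr C"
    and Fib_Comp: "f \<in> Fib C \<Longrightarrow> g \<in> Fib C \<Longrightarrow> Cod C f = Dom C g \<Longrightarrow> g \<cdot> f \<in> Fib C"
    and Fib_pullback_ex:
      "f \<in> Fib C \<Longrightarrow> g \<in> Arr C \<Longrightarrow> Cod C g = Cod C f \<Longrightarrow> \<exists>p q. is_pullback C f g p q"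
    and Fib_pullback: "f \<in> Fib C \<Longrightarrow> is_pullback C f g p q \<Longrightarrow> q \<in> Fib C"
    and acyclic_Fib_pullback:
      "f \<in> Fib C \<inter> Weq C \<Longrightarrow> is_pullback C f g p q \<Longrightarrow> q \<in> Fib C \<inter> Weq C"
    and two_out_of_six:
      "f \<in> Hom C A B \<Longrightarrow> g \<in> Hom C B D \<Longrightarrow> h \<in> Hom C D E \<Longrightarrow>
       g \<cdot> f \<in> Weq C \<Longrightarrow> h \<cdot> g \<in> Weq C \<Longrightarrow>
       f \<in> Weq C \<and> g \<in> Weq C \<and> h \<in> Weq C \<and> h \<cdot> (g \<cdot> f) \<in> Weq C"
    and iso_acyclic_Fib: "is_iso C f \<Longrightarrow> f \<in> Fib C \<inter> Weq C"
    and acyclic_Fib_section: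
      "f \<in> Fib C \<inter> Weq C \<Longrightarrow> \<exists>s \<in> Hom C (Cod C f) (Dom C f). f \<cdot> s = Ident C (Cod C f)"
    and path_object_ex: "B \<in> Obj C \<Longrightarrow> \<exists>r st. path_object C B r st"
    and terminal_ex: "\<exists>T. terminal C T \<and> (\<forall>X. Hom C X T \<subseteq> Fib C)"

definition homotopic :: "('o, 'm, 'z) path_cat_scheme \<Rightarrow> 'm \<Rightarrow> 'm \<Rightarrow> bool" where
  "homotopic C f g \<longleftrightarrow>
    f \<in> Arr C \<and> g \<in> Hom C (Dom C f) (Cod C f) \<and>
    (\<exists>r st. path_object C (Cod C f) r st \<and>
       (\<exists>h \<in> Hom C (Dom C f) (Dom C st).
          (pr1 C (Cod C f) (Cod C f) \<cdot>\<^bsub>C\<^esub> st) \<cdot>\<^bsub>C\<^esub> h = f \<and>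
          (pr2 C (Cod C f) (Cod C f) \<cdot>\<^bsub>C\<^esub> st) \<cdot>\<^bsub>C\<^esub> h = g))"

definition homotopy_rel :: "('o, 'm, 'z) path_cat_scheme \<Rightarrow> ('m \<times> 'm) set" where
  "homotopy_rel C = {(f, g). homotopic C f g}"

definition Ho :: "('o, 'm, 'z) path_cat_scheme \<Rightarrow> ('o, 'm set) cat" where
  "Ho C = quotient_cat C (homotopy_rel C)"

definition homotopy_equivalence :: "('o, 'm, 'z) path_cat_scheme \<Rightarrow> 'm \<Rightarrow> bool" where
  "homotopy_equivalence C f \<longleftrightarrow> f \<in> Arr C \<and> is_iso (Ho C) (homotopy_rel C `` {f})"

text \<open>
  The square \<open>f q1 \<simeq> g q2\<close> is a homotopy pullback.  Here \<open>w\<close> is the projection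
  of the pullback of \<open>f \<times> g\<close> and \<open>(s, t)\<close> to \<open>A \<times> B\<close>, and \<open>\<pi>\<close> the one to the path object.
\<close>

definition is_homotopy_pullback ::
  "('o, 'm, 'z) path_cat_scheme \<Rightarrow> 'm \<Rightarrow> 'm \<Rightarrow> 'm \<Rightarrow> 'm \<Rightarrow> bool" where
  "is_homotopy_pullback C f g q1 q2 \<longleftrightarrow>
    f \<in> Arr C \<and> g \<in> Hom C (Dom C g) (Cod C f) \<and>
    q1 \<in> Hom C (Dom C q1) (Dom C f) \<and> q2 \<in> Hom C (Dom C q1) (Dom C g) \<and>
    homotopic C (f \<cdot>\<^bsub>C\<^esub> q1) (g \<cdot>\<^bsub>C\<^esub> q2) \<and>
    (\<exists>r st w \<pi>. path_object C (Cod C f) r st \<and>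
       is_pullback C (prod_map C f g) st w \<pi> \<and>
       (\<exists>h \<in> Hom C (Dom C q1) (Dom C w). homotopy_equivalence C h \<and>
          q1 = (pr1 C (Dom C f) (Dom C g) \<cdot>\<^bsub>C\<^esub> w) \<cdot>\<^bsub>C\<^esub> h \<and>
          q2 = (pr2 C (Dom C f) (Dom C g) \<cdot>\<^bsub>C\<^esub> w) \<cdot>\<^bsub>C\<^esub> h))"

definition homotopy_initial :: "('o, 'm, 'z) path_cat_scheme \<Rightarrow> 'o \<Rightarrow> bool" where
  "homotopy_initial C Z \<longleftrightarrow> Z \<in> Obj C \<and>
    (\<forall>A \<in> Obj C. Hom C Z A \<noteq> {} \<and> (\<forall>f \<in> Hom C Z A. \<forall>g \<in> Hom C Z A. homotopic C f g))"

definition is_homotopy_sum ::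
  "('o, 'm, 'z) path_cat_scheme \<Rightarrow> 'o \<Rightarrow> 'o \<Rightarrow> 'm \<Rightarrow> 'm \<Rightarrow> bool" where
  "is_homotopy_sum C A B i j \<longleftrightarrow>
    i \<in> Hom C A (Cod C i) \<and> j \<in> Hom C B (Cod C i) \<and>
    (\<forall>X. \<forall>f \<in> Hom C A X. \<forall>g \<in> Hom C B X.
       (\<exists>h \<in> Hom C (Cod C i) X. homotopic C (h \<cdot>\<^bsub>C\<^esub> i) f \<and> homotopic C (h \<cdot>\<^bsub>C\<^esub> j) g) \<and>
       (\<forall>h \<in> Hom C (Cod C i) X. \<forall>h' \<in> Hom C (Cod C i) X.
          homotopic C (h \<cdot>\<^bsub>C\<^esub> i) f \<and> homotopic C (h \<cdot>\<^bsub>C\<^esub> j) g \<and>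
          homotopic C (h' \<cdot>\<^bsub>C\<^esub> i) f \<and> homotopic C (h' \<cdot>\<^bsub>C\<^esub> j) g \<longrightarrow> homotopic C h h'))"

text \<open>
  Stability and disjointness of a homotopy sum with coprojections \<open>i\<close> and \<open>j\<close>.  In the first
  definition \<open>c\<close> and \<open>d\<close> form the top row and \<open>a\<close>, \<open>x\<close>, \<open>b\<close> are the vertical maps.
\<close>

definition stable_homotopy_sum :: "('o, 'm, 'z) path_cat_scheme \<Rightarrow> 'm \<Rightarrow> 'm \<Rightarrow> bool" where
  "stable_homotopy_sum C i j \<longleftrightarrow>
    (\<forall>a x b c d. is_homotopy_pullback C i x a c \<and> is_homotopy_pullback C j x b d \<longrightarrow>
       is_homotopy_sum C (Dom C c) (Dom C d) c d)"

definition disjoint_homotopy_sum :: "('o, 'm, 'z) path_cat_scheme \<Rightarrow> 'm \<Rightarrow> 'm \<Rightarrow> bool" where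
  "disjoint_homotopy_sum C i j \<longleftrightarrow>
    (\<exists>a b. homotopy_initial C (Dom C a) \<and> is_homotopy_pullback C i j a b)"

definition homotopy_extensive :: "('o, 'm, 'z) path_cat_scheme \<Rightarrow> bool" where
  "homotopy_extensive C \<longleftrightarrow>
    (\<exists>Z. homotopy_initial C Z) \<and>
    (\<forall>A \<in> Obj C. \<forall>B \<in> Obj C. \<exists>i j. is_homotopy_sum C A B i j) \<and>
    (\<forall>A B i j. is_homotopy_sum C A B i j \<longrightarrow>
       stable_homotopy_sum C i j \<and> disjoint_homotopy_sum C i j)"


section \<open>The homotopy exact completion\<close>

definition homotopy_eqrel :: "('o, 'm, 'z) path_cat_scheme \<Rightarrow> 'o \<Rightarrow> 'm \<Rightarrow> bool" where
  "homotopy_eqrel C X p \<longleftrightarrow>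
    X \<in> Obj C \<and> p \<in> Fib C \<and> p \<in> Hom C (Dom C p) (Prod C X X) \<and>
    (let R = Dom C p; p1 = pr1 C X X \<cdot>\<^bsub>C\<^esub> p; p2 = pr2 C X X \<cdot>\<^bsub>C\<^esub> p in
      (\<exists>\<rho> \<in> Hom C X R. p \<cdot>\<^bsub>C\<^esub> \<rho> = diag C X) \<and>
      (\<exists>\<sigma> \<in> Hom C R R. p1 \<cdot>\<^bsub>C\<^esub> \<sigma> = p2 \<and> p2 \<cdot>\<^bsub>C\<^esub> \<sigma> = p1) \<and>
      (\<exists>q1 q2. is_pullback C p2 p1 q1 q2 \<and>
         (\<exists>\<tau> \<in> Hom C (Dom C q1) R.
            p1 \<cdot>\<^bsub>C\<^esub> \<tau> = p1 \<cdot>\<^bsub>C\<^esub> q1 \<and> p2 \<cdot>\<^bsub>C\<^esub> \<tau> = p2 \<cdot>\<^bsub>C\<^esub> q2)))"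

text \<open>
  The category of homotopy equivalence relations and relation-preserving maps, before
  identification of maps.  An arrow is a triple of source, target and underlying map, because a
  map of \<open>C\<close> does not determine the relations on its domain and codomain.
\<close>

type_synonym ('o, 'm) hex_obj = "'o \<times> 'm"
type_synonym ('o, 'm) hex_map = "('o, 'm) hex_obj \<times> ('o, 'm) hex_obj \<times> 'm"

definition eqrel_cat ::
  "('o, 'm, 'z) path_cat_scheme \<Rightarrow> (('o, 'm) hex_obj, ('o, 'm) hex_map) cat" where
  "eqrel_cat C = \<lparr>
     Obj = {(X, \<rho>). homotopy_eqrel C X \<rho>},
     Arr = {((X, \<rho>), (Y, \<sigma>), f) | X \<rho> Y \<sigma> f.
              homotopy_eqrel C X \<rho> \<and> homotopy_eqrel C Y \<sigma> \<and> f \<in> Hom C X Y \<and>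
              (\<exists>\<phi> \<in> Hom C (Dom C \<rho>) (Dom C \<sigma>). \<sigma> \<cdot>\<^bsub>C\<^esub> \<phi> = prod_map C f f \<cdot>\<^bsub>C\<^esub> \<rho>)},
     Dom = (\<lambda>(A, B, f). A),
     Cod = (\<lambda>(A, B, f). B),
     Ident = (\<lambda>A. (A, A, Ident C (fst A))),
     Comp = (\<lambda>(B', D, g) (A, B, f). (A, D, g \<cdot>\<^bsub>C\<^esub> f)) \<rparr>"

definition hex_rel ::
  "('o, 'm, 'z) path_cat_scheme \<Rightarrow> (('o, 'm) hex_map \<times> ('o, 'm) hex_map) set" where
  "hex_rel C = {(((X, \<rho>), (Y, \<sigma>), f), ((X, \<rho>), (Y, \<sigma>), g)) | X \<rho> Y \<sigma> f g.
     ((X, \<rho>), (Y, \<sigma>), f) \<in> Arr (eqrel_cat C) \<and> ((X, \<rho>), (Y, \<sigma>), g) \<in> Arr (eqrel_cat C) \<and>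
     (\<exists>H \<in> Hom C X (Dom C \<sigma>). \<sigma> \<cdot>\<^bsub>C\<^esub> H = pairing C f g)}"

definition Hex ::
  "('o, 'm, 'z) path_cat_scheme \<Rightarrow> (('o, 'm) hex_obj, ('o, 'm) hex_map set) cat" where
  "Hex C = quotient_cat (eqrel_cat C) (hex_rel C)"


section \<open>Pretoposes\<close>

definition finitely_complete :: "('o, 'm, 'z) cat_scheme \<Rightarrow> bool" where
  "finitely_complete C \<longleftrightarrow>
    (\<exists>T. terminal C T) \<and>
    (\<forall>f \<in> Arr C. \<forall>g \<in> Arr C. Cod C f = Cod C g \<longrightarrow> (\<exists>p q. is_pullback C f g p q))"

definition regular_epi :: "('o, 'm, 'z) cat_scheme \<Rightarrow> 'm \<Rightarrow> bool" where
  "regular_epi C e \<longleftrightarrow> (\<exists>u v. is_coequalizer C u v e)"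

definition kernel_pair :: "('o, 'm, 'z) cat_scheme \<Rightarrow> 'm \<Rightarrow> 'm \<Rightarrow> 'm \<Rightarrow> bool" where
  "kernel_pair C f u v \<longleftrightarrow> is_pullback C f f u v"

definition regular_category :: "('o, 'm, 'z) cat_scheme \<Rightarrow> bool" where
  "regular_category C \<longleftrightarrow>
    category C \<and> finitely_complete C \<and>
    (\<forall>f u v. kernel_pair C f u v \<longrightarrow> (\<exists>e. is_coequalizer C u v e)) \<and>
    (\<forall>e g p q. regular_epi C e \<and> is_pullback C e g p q \<longrightarrow> regular_epi C q)"

definition jointly_monic :: "('o, 'm, 'z) cat_scheme \<Rightarrow> 'm \<Rightarrow> 'm \<Rightarrow> bool" where
  "jointly_monic C p1 p2 \<longleftrightarrow>
    (\<forall>Y. \<forall>u \<in> Hom C Y (Dom C p1). \<forall>v \<in> Hom C Y (Dom C p1).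
       p1 \<cdot>\<^bsub>C\<^esub> u = p1 \<cdot>\<^bsub>C\<^esub> v \<and> p2 \<cdot>\<^bsub>C\<^esub> u = p2 \<cdot>\<^bsub>C\<^esub> v \<longrightarrow> u = v)"

definition equivalence_relation :: "('o, 'm, 'z) cat_scheme \<Rightarrow> 'o \<Rightarrow> 'm \<Rightarrow> 'm \<Rightarrow> bool" where
  "equivalence_relation C X p1 p2 \<longleftrightarrow>
    p1 \<in> Hom C (Dom C p1) X \<and> p2 \<in> Hom C (Dom C p1) X \<and> jointly_monic C p1 p2 \<and>
    (\<exists>\<rho> \<in> Hom C X (Dom C p1). p1 \<cdot>\<^bsub>C\<^esub> \<rho> = Ident C X \<and> p2 \<cdot>\<^bsub>C\<^esub> \<rho> = Ident C X) \<and>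
    (\<exists>\<sigma> \<in> Hom C (Dom C p1) (Dom C p1). p1 \<cdot>\<^bsub>C\<^esub> \<sigma> = p2 \<and> p2 \<cdot>\<^bsub>C\<^esub> \<sigma> = p1) \<and>
    (\<exists>q1 q2. is_pullback C p2 p1 q1 q2 \<and>
       (\<exists>\<tau> \<in> Hom C (Dom C q1) (Dom C p1).
          p1 \<cdot>\<^bsub>C\<^esub> \<tau> = p1 \<cdot>\<^bsub>C\<^esub> q1 \<and> p2 \<cdot>\<^bsub>C\<^esub> \<tau> = p2 \<cdot>\<^bsub>C\<^esub> q2))"

definition exact_category :: "('o, 'm, 'z) cat_scheme \<Rightarrow> bool" where
  "exact_category C \<longleftrightarrow>
    regular_category C \<and>
    (\<forall>X p1 p2. equivalence_relation C X p1 p2 \<longrightarrow> (\<exists>f. kernel_pair C f p1 p2))"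

definition disjoint_sum :: "('o, 'm, 'z) cat_scheme \<Rightarrow> 'm \<Rightarrow> 'm \<Rightarrow> bool" where
  "disjoint_sum C i j \<longleftrightarrow>
    monic C i \<and> monic C j \<and> (\<exists>a b. initial C (Dom C a) \<and> is_pullback C i j a b)"

definition stable_sum :: "('o, 'm, 'z) cat_scheme \<Rightarrow> 'm \<Rightarrow> 'm \<Rightarrow> bool" where
  "stable_sum C i j \<longleftrightarrow>
    (\<forall>x \<in> Arr C. Cod C x = Cod C i \<longrightarrow>
       (\<exists>a c. is_pullback C i x a c) \<and> (\<exists>b d. is_pullback C j x b d)) \<and>
    (\<forall>a x b c d. is_pullback C i x a c \<and> is_pullback C j x b d \<longrightarrow>
       is_coproduct C (Dom C c) (Dom C d) c d)"

text \<open>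
  The third conjunct is stability under pullback of the empty sum: the initial object is strict.
\<close>

definition extensive_category :: "('o, 'm, 'z) cat_scheme \<Rightarrow> bool" where
  "extensive_category C \<longleftrightarrow>
    category C \<and> (\<exists>Z. initial C Z) \<and>
    (\<forall>Z Y. initial C Z \<and> Y \<in> Obj C \<and> Hom C Y Z \<noteq> {} \<longrightarrow> initial C Y) \<and>
    (\<forall>A \<in> Obj C. \<forall>B \<in> Obj C. \<exists>i j. is_coproduct C A B i j) \<and>
    (\<forall>A B i j. is_coproduct C A B i j \<longrightarrow> disjoint_sum C i j \<and> stable_sum C i j)"

definition pretopos :: "('o, 'm, 'z) cat_scheme \<Rightarrow> bool" where
  "pretopos C \<longleftrightarrow> exact_category C \<and> extensive_category C"

end

theory Submission
  imports Defs
begin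

text \<open>
  The proof is a translation into logic.  A fibration over \<open>X\<close> acts as a predicate on the
  generalised elements of \<open>X\<close>, that is, on the maps into \<open>X\<close>: it holds of those that factor
  through it.  Since fibrations are stable under pullback and composition, such predicates can be
  substituted into, conjoined and existentially quantified.  Path objects behave as equality: the
  path relation obeys the Leibniz rule (\<open>path_Leibniz\<close>), hence is a homotopy equivalence
  relation, and the least one.  An object of the completion is an object of \<open>\<C>\<close> with an
  equivalence relation \<open>eqv A\<close> on its elements, its maps are the maps of \<open>\<C>\<close> that respect the
  relations, and two of them are equal when they send each element to equivalent ones.  After this
  only the relations on elements matter.

  Exactness then follows the construction of quotients by hand.  The elements of a pullback are the
  pairs whose images are equivalent (\<open>Hex_pullback_iff\<close>, \<open>Hex_pullback_ex\<close>).  A map is a regular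
  epimorphism exactly if it has a section in \<open>\<C>\<close>, up to equivalence but with no compatibility
  with the relations (\<open>regular_epi_iff\<close>), a property that passes to pullbacks.  An internal
  equivalence relation is a coarser relation on the same underlying object, and the identity map
  into the coarser object is its quotient (\<open>equivalence_relation_kernel_pair\<close>).

  For sums, stability splits every element of a homotopy sum into an element of each summand,
  disjointness makes an element that comes from both sides live on a homotopy initial domain, and
  predicates may be checked on the pieces of such a splitting (\<open>lifts_local\<close>).  The sum of two
  objects carries the relation whose pairs are locally pairs of one of the two relations
  (\<open>sum_rel\<close>); it is transitive because, where the middle element of two related pairs comes
  from both summands, the domain is homotopy initial.  It restricts to the given relations and
  relates elements of different summands only over homotopy initial objects, which gives
  disjointness, and comparing splittings in \<open>\<C>\<close> with pullbacks in the completion gives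
  stability (\<open>sum_rel_stable\<close>).  Strictness of the initial object comes from the fact that an
  object over a homotopy initial one is its own double (\<open>homotopy_initial_strict\<close>).
\<close>

section \<open>Categories and their quotients\<close>

context category
begin

lemma Hom_iff: "f \<in> Hom C A B \<longleftrightarrow> f \<in> Arr C \<and> Dom C f = A \<and> Cod C f = B"
  by (simp add: Hom_def)

lemma Comp_simps [simp]:
  assumes "f \<in> Arr C" "g \<in> Arr C" "Cod C f = Dom C g"
  shows "g \<cdot> f \<in> Arr C" "Dom C (g \<cdot> f) = Dom C f" "Cod C (g \<cdot> f) = Cod C g"
  using Comp_Hom[of f "Dom C f" "Dom C g" g "Cod C g"] assms by (auto simp: Hom_iff)

lemma Ident_simps [simp]:
  assumes "A \<in> Obj C"
  shows "Ident C A \<in> Arr C" "Dom C (Ident C A) = A" "Cod C (Ident C A) = A"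
  using Ident_Hom[OF assms] by (auto simp: Hom_iff)

lemma Comp_Ident [simp]:
  "f \<in> Arr C \<Longrightarrow> Cod C f = B \<Longrightarrow> Ident C B \<cdot> f = f"
  "f \<in> Arr C \<Longrightarrow> Dom C f = A \<Longrightarrow> f \<cdot> Ident C A = f"
  using Comp_Ident_left Comp_Ident_right by (auto simp: Hom_iff)

lemma Comp_assoc' [simp]:
  assumes "f \<in> Arr C" "g \<in> Arr C" "h \<in> Arr C" "Cod C f = Dom C g" "Cod C g = Dom C h"
  shows "(h \<cdot> g) \<cdot> f = h \<cdot> g \<cdot> f"
  using Comp_assoc[of f "Dom C f" "Dom C g" g "Dom C h" h "Cod C h"] assms by (auto simp: Hom_iff)

lemma Comp_eq_comp:
  assumes "g \<cdot> f = k" "f \<in> Arr C" "g \<in> Arr C" "h \<in> Arr C" "Cod C f = Dom C g" "Cod C h = Dom C f"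
  shows "g \<cdot> f \<cdot> h = k \<cdot> h"
  using Comp_assoc'[of h f g] assms by auto

lemma Arr_Obj [simp]: "f \<in> Arr C \<Longrightarrow> Dom C f \<in> Obj C" "f \<in> Arr C \<Longrightarrow> Cod C f \<in> Obj C"
  by (auto intro: Dom_Obj Cod_Obj)

lemma is_iso_Ident: "A \<in> Obj C \<Longrightarrow> is_iso C (Ident C A)"
  by (auto simp: is_iso_def Hom_iff intro!: bexI[of _ "Ident C A"])

lemma pullback_arrD:
  assumes "is_pullback C f g p q"
  shows "f \<in> Arr C" "g \<in> Arr C" "p \<in> Arr C" "q \<in> Arr C"
    "Cod C g = Cod C f" "Cod C p = Dom C f" "Cod C q = Dom C g" "Dom C q = Dom C p"
    "f \<cdot> p = g \<cdot> q"
  using assms by (auto simp: is_pullback_def Hom_iff)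

lemma pullback_square:
  assumes "is_pullback C f g p q" "h \<in> Arr C" "Cod C h = Dom C p"
  shows "f \<cdot> p \<cdot> h = g \<cdot> q \<cdot> h"
proof -
  note D = pullback_arrD[OF assms(1)]
  have "f \<cdot> p \<cdot> h = (f \<cdot> p) \<cdot> h" using D assms(2,3) by (subst Comp_assoc') auto
  also have "\<dots> = g \<cdot> q \<cdot> h" using D assms(2,3) by (subst D(9), subst Comp_assoc') auto
  finally show ?thesis .
qed

lemma pullback_factor:
  assumes "is_pullback C f g p q" "u \<in> Arr C" "v \<in> Arr C" "Dom C v = Dom C u"
    "Cod C u = Dom C f" "Cod C v = Dom C g" "f \<cdot> u = g \<cdot> v"
  obtains h where "h \<in> Arr C" "Dom C h = Dom C u" "Cod C h = Dom C p" "p \<cdot> h = u" "q \<cdot> h = v"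
proof -
  have "\<exists>!h. h \<in> Hom C (Dom C u) (Dom C p) \<and> p \<cdot> h = u \<and> q \<cdot> h = v"
    using assms by (auto simp: is_pullback_def Hom_iff)
  with that show thesis by (auto simp: Hom_iff)
qed

lemma pullback_unique:
  assumes pb: "is_pullback C f g p q" and h: "h \<in> Arr C" "Cod C h = Dom C p"
    and k: "k \<in> Arr C" "Cod C k = Dom C p" "Dom C k = Dom C h"
    and eq: "p \<cdot> h = p \<cdot> k" "q \<cdot> h = q \<cdot> k"
  shows "h = k"
proof -
  note D = pullback_arrD[OF pb]
  have ph: "p \<cdot> h \<in> Hom C (Dom C h) (Dom C f)" "q \<cdot> h \<in> Hom C (Dom C h) (Dom C g)"
    using D h by (auto simp: Hom_iff)
  have "f \<cdot> p \<cdot> h = g \<cdot> q \<cdot> h" by (rule pullback_square[OF pb h])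
  then have "\<exists>!k. k \<in> Hom C (Dom C h) (Dom C p) \<and> p \<cdot> k = p \<cdot> h \<and> q \<cdot> k = q \<cdot> h"
    using pb ph unfolding is_pullback_def by blast
  with h k eq show ?thesis by (auto simp: Hom_iff)
qed

lemma pullbackI:
  assumes "f \<in> Arr C" "g \<in> Arr C" "p \<in> Arr C" "q \<in> Arr C"
    "Cod C g = Cod C f" "Cod C p = Dom C f" "Cod C q = Dom C g" "Dom C q = Dom C p"
    "f \<cdot> p = g \<cdot> q"
    and ex: "\<And>u v. \<lbrakk>u \<in> Arr C; v \<in> Arr C; Dom C v = Dom C u; Cod C u = Dom C f;
      Cod C v = Dom C g; f \<cdot> u = g \<cdot> v\<rbrakk> \<Longrightarrow>
      \<exists>h. h \<in> Arr C \<and> Dom C h = Dom C u \<and> Cod C h = Dom C p \<and> p \<cdot> h = u \<and> q \<cdot> h = v"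
    and un: "\<And>h k. \<lbrakk>h \<in> Arr C; k \<in> Arr C; Cod C h = Dom C p; Cod C k = Dom C p;
      Dom C k = Dom C h; p \<cdot> h = p \<cdot> k; q \<cdot> h = q \<cdot> k\<rbrakk> \<Longrightarrow> h = k"
  shows "is_pullback C f g p q"
  unfolding is_pullback_def
proof (intro conjI allI ballI impI)
  fix Y u v assume u: "u \<in> Hom C Y (Dom C f)" and v: "v \<in> Hom C Y (Dom C g)"
    and eq: "f \<cdot> u = g \<cdot> v"
  then obtain h where "h \<in> Arr C" "Dom C h = Dom C u" "Cod C h = Dom C p" "p \<cdot> h = u" "q \<cdot> h = v"
    using ex[of u v] by (auto simp: Hom_iff)
  then show "\<exists>!h. h \<in> Hom C Y (Dom C p) \<and> p \<cdot> h = u \<and> q \<cdot> h = v"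
    using u v un by (intro ex1I[of _ h]) (auto simp: Hom_iff)
qed (use assms(1-9) in \<open>auto simp: Hom_iff\<close>)

lemma pullback_sym:
  assumes "is_pullback C f g p q"
  shows "is_pullback C g f q p"
proof (rule pullbackI)
  note D = pullback_arrD[OF assms]
  show "\<exists>h. h \<in> Arr C \<and> Dom C h = Dom C u \<and> Cod C h = Dom C q \<and> q \<cdot> h = u \<and> p \<cdot> h = v"
    if uv: "u \<in> Arr C" "v \<in> Arr C" "Dom C v = Dom C u" "Cod C u = Dom C g" "Cod C v = Dom C f" "g \<cdot> u = f \<cdot> v"
    for u v
  proof -
    obtain h where "h \<in> Arr C" "Dom C h = Dom C v" "Cod C h = Dom C p" "p \<cdot> h = v" "q \<cdot> h = u"
      by (rule pullback_factor[OF assms, of v u]) (use uv in auto)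
    then show ?thesis using uv D by (intro exI[of _ h]) simp
  qed
  show "h = k" if "h \<in> Arr C" "k \<in> Arr C" "Cod C h = Dom C q" "Cod C k = Dom C q" "Dom C k = Dom C h"
    "q \<cdot> h = q \<cdot> k" "p \<cdot> h = p \<cdot> k" for h k
    by (rule pullback_unique[OF assms]) (use that D in auto)
  show "g \<cdot> q = f \<cdot> p" using D(9) by simp
qed (use pullback_arrD[OF assms] in simp_all)

lemma pullback_postcomp:
  assumes pb: "is_pullback C f g p q" and m: "m \<in> Arr C" "Dom C m = Cod C f"
    and k: "k \<in> Arr C" "Dom C k = Cod C m" "Cod C k = Cod C f" "k \<cdot> m = Ident C (Cod C f)"
  shows "is_pullback C (m \<cdot> f) (m \<cdot> g) p q"
proof (rule pullbackI)
  note D = pullback_arrD[OF pb]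
  have cancel: "f' = g'" if eq: "m \<cdot> f' = m \<cdot> g'" and fg: "f' \<in> Arr C" "g' \<in> Arr C" "Cod C f' = Cod C f" "Cod C g' = Cod C f"
    for f' g'
  proof -
    have "k \<cdot> m \<cdot> f' = f'" "k \<cdot> m \<cdot> g' = g'"
      using Comp_eq_comp[OF k(4), of f'] Comp_eq_comp[OF k(4), of g'] m k(1-3) fg by simp_all
    then show ?thesis using eq by metis
  qed
  show "(m \<cdot> f) \<cdot> p = (m \<cdot> g) \<cdot> q" using D m by simp
  show "\<exists>h. h \<in> Arr C \<and> Dom C h = Dom C u \<and> Cod C h = Dom C p \<and> p \<cdot> h = u \<and> q \<cdot> h = v"
    if u: "u \<in> Arr C" "v \<in> Arr C" "Dom C v = Dom C u" "Cod C u = Dom C (m \<cdot> f)" "Cod C v = Dom C (m \<cdot> g)"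
      "(m \<cdot> f) \<cdot> u = (m \<cdot> g) \<cdot> v" for u v
  proof -
    have uv: "Cod C u = Dom C f" "Cod C v = Dom C g" using u(4,5) D m by simp_all
    have "f \<cdot> u = g \<cdot> v" by (rule cancel) (use u(1-3,6) uv D(1-8) m in simp_all)
    then obtain h where "h \<in> Arr C" "Dom C h = Dom C u" "Cod C h = Dom C p" "p \<cdot> h = u" "q \<cdot> h = v"
      using pullback_factor[OF pb u(1-3) uv] by blast
    then show ?thesis by blast
  qed
  show "h = k'" if "h \<in> Arr C" "k' \<in> Arr C" "Cod C h = Dom C p" "Cod C k' = Dom C p" "Dom C k' = Dom C h"
    "p \<cdot> h = p \<cdot> k'" "q \<cdot> h = q \<cdot> k'" for h k'
    by (rule pullback_unique[OF pb]) (use that in auto)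
qed (use pullback_arrD[OF pb] m in simp_all)

lemma monic_of_comp:
  assumes mono: "monic C (m \<cdot> f)" and f: "f \<in> Arr C" and m: "m \<in> Arr C" and cod: "Cod C f = Dom C m"
  shows "monic C f"
  unfolding monic_def
proof (intro conjI allI ballI impI)
  fix Z u v assume u: "u \<in> Hom C Z (Dom C f)" and v: "v \<in> Hom C Z (Dom C f)" and eq: "f \<cdot> u = f \<cdot> v"
  have "(m \<cdot> f) \<cdot> u = (m \<cdot> f) \<cdot> v" using u v f m cod eq by (simp add: Hom_iff)
  moreover have "u \<in> Hom C Z (Dom C (m \<cdot> f))" "v \<in> Hom C Z (Dom C (m \<cdot> f))" using u v f m cod by simp_all
  ultimately show "u = v" using mono unfolding monic_def by blast
qed (rule f)

lemma coproduct_iso: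
  assumes c: "is_coproduct C A B i j" and c': "is_coproduct C A B i' j'"
  obtains \<theta> \<theta>' where "\<theta> \<in> Arr C" "Dom C \<theta> = Cod C i" "Cod C \<theta> = Cod C i'"
    "\<theta>' \<in> Arr C" "Dom C \<theta>' = Cod C i'" "Cod C \<theta>' = Cod C i"
    "\<theta> \<cdot> i = i'" "\<theta> \<cdot> j = j'" "\<theta>' \<cdot> i' = i" "\<theta>' \<cdot> j' = j"
    "\<theta>' \<cdot> \<theta> = Ident C (Cod C i)" "\<theta> \<cdot> \<theta>' = Ident C (Cod C i')"
proof -
  have ij: "i \<in> Arr C" "Dom C i = A" "j \<in> Arr C" "Dom C j = B" "Cod C j = Cod C i"
    and ij': "i' \<in> Arr C" "Dom C i' = A" "j' \<in> Arr C" "Dom C j' = B" "Cod C j' = Cod C i'"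
    using c c' by (auto simp: is_coproduct_def Hom_iff)
  have u: "\<exists>!h. h \<in> Arr C \<and> Dom C h = Cod C i \<and> Cod C h = Y \<and> h \<cdot> i = f \<and> h \<cdot> j = g"
    if "f \<in> Arr C" "Dom C f = A" "Cod C f = Y" "g \<in> Arr C" "Dom C g = B" "Cod C g = Y" for f g Y
  proof -
    have "f \<in> Hom C A Y" "g \<in> Hom C B Y" using that by (simp_all add: Hom_iff)
    then have "\<exists>!h. h \<in> Hom C (Cod C i) Y \<and> h \<cdot> i = f \<and> h \<cdot> j = g"
      using c unfolding is_coproduct_def by blast
    then show ?thesis by (simp add: Hom_iff)
  qed
  have u': "\<exists>!h. h \<in> Arr C \<and> Dom C h = Cod C i' \<and> Cod C h = Y \<and> h \<cdot> i' = f \<and> h \<cdot> j' = g"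
    if "f \<in> Arr C" "Dom C f = A" "Cod C f = Y" "g \<in> Arr C" "Dom C g = B" "Cod C g = Y" for f g Y
  proof -
    have "f \<in> Hom C A Y" "g \<in> Hom C B Y" using that by (simp_all add: Hom_iff)
    then have "\<exists>!h. h \<in> Hom C (Cod C i') Y \<and> h \<cdot> i' = f \<and> h \<cdot> j' = g"
      using c' unfolding is_coproduct_def by blast
    then show ?thesis by (simp add: Hom_iff)
  qed
  obtain t where t: "t \<in> Arr C" "Dom C t = Cod C i" "Cod C t = Cod C i'" "t \<cdot> i = i'" "t \<cdot> j = j'"
    using u[of i' "Cod C i'" j'] ij' by auto
  obtain t' where t': "t' \<in> Arr C" "Dom C t' = Cod C i'" "Cod C t' = Cod C i" "t' \<cdot> i' = i" "t' \<cdot> j' = j"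
    using u'[of i "Cod C i" j] ij by auto
  have "t' \<cdot> t = Ident C (Cod C i)"
  proof -
    have "(t' \<cdot> t) \<cdot> i = i" "(t' \<cdot> t) \<cdot> j = j" using t t' ij by simp_all
    moreover have "Ident C (Cod C i) \<cdot> i = i" "Ident C (Cod C i) \<cdot> j = j" using ij by simp_all
    moreover have "t' \<cdot> t \<in> Arr C" "Dom C (t' \<cdot> t) = Cod C i" "Cod C (t' \<cdot> t) = Cod C i" using t t' by simp_all
    moreover have "\<exists>!h. h \<in> Arr C \<and> Dom C h = Cod C i \<and> Cod C h = Cod C i \<and> h \<cdot> i = i \<and> h \<cdot> j = j"
      by (rule u) (use ij in simp_all)
    moreover have "Ident C (Cod C i) \<in> Arr C" "Dom C (Ident C (Cod C i)) = Cod C i"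
      "Cod C (Ident C (Cod C i)) = Cod C i" using ij by simp_all
    ultimately show ?thesis by blast
  qed
  moreover have "t \<cdot> t' = Ident C (Cod C i')"
  proof -
    have "(t \<cdot> t') \<cdot> i' = i'" "(t \<cdot> t') \<cdot> j' = j'" using t t' ij' by simp_all
    moreover have "Ident C (Cod C i') \<cdot> i' = i'" "Ident C (Cod C i') \<cdot> j' = j'" using ij' by simp_all
    moreover have "t \<cdot> t' \<in> Arr C" "Dom C (t \<cdot> t') = Cod C i'" "Cod C (t \<cdot> t') = Cod C i'" using t t' by simp_all
    moreover have "\<exists>!h. h \<in> Arr C \<and> Dom C h = Cod C i' \<and> Cod C h = Cod C i' \<and> h \<cdot> i' = i' \<and> h \<cdot> j' = j'"
      by (rule u') (use ij' in simp_all)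
    moreover have "Ident C (Cod C i') \<in> Arr C" "Dom C (Ident C (Cod C i')) = Cod C i'"
      "Cod C (Ident C (Cod C i')) = Cod C i'" using ij' by simp_all
    ultimately show ?thesis by blast
  qed
  ultimately show thesis using t t' that by blast
qed

end

text \<open>
  Both the homotopy category and the homotopy exact completion are quotients by a congruence, so
  the passage between arrows and their representatives is set up once.
\<close>

locale category_congruence = category C for C :: "('o, 'm, 'z) cat_scheme" (structure) +
  fixes E :: "('m \<times> 'm) set"
  assumes equiv_E: "equiv (Arr C) E"
    and parallel_E: "(f, g) \<in> E \<Longrightarrow> Dom C g = Dom C f \<and> Cod C g = Cod C f"
    and comp_E: "(f, f') \<in> E \<Longrightarrow> (g, g') \<in> E \<Longrightarrow> Cod C f = Dom C g \<Longrightarrow> (g \<cdot> f, g' \<cdot> f') \<in> E"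
begin

lemma E_refl: "f \<in> Arr C \<Longrightarrow> (f, f) \<in> E"
  using equiv_E by (auto simp: equiv_def refl_on_def)

lemma class_eq_iff: "f \<in> Arr C \<Longrightarrow> g \<in> Arr C \<Longrightarrow> E `` {f} = E `` {g} \<longleftrightarrow> (f, g) \<in> E"
  using equiv_E by (simp add: eq_equiv_class_iff)

lemma Dom_class: "f \<in> Arr C \<Longrightarrow> Dom (quotient_cat C E) (E `` {f}) = Dom C f"
proof -
  assume "f \<in> Arr C"
  then have "Dom C ` (E `` {f}) = {Dom C f}" using E_refl parallel_E by (auto intro: image_eqI)
  then show ?thesis by (simp add: quotient_cat_def)
qed

lemma Cod_class: "f \<in> Arr C \<Longrightarrow> Cod (quotient_cat C E) (E `` {f}) = Cod C f"
proof -
  assume "f \<in> Arr C"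
  then have "Cod C ` (E `` {f}) = {Cod C f}" using E_refl parallel_E by (auto intro: image_eqI)
  then show ?thesis by (simp add: quotient_cat_def)
qed

lemma Comp_class:
  assumes "f \<in> Arr C" "g \<in> Arr C" "Cod C f = Dom C g"
  shows "Comp (quotient_cat C E) (E `` {g}) (E `` {f}) = E `` {g \<cdot> f}"
proof -
  have tr: "(x, z) \<in> E" if "(x, y) \<in> E" "(y, z) \<in> E" for x y z
    using equiv_E that by (auto simp: equiv_def trans_def)
  have "E `` {g' \<cdot> f' | g' f'. g' \<in> E `` {g} \<and> f' \<in> E `` {f}} = E `` {g \<cdot> f}"
  proof (intro equalityI subsetI)
    fix x assume "x \<in> E `` {g' \<cdot> f' | g' f'. g' \<in> E `` {g} \<and> f' \<in> E `` {f}}"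
    then obtain g' f' where gf: "(g, g') \<in> E" "(f, f') \<in> E" "(g' \<cdot> f', x) \<in> E" by auto
    with comp_E[OF gf(2) gf(1)] assms(3) show "x \<in> E `` {g \<cdot> f}" by (auto intro: tr)
  next
    fix x assume "x \<in> E `` {g \<cdot> f}"
    then show "x \<in> E `` {g' \<cdot> f' | g' f'. g' \<in> E `` {g} \<and> f' \<in> E `` {f}}"
      using E_refl[OF assms(1)] E_refl[OF assms(2)] by auto
  qed
  then show ?thesis by (simp add: quotient_cat_def)
qed

lemma Hom_quotient_iff:
  "\<alpha> \<in> Hom (quotient_cat C E) A B \<longleftrightarrow>
    (\<exists>f. f \<in> Arr C \<and> Dom C f = A \<and> Cod C f = B \<and> \<alpha> = E `` {f})"
  (is "?L \<longleftrightarrow> ?R")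
proof
  assume L: ?L
  then have "\<alpha> \<in> Arr C // E" by (simp add: Hom_def quotient_cat_def)
  then obtain f where "f \<in> Arr C" "\<alpha> = E `` {f}" by (auto elim: quotientE)
  with L show ?R using Dom_class Cod_class by (auto simp: Hom_def)
next
  assume ?R
  then obtain f where f: "f \<in> Arr C" "Dom C f = A" "Cod C f = B" "\<alpha> = E `` {f}" by blast
  then have "\<alpha> \<in> Arr (quotient_cat C E)" by (auto simp: quotient_cat_def intro: quotientI)
  with f show ?L using Dom_class Cod_class by (auto simp: Hom_def)
qed

lemma Hom_quotientE:
  assumes "\<alpha> \<in> Hom (quotient_cat C E) A B"
  obtains f where "f \<in> Arr C" "Dom C f = A" "Cod C f = B" "\<alpha> = E `` {f}"
  using assms unfolding Hom_quotient_iff by auto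

lemma Ident_class: "Ident (quotient_cat C E) A = E `` {Ident C A}"
  by (simp add: quotient_cat_def)

lemma category_quotient: "category (quotient_cat C E)"
proof
  fix \<alpha> assume "\<alpha> \<in> Arr (quotient_cat C E)"
  then have "\<alpha> \<in> Hom (quotient_cat C E) (Dom (quotient_cat C E) \<alpha>) (Cod (quotient_cat C E) \<alpha>)"
    by (simp add: Hom_def)
  then obtain f where f: "f \<in> Arr C" "Dom C f = Dom (quotient_cat C E) \<alpha>"
    "Cod C f = Cod (quotient_cat C E) \<alpha>"
    by (elim Hom_quotientE)
  show "Dom (quotient_cat C E) \<alpha> \<in> Obj (quotient_cat C E)"
    unfolding f(2)[symmetric] using f(1) by (simp add: quotient_cat_def)
  show "Cod (quotient_cat C E) \<alpha> \<in> Obj (quotient_cat C E)"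
    unfolding f(3)[symmetric] using f(1) by (simp add: quotient_cat_def)
next
  fix A assume "A \<in> Obj (quotient_cat C E)"
  then have "A \<in> Obj C" by (simp add: quotient_cat_def)
  then show "Ident (quotient_cat C E) A \<in> Hom (quotient_cat C E) A A"
    unfolding Hom_quotient_iff Ident_class by (intro exI[of _ "Ident C A"]) simp
next
  fix \<alpha> \<beta> A B D
  assume "\<alpha> \<in> Hom (quotient_cat C E) A B" "\<beta> \<in> Hom (quotient_cat C E) B D"
  then obtain f g where "f \<in> Arr C" "Dom C f = A" "Cod C f = B" "\<alpha> = E `` {f}"
    "g \<in> Arr C" "Dom C g = B" "Cod C g = D" "\<beta> = E `` {g}"
    by (elim Hom_quotientE)
  then show "Comp (quotient_cat C E) \<beta> \<alpha> \<in> Hom (quotient_cat C E) A D"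
    unfolding Hom_quotient_iff by (intro exI[of _ "g \<cdot> f"]) (simp add: Comp_class)
next
  fix \<alpha> A B assume "\<alpha> \<in> Hom (quotient_cat C E) A B"
  then obtain f where f: "f \<in> Arr C" "Dom C f = A" "Cod C f = B" "\<alpha> = E `` {f}"
    by (elim Hom_quotientE)
  then show "Comp (quotient_cat C E) (Ident (quotient_cat C E) B) \<alpha> = \<alpha>"
    "Comp (quotient_cat C E) \<alpha> (Ident (quotient_cat C E) A) = \<alpha>"
    unfolding Ident_class using Comp_class[of f "Ident C B"] Comp_class[of "Ident C A" f] by auto
next
  fix \<alpha> \<beta> \<gamma> A B D F
  assume "\<alpha> \<in> Hom (quotient_cat C E) A B" "\<beta> \<in> Hom (quotient_cat C E) B D"
    "\<gamma> \<in> Hom (quotient_cat C E) D F"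
  then obtain f g h where "f \<in> Arr C" "Dom C f = A" "Cod C f = B" "\<alpha> = E `` {f}"
    "g \<in> Arr C" "Dom C g = B" "Cod C g = D" "\<beta> = E `` {g}"
    "h \<in> Arr C" "Dom C h = D" "Cod C h = F" "\<gamma> = E `` {h}"
    by (elim Hom_quotientE)
  then show "Comp (quotient_cat C E) \<gamma> (Comp (quotient_cat C E) \<beta> \<alpha>) =
      Comp (quotient_cat C E) (Comp (quotient_cat C E) \<gamma> \<beta>) \<alpha>"
    by (simp add: Comp_class)
qed

end

section \<open>Path categories\<close>

context path_category
begin

lemma Fib_ArrD [simp]: "f \<in> Fib C \<Longrightarrow> f \<in> Arr C"
  using Fib_Arr by blast

lemma Weq_ArrD: "f \<in> Weq C \<Longrightarrow> f \<in> Arr C"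
  using Weq_Arr by blast

lemma Fib_Ident [simp]: "A \<in> Obj C \<Longrightarrow> Ident C A \<in> Fib C"
  using iso_acyclic_Fib is_iso_Ident by blast

lemma Weq_Ident: "A \<in> Obj C \<Longrightarrow> Ident C A \<in> Weq C"
  using iso_acyclic_Fib is_iso_Ident by blast

lemma Weq_cancel_right:
  assumes "f \<in> Weq C" "g \<in> Arr C" "Cod C f = Dom C g" "g \<cdot> f \<in> Weq C"
  shows "g \<in> Weq C"
  using two_out_of_six[of "Ident C (Dom C f)" "Dom C f" "Dom C f" f "Dom C g" g "Cod C g"]
    assms Weq_ArrD[of f] by (auto simp: Hom_iff)

lemma Weq_cancel_left:
  assumes "g \<in> Weq C" "f \<in> Arr C" "Cod C f = Dom C g" "g \<cdot> f \<in> Weq C"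
  shows "f \<in> Weq C"
  using two_out_of_six[of f "Dom C f" "Dom C g" g "Cod C g" "Ident C (Cod C g)" "Cod C g"]
    assms Weq_ArrD[of g] by (auto simp: Hom_iff)

lemma Fib_pullback_obtain:
  assumes "f \<in> Fib C" "g \<in> Arr C" "Cod C g = Cod C f"
  obtains p q where "is_pullback C f g p q" "q \<in> Fib C"
  using Fib_pullback_ex[OF assms] Fib_pullback[OF assms(1)] by blast

subsection \<open>Products\<close>

lemma terminal_map:
  obtains T t where "T \<in> Obj C" "\<And>A. A \<in> Obj C \<Longrightarrow> t A \<in> Fib C \<and> Dom C (t A) = A \<and> Cod C (t A) = T"
    "\<And>f g. f \<in> Arr C \<Longrightarrow> g \<in> Arr C \<Longrightarrow> Dom C f = Dom C g \<Longrightarrow> Cod C f = T \<Longrightarrow> Cod C g = T \<Longrightarrow> f = g"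
proof -
  from terminal_ex obtain T where T: "terminal C T" "\<And>X. Hom C X T \<subseteq> Fib C" by blast
  define t where "t A = (THE f. f \<in> Hom C A T)" for A
  have "t A \<in> Hom C A T" if "A \<in> Obj C" for A
    using T(1) that unfolding t_def terminal_def by - (rule theI', simp)
  then have "t A \<in> Fib C \<and> Dom C (t A) = A \<and> Cod C (t A) = T" if "A \<in> Obj C" for A
    using T(2)[of A] that by (auto simp: Hom_iff)
  moreover have "f = g" if "f \<in> Arr C" "g \<in> Arr C" "Dom C f = Dom C g" "Cod C f = T" "Cod C g = T"
    for f g
  proof -
    have "\<exists>!h. h \<in> Hom C (Dom C f) T" using T(1) that(1) by (simp add: terminal_def)
    then show ?thesis using that by (auto simp: Hom_iff)
  qed
  ultimately show thesis using T(1) that[of T t] unfolding terminal_def by blast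
qed

lemma product_projections:
  assumes "A \<in> Obj C" "B \<in> Obj C"
  shows "is_product C A B (pr1 C A B) (pr2 C A B)"
proof -
  obtain T t where T: "T \<in> Obj C" "\<And>A. A \<in> Obj C \<Longrightarrow> t A \<in> Fib C \<and> Dom C (t A) = A \<and> Cod C (t A) = T"
    "\<And>f g. f \<in> Arr C \<Longrightarrow> g \<in> Arr C \<Longrightarrow> Dom C f = Dom C g \<Longrightarrow> Cod C f = T \<Longrightarrow> Cod C g = T \<Longrightarrow> f = g"
    by (rule terminal_map, rule that)
  obtain p q where pb: "is_pullback C (t A) (t B) p q"
    by (rule Fib_pullback_obtain[of "t A" "t B"]) (use T(2) assms in auto)
  have D: "p \<in> Arr C" "q \<in> Arr C" "Cod C p = A" "Cod C q = B" "Dom C q = Dom C p"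
    using pullback_arrD[OF pb] T assms by auto
  have "is_product C A B p q"
    unfolding is_product_def
  proof (intro conjI allI ballI)
    fix Y f g assume f: "f \<in> Hom C Y A" and g: "g \<in> Hom C Y B"
    then have eq: "t A \<cdot> f = t B \<cdot> g" using T(2) assms by (intro T(3)) (auto simp: Hom_iff)
    obtain h where h: "h \<in> Arr C" "Dom C h = Dom C f" "Cod C h = Dom C p" "p \<cdot> h = f" "q \<cdot> h = g"
      using pullback_factor[OF pb, of f g] f g eq T(2) assms by (auto simp: Hom_iff)
    then show "\<exists>!h. h \<in> Hom C Y (Dom C p) \<and> p \<cdot> h = f \<and> q \<cdot> h = g"
      using f g pullback_unique[OF pb] by (intro ex1I[of _ h]) (auto simp: Hom_iff)
  qed (use D in \<open>auto simp: Hom_iff\<close>)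
  then have "\<exists>pq. is_product C A B (fst pq) (snd pq)" by auto
  then show ?thesis unfolding pr1_def pr2_def prod_proj_def by (rule someI_ex)
qed

lemma pr_simps [simp]:
  assumes "A \<in> Obj C" "B \<in> Obj C"
  shows "pr1 C A B \<in> Arr C" "pr2 C A B \<in> Arr C" "Dom C (pr1 C A B) = Prod C A B"
    "Dom C (pr2 C A B) = Prod C A B" "Cod C (pr1 C A B) = A" "Cod C (pr2 C A B) = B"
  using product_projections[OF assms] by (auto simp: is_product_def Hom_iff Prod_def)

lemma Prod_Obj [simp]: "A \<in> Obj C \<Longrightarrow> B \<in> Obj C \<Longrightarrow> Prod C A B \<in> Obj C"
  using Dom_Obj[of "pr1 C A B"] by simp

lemma pairing_ex1:
  assumes "f \<in> Arr C" "g \<in> Arr C" "Dom C g = Dom C f"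
  shows "\<exists>!h. h \<in> Hom C (Dom C f) (Prod C (Cod C f) (Cod C g)) \<and>
     pr1 C (Cod C f) (Cod C g) \<cdot> h = f \<and> pr2 C (Cod C f) (Cod C g) \<cdot> h = g"
  using product_projections[of "Cod C f" "Cod C g"] assms by (auto simp: is_product_def Hom_iff)

lemma pairing_typed:
  assumes "f \<in> Arr C" "g \<in> Arr C" "Dom C g = Dom C f"
  shows "pairing C f g \<in> Hom C (Dom C f) (Prod C (Cod C f) (Cod C g)) \<and>
     pr1 C (Cod C f) (Cod C g) \<cdot> pairing C f g = f \<and> pr2 C (Cod C f) (Cod C g) \<cdot> pairing C f g = g"
  unfolding pairing_def by (rule theI'[OF pairing_ex1[OF assms]])

lemma pairing_simps [simp]:
  assumes "f \<in> Arr C" "g \<in> Arr C" "Dom C g = Dom C f"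
  shows "pairing C f g \<in> Arr C" "Dom C (pairing C f g) = Dom C f"
    "Cod C (pairing C f g) = Prod C (Cod C f) (Cod C g)"
    "Cod C f = A \<Longrightarrow> Cod C g = B \<Longrightarrow> pr1 C A B \<cdot> pairing C f g = f"
    "Cod C f = A \<Longrightarrow> Cod C g = B \<Longrightarrow> pr2 C A B \<cdot> pairing C f g = g"
  using pairing_typed[OF assms] by (auto simp: Hom_iff)

lemma Prod_ext:
  assumes "h \<in> Arr C" "k \<in> Arr C" "Dom C k = Dom C h" "Cod C h = Prod C A B" "Cod C k = Prod C A B"
    "A \<in> Obj C" "B \<in> Obj C" "pr1 C A B \<cdot> h = pr1 C A B \<cdot> k" "pr2 C A B \<cdot> h = pr2 C A B \<cdot> k"
  shows "h = k"
proof -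
  have "\<exists>!l. l \<in> Hom C (Dom C h) (Dom C (pr1 C A B)) \<and> pr1 C A B \<cdot> l = pr1 C A B \<cdot> h \<and>
      pr2 C A B \<cdot> l = pr2 C A B \<cdot> h"
    using product_projections[of A B] assms by (auto simp: is_product_def Hom_iff)
  then show ?thesis using assms by (auto simp: Hom_iff)
qed

lemma pairing_comp [simp]:
  assumes "f \<in> Arr C" "g \<in> Arr C" "Dom C g = Dom C f" "h \<in> Arr C" "Cod C h = Dom C f"
  shows "pairing C f g \<cdot> h = pairing C (f \<cdot> h) (g \<cdot> h)"
proof (rule Prod_ext[of _ _ "Cod C f" "Cod C g"])
  show "pr1 C (Cod C f) (Cod C g) \<cdot> pairing C f g \<cdot> h =
    pr1 C (Cod C f) (Cod C g) \<cdot> pairing C (f \<cdot> h) (g \<cdot> h)"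
    using assms by (subst Comp_assoc'[symmetric]) auto
  show "pr2 C (Cod C f) (Cod C g) \<cdot> pairing C f g \<cdot> h =
    pr2 C (Cod C f) (Cod C g) \<cdot> pairing C (f \<cdot> h) (g \<cdot> h)"
    using assms by (subst Comp_assoc'[symmetric]) auto
qed (use assms in auto)

lemma pairing_eta:
  assumes "h \<in> Arr C" "Cod C h = Prod C A B" "A \<in> Obj C" "B \<in> Obj C"
  shows "pairing C (pr1 C A B \<cdot> h) (pr2 C A B \<cdot> h) = h"
  by (rule Prod_ext[of _ _ A B]) (use assms in auto)

lemma prod_map_simps [simp]:
  assumes "f \<in> Arr C" "g \<in> Arr C"
  shows "prod_map C f g \<in> Arr C" "Dom C (prod_map C f g) = Prod C (Dom C f) (Dom C g)"
    "Cod C (prod_map C f g) = Prod C (Cod C f) (Cod C g)"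
  using assms by (auto simp: prod_map_def)

lemma prod_map_comp:
  assumes "f \<in> Arr C" "g \<in> Arr C" "h \<in> Arr C" "Cod C h = Prod C (Dom C f) (Dom C g)"
  shows "prod_map C f g \<cdot> h =
    pairing C (f \<cdot> pr1 C (Dom C f) (Dom C g) \<cdot> h) (g \<cdot> pr2 C (Dom C f) (Dom C g) \<cdot> h)"
  using assms by (auto simp: prod_map_def)

lemma prod_map_pairing [simp]:
  assumes "f \<in> Arr C" "g \<in> Arr C" "x \<in> Arr C" "y \<in> Arr C" "Dom C y = Dom C x"
    "Cod C x = Dom C f" "Cod C y = Dom C g"
  shows "prod_map C f g \<cdot> pairing C x y = pairing C (f \<cdot> x) (g \<cdot> y)"
  using assms by (subst prod_map_comp) auto

lemma diag_comp:
  assumes "x \<in> Arr C" "Cod C x = A"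
  shows "diag C A \<cdot> x = pairing C x x"
  using assms unfolding diag_def by (subst pairing_comp) (auto simp: Arr_Obj)

lemma diag_simps [simp]:
  "A \<in> Obj C \<Longrightarrow> diag C A \<in> Arr C" "A \<in> Obj C \<Longrightarrow> Dom C (diag C A) = A"
  "A \<in> Obj C \<Longrightarrow> Cod C (diag C A) = Prod C A A"
  by (auto simp: diag_def)

lemma pr_Fib [simp]:
  assumes "A \<in> Obj C" "B \<in> Obj C"
  shows "pr1 C A B \<in> Fib C" "pr2 C A B \<in> Fib C"
proof -
  obtain T t where T: "T \<in> Obj C" "\<And>A. A \<in> Obj C \<Longrightarrow> t A \<in> Fib C \<and> Dom C (t A) = A \<and> Cod C (t A) = T"
    "\<And>f g. f \<in> Arr C \<Longrightarrow> g \<in> Arr C \<Longrightarrow> Dom C f = Dom C g \<Longrightarrow> Cod C f = T \<Longrightarrow> Cod C g = T \<Longrightarrow> f = g"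
    by (rule terminal_map, rule that)
  have pair: "\<exists>h. h \<in> Arr C \<and> Dom C h = Dom C u \<and> Cod C h = Prod C A B \<and>
      pr1 C A B \<cdot> h = u \<and> pr2 C A B \<cdot> h = v"
    if "u \<in> Arr C" "v \<in> Arr C" "Dom C v = Dom C u" "Cod C u = A" "Cod C v = B" for u v
    using that by (intro exI[of _ "pairing C u v"]) auto
  have "is_pullback C (t A) (t B) (pr1 C A B) (pr2 C A B)"
    by (rule pullbackI) (use assms T(2) pair in \<open>auto intro: T(3) Prod_ext[of _ _ A B]\<close>)
  then show "pr2 C A B \<in> Fib C" using Fib_pullback T assms by blast
  have "\<exists>h. h \<in> Arr C \<and> Dom C h = Dom C v \<and> Cod C h = Prod C A B \<and>
      pr2 C A B \<cdot> h = v \<and> pr1 C A B \<cdot> h = u"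
    if "v \<in> Arr C" "u \<in> Arr C" "Dom C u = Dom C v" "Cod C u = A" "Cod C v = B" for u v
    using pair[of u v] that by auto
  then have "is_pullback C (t B) (t A) (pr2 C A B) (pr1 C A B)"
    by (intro pullbackI) (use assms T(2) in \<open>auto intro: T(3) Prod_ext[of _ _ A B]\<close>)
  then show "pr1 C A B \<in> Fib C" using Fib_pullback T assms by blast
qed

subsection \<open>Path objects, factorisation and lifting\<close>

lemma path_objectD:
  assumes "path_object C B r st"
  shows "B \<in> Obj C" "r \<in> Arr C" "Dom C r = B" "Cod C r = Dom C st" "r \<in> Weq C"
    "st \<in> Fib C" "Cod C st = Prod C B B" "st \<cdot> r = diag C B"
  using assms unfolding path_object_def Hom_iff by auto

lemma path_object_ends:
  assumes "path_object C B r st"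
  shows "pr1 C B B \<cdot> st \<in> Fib C \<inter> Weq C" "pr2 C B B \<cdot> st \<in> Fib C \<inter> Weq C"
    "pr1 C B B \<cdot> st \<cdot> r = Ident C B" "pr2 C B B \<cdot> st \<cdot> r = Ident C B"
proof -
  note P = path_objectD[OF assms]
  show *: "pr1 C B B \<cdot> st \<cdot> r = Ident C B" "pr2 C B B \<cdot> st \<cdot> r = Ident C B"
    using P by (auto simp: diag_def)
  show "pr1 C B B \<cdot> st \<in> Fib C \<inter> Weq C" "pr2 C B B \<cdot> st \<in> Fib C \<inter> Weq C"
    using P * Weq_cancel_right[OF P(5), of "pr1 C B B \<cdot> st"]
      Weq_cancel_right[OF P(5), of "pr2 C B B \<cdot> st"] by (auto intro!: Fib_Comp simp: Weq_Ident)
qed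

text \<open>
  Every map is a weak equivalence followed by a fibration: replace the source of \<open>f\<close> by the
  object of pairs of a point \<open>a\<close> and a path starting in \<open>f a\<close>.
\<close>

lemma factorisation:
  assumes f: "f \<in> Arr C"
  obtains w p where "w \<in> Weq C" "p \<in> Fib C" "Dom C w = Dom C f" "Cod C w = Dom C p"
    "Cod C p = Cod C f" "p \<cdot> w = f"
proof -
  define A B where "A = Dom C f" and "B = Cod C f"
  have AB: "A \<in> Obj C" "B \<in> Obj C" "Dom C f = A" "Cod C f = B" using f by (auto simp: A_def B_def)
  obtain r st where po: "path_object C B r st" using path_object_ex AB by blast
  note P = path_objectD[OF po] and Q = path_object_ends[OF po]
  obtain u v where pb: "is_pullback C st (prod_map C f (Ident C B)) u v" and v: "v \<in> Fib C"
    using Fib_pullback_obtain[of st "prod_map C f (Ident C B)"] P f AB by auto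
  have uv: "u \<in> Arr C" "v \<in> Arr C" "Cod C u = Dom C st" "Cod C v = Prod C A B" "Dom C v = Dom C u"
    using pullback_arrD[OF pb] f AB by auto
  have eq: "st \<cdot> u = pairing C (f \<cdot> pr1 C A B \<cdot> v) (pr2 C A B \<cdot> v)"
    using pullback_arrD(9)[OF pb] prod_map_comp[of f "Ident C B" v] uv f AB by simp
  have "st \<cdot> r \<cdot> f = prod_map C f (Ident C B) \<cdot> pairing C (Ident C A) f"
    using P f AB diag_comp[of f B] Comp_assoc'[of f r st] by simp
  then obtain w where w: "w \<in> Arr C" "Dom C w = A" "Cod C w = Dom C u"
    "u \<cdot> w = r \<cdot> f" "v \<cdot> w = pairing C (Ident C A) f"
    using pullback_factor[OF pb, of "r \<cdot> f" "pairing C (Ident C A) f"] P f AB by auto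
  have "is_pullback C (pr1 C B B \<cdot> st) f u (pr1 C A B \<cdot> v)"
  proof (rule pullbackI)
    show "(pr1 C B B \<cdot> st) \<cdot> u = f \<cdot> pr1 C A B \<cdot> v"
      using uv P f AB eq by simp
  next
    fix x y assume x: "x \<in> Arr C" "Cod C x = Dom C (pr1 C B B \<cdot> st)"
      and y: "y \<in> Arr C" "Dom C y = Dom C x" "Cod C y = Dom C f"
      and xy: "(pr1 C B B \<cdot> st) \<cdot> x = f \<cdot> y"
    have x': "Cod C x = Dom C st" using x P by simp
    have "st \<cdot> x = pairing C (pr1 C B B \<cdot> st \<cdot> x) (pr2 C B B \<cdot> st \<cdot> x)"
      using P x x' by (intro pairing_eta[symmetric]) auto
    also have "\<dots> = prod_map C f (Ident C B) \<cdot> pairing C y (pr2 C B B \<cdot> st \<cdot> x)"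
      using P x x' y xy f AB by simp
    finally obtain h where "h \<in> Arr C" "Dom C h = Dom C x" "Cod C h = Dom C u" "u \<cdot> h = x"
      "v \<cdot> h = pairing C y (pr2 C B B \<cdot> st \<cdot> x)"
      using pullback_factor[OF pb, of x "pairing C y (pr2 C B B \<cdot> st \<cdot> x)"] P x x' y f AB by auto
    then show "\<exists>h. h \<in> Arr C \<and> Dom C h = Dom C x \<and> Cod C h = Dom C u \<and> u \<cdot> h = x \<and>
        (pr1 C A B \<cdot> v) \<cdot> h = y"
      using P x x' y f AB uv by (intro exI[of _ h]) auto
  next
    fix h k assume h: "h \<in> Arr C" "Cod C h = Dom C u" and k: "k \<in> Arr C" "Cod C k = Dom C u"
      "Dom C k = Dom C h" and u: "u \<cdot> h = u \<cdot> k" and q: "(pr1 C A B \<cdot> v) \<cdot> h = (pr1 C A B \<cdot> v) \<cdot> k"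
    have *: "pr2 C A B \<cdot> v \<cdot> l = pr2 C B B \<cdot> st \<cdot> u \<cdot> l" if "l \<in> Arr C" "Cod C l = Dom C u" for l
    proof -
      have "pr2 C B B \<cdot> st \<cdot> u \<cdot> l = (pr2 C B B \<cdot> (st \<cdot> u)) \<cdot> l" using P uv that by simp
      also have "\<dots> = pr2 C A B \<cdot> v \<cdot> l" unfolding eq using uv AB f that by simp
      finally show ?thesis by simp
    qed
    have "pr1 C A B \<cdot> v \<cdot> h = pr1 C A B \<cdot> v \<cdot> k" using q h k AB uv by simp
    moreover have "pr2 C A B \<cdot> v \<cdot> h = pr2 C A B \<cdot> v \<cdot> k" using *[of h] *[of k] u h k by simp
    ultimately have "v \<cdot> h = v \<cdot> k"
      using h k AB uv by (intro Prod_ext[of "v \<cdot> h" "v \<cdot> k" A B]) simp_all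
    then show "h = k"
      using pullback_unique[OF pb h k(1,2,3) u] by simp
  qed (use uv P f AB in auto)
  then have q: "pr1 C A B \<cdot> v \<in> Weq C" using acyclic_Fib_pullback Q by blast
  have "w \<in> Weq C"
    using Weq_cancel_left[OF q, of w] w uv AB by (auto simp: Weq_Ident f)
  then show thesis
    using w uv AB f v by (intro that[of w "pr2 C A B \<cdot> v"]) (auto intro: Fib_Comp)
qed

text \<open>
  Factorising the comparison map into the pullback of \<open>p\<close> along \<open>g\<close> yields an acyclic fibration
  over the target of \<open>w\<close>, by 2-out-of-3; any section of it gives a map over \<open>g\<close>.
\<close>

lemma lifting:
  assumes w: "w \<in> Weq C" and p: "p \<in> Fib C" and f: "f \<in> Arr C" "Dom C f = Dom C w" "Cod C f = Dom C p"
    and g: "g \<in> Arr C" "Dom C g = Cod C w" "Cod C g = Cod C p" and eq: "p \<cdot> f = g \<cdot> w"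
  obtains l where "l \<in> Arr C" "Dom C l = Cod C w" "Cod C l = Dom C p" "p \<cdot> l = g"
proof -
  have wA: "w \<in> Arr C" using w Weq_ArrD by blast
  obtain u v where pb: "is_pullback C p g u v" and v: "v \<in> Fib C"
    using Fib_pullback_obtain[of p g] p g by auto
  note D = pullback_arrD[OF pb]
  obtain m where m: "m \<in> Arr C" "Dom C m = Dom C w" "Cod C m = Dom C u" "u \<cdot> m = f" "v \<cdot> m = w"
    by (rule pullback_factor[OF pb, of f w]) (use f wA g eq in auto)
  obtain w' q where q: "w' \<in> Weq C" "q \<in> Fib C" "Dom C w' = Dom C m" "Cod C w' = Dom C q"
    "Cod C q = Cod C m" "q \<cdot> w' = m"
    using factorisation[OF m(1)] by blast
  have w'A: "w' \<in> Arr C" using q Weq_ArrD by blast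
  have vqf: "v \<cdot> q \<in> Fib C" using q(5) m(3) D(8) by (intro Fib_Comp q v) simp
  have "(v \<cdot> q) \<cdot> w' = w" using q m D w'A by simp
  then have "v \<cdot> q \<in> Weq C" by - (rule Weq_cancel_right[OF q(1)], use q m D w in auto)
  then obtain s where s: "s \<in> Hom C (Cod C (v \<cdot> q)) (Dom C (v \<cdot> q))"
    "(v \<cdot> q) \<cdot> s = Ident C (Cod C (v \<cdot> q))"
    using acyclic_Fib_section[of "v \<cdot> q"] vqf by (meson IntI)
  have s': "s \<in> Arr C" "Dom C s = Dom C g" "Cod C s = Dom C q" "v \<cdot> q \<cdot> s = Ident C (Dom C g)"
    using s q m D by (auto simp: Hom_iff)
  have "p \<cdot> u \<cdot> q \<cdot> s = (p \<cdot> u) \<cdot> q \<cdot> s" using s' q m D by (subst Comp_assoc') auto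
  also have "\<dots> = g \<cdot> v \<cdot> q \<cdot> s" using s' q m D by (subst D(9), subst Comp_assoc') auto
  also have "\<dots> = g" using s' g by simp
  finally show thesis using s' q m D g by (intro that[of "u \<cdot> q \<cdot> s"]) auto
qed

end

section \<open>Fibrations as predicates\<close>

text \<open>
  A fibration into \<open>X\<close> is read as a predicate on generalised elements of \<open>X\<close>: it holds of \<open>g\<close>
  when \<open>g\<close> factors through it.  Closure of fibrations under pullback and composition turns into
  closure of such predicates under substitution, conjunction and existential quantification,
  where a witness of an existential statement is an actual map.
\<close>

context path_category
begin

definition lifts :: "'m \<Rightarrow> 'm \<Rightarrow> bool" where
  "lifts p g \<longleftrightarrow> (\<exists>h. h \<in> Arr C \<and> Cod C h = Dom C p \<and> p \<cdot> h = g)"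

lemma liftsI: "h \<in> Arr C \<Longrightarrow> Cod C h = Dom C p \<Longrightarrow> p \<cdot> h = g \<Longrightarrow> lifts p g"
  unfolding lifts_def by blast

lemma liftsE:
  assumes "lifts p g" "p \<in> Arr C"
  obtains h where "h \<in> Arr C" "Dom C h = Dom C g" "Cod C h = Dom C p" "p \<cdot> h = g"
  using assms unfolding lifts_def by (metis Comp_simps(2))

lemma lifts_comp:
  assumes "lifts p g" "p \<in> Arr C" "k \<in> Arr C" "Cod C k = Dom C g"
  shows "lifts p (g \<cdot> k)"
proof -
  obtain h where h: "h \<in> Arr C" "Dom C h = Dom C g" "Cod C h = Dom C p" "p \<cdot> h = g"
    by (rule liftsE[OF assms(1,2)])
  have "p \<cdot> h \<cdot> k = g \<cdot> k"
    using Comp_assoc'[of k h p] h assms(2-) by simp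
  then show ?thesis using h assms by (intro liftsI[of "h \<cdot> k"]) simp_all
qed

lemma lifts_reindex:
  assumes p: "p \<in> Fib C" and f: "f \<in> Arr C" "Cod C f = Cod C p"
  obtains p' where "p' \<in> Fib C" "Cod C p' = Dom C f"
    "\<And>g. g \<in> Arr C \<Longrightarrow> Cod C g = Dom C f \<Longrightarrow> lifts p' g \<longleftrightarrow> lifts p (f \<cdot> g)"
proof -
  obtain u v where pb: "is_pullback C p f u v" and v: "v \<in> Fib C"
    by (rule Fib_pullback_obtain[OF p f])
  note D = pullback_arrD[OF pb]
  have "lifts v g \<longleftrightarrow> lifts p (f \<cdot> g)" if g: "g \<in> Arr C" "Cod C g = Dom C f" for g
  proof
    assume "lifts v g"
    then obtain h where h: "h \<in> Arr C" "Dom C h = Dom C g" "Cod C h = Dom C v" "v \<cdot> h = g"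
      using D(4) by (rule liftsE)
    have "p \<cdot> u \<cdot> h = f \<cdot> g" using pullback_square[OF pb h(1)] D h by simp
    then show "lifts p (f \<cdot> g)"
      using D h g by (intro liftsI[of "u \<cdot> h"]) simp_all
  next
    assume "lifts p (f \<cdot> g)"
    then obtain k where k: "k \<in> Arr C" "Dom C k = Dom C (f \<cdot> g)" "Cod C k = Dom C p" "p \<cdot> k = f \<cdot> g"
      using D(1) by (rule liftsE)
    obtain h where "h \<in> Arr C" "Dom C h = Dom C k" "Cod C h = Dom C u" "v \<cdot> h = g"
      by (rule pullback_factor[OF pb, of k g]) (use k g D in auto)
    then show "lifts v g"
      using D by (intro liftsI[of h]) simp_all
  qed
  then show thesis using that v D by auto
qed

lemma lifts_conj:
  assumes p: "p \<in> Fib C" and q: "q \<in> Fib C" "Cod C q = Cod C p"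
  obtains p' where "p' \<in> Fib C" "Cod C p' = Cod C p"
    "\<And>g. g \<in> Arr C \<Longrightarrow> Cod C g = Cod C p \<Longrightarrow> lifts p' g \<longleftrightarrow> lifts p g \<and> lifts q g"
proof -
  obtain p1 where p1: "p1 \<in> Fib C" "Cod C p1 = Dom C q"
    "\<And>g. g \<in> Arr C \<Longrightarrow> Cod C g = Dom C q \<Longrightarrow> lifts p1 g \<longleftrightarrow> lifts p (q \<cdot> g)"
    by (rule lifts_reindex[OF p, of q]) (use q in auto)
  have "lifts (q \<cdot> p1) g \<longleftrightarrow> lifts p g \<and> lifts q g" if g: "g \<in> Arr C" "Cod C g = Cod C p" for g
  proof
    assume "lifts (q \<cdot> p1) g"
    then obtain h where h: "h \<in> Arr C" "Cod C h = Dom C p1" "q \<cdot> p1 \<cdot> h = g"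
      using p1(1,2) q by (elim liftsE) simp_all
    have "lifts p1 (p1 \<cdot> h)" using h by (intro liftsI[of h]) simp_all
    then have "lifts p g" using p1(3)[of "p1 \<cdot> h"] h p1(1,2) by simp
    moreover have "lifts q g" using h p1(1,2) q by (intro liftsI[of "p1 \<cdot> h"]) simp_all
    ultimately show "lifts p g \<and> lifts q g" by simp
  next
    assume *: "lifts p g \<and> lifts q g"
    then obtain h where h: "h \<in> Arr C" "Cod C h = Dom C q" "q \<cdot> h = g"
      unfolding lifts_def by blast
    then have "lifts p1 h" using p1(3)[of h] * by simp
    then obtain k where "k \<in> Arr C" "Cod C k = Dom C p1" "p1 \<cdot> k = h"
      unfolding lifts_def by blast
    then show "lifts (q \<cdot> p1) g"
      using h p1(1,2) q by (intro liftsI[of k]) simp_all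
  qed
  then show thesis
    using p1(1,2) q p by (intro that[of "q \<cdot> p1"]) (auto intro: Fib_Comp)
qed

lemma lifts_exists:
  assumes p: "p \<in> Fib C" "Cod C p = Prod C X Y" "X \<in> Obj C" "Y \<in> Obj C"
  obtains p' where "p' \<in> Fib C" "Cod C p' = X"
    "\<And>g. g \<in> Arr C \<Longrightarrow> Cod C g = X \<Longrightarrow> lifts p' g \<longleftrightarrow>
      (\<exists>y. y \<in> Arr C \<and> Dom C y = Dom C g \<and> Cod C y = Y \<and> lifts p (pairing C g y))"
proof -
  have "lifts (pr1 C X Y \<cdot> p) g \<longleftrightarrow>
      (\<exists>y. y \<in> Arr C \<and> Dom C y = Dom C g \<and> Cod C y = Y \<and> lifts p (pairing C g y))"
    if g: "g \<in> Arr C" "Cod C g = X" for g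
  proof
    assume "lifts (pr1 C X Y \<cdot> p) g"
    then obtain h where h: "h \<in> Arr C" "Dom C h = Dom C g" "Cod C h = Dom C p"
      "pr1 C X Y \<cdot> p \<cdot> h = g"
      using p by (elim liftsE) simp_all
    have "pairing C g (pr2 C X Y \<cdot> p \<cdot> h) = p \<cdot> h"
      using pairing_eta[of "p \<cdot> h" X Y] h p by simp
    then have "lifts p (pairing C g (pr2 C X Y \<cdot> p \<cdot> h))"
      using h by (intro liftsI[of h]) simp_all
    then show "\<exists>y. y \<in> Arr C \<and> Dom C y = Dom C g \<and> Cod C y = Y \<and> lifts p (pairing C g y)"
      using h p by (intro exI[of _ "pr2 C X Y \<cdot> p \<cdot> h"]) auto
  next
    assume "\<exists>y. y \<in> Arr C \<and> Dom C y = Dom C g \<and> Cod C y = Y \<and> lifts p (pairing C g y)"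
    then obtain y h where "y \<in> Arr C" "Dom C y = Dom C g" "Cod C y = Y"
      "h \<in> Arr C" "Cod C h = Dom C p" "p \<cdot> h = pairing C g y"
      unfolding lifts_def by blast
    then show "lifts (pr1 C X Y \<cdot> p) g"
      using p g by (intro liftsI[of h]) simp_all
  qed
  then show thesis using p by (intro that[of "pr1 C X Y \<cdot> p"]) (auto intro: Fib_Comp)
qed

text \<open>
  The argument \<open>A = (X, p)\<close> has the shape of an object of the completion, but \<open>p\<close> may be any
  arrow, so that a relation can be studied before it is known to be an equivalence.
\<close>

definition eqv :: "'o \<times> 'm \<Rightarrow> 'm \<Rightarrow> 'm \<Rightarrow> bool" where
  "eqv A x y \<longleftrightarrow> x \<in> Arr C \<and> y \<in> Arr C \<and> Dom C y = Dom C x \<and> Cod C x = fst A \<and> Cod C y = fst A \<and>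
    lifts (snd A) (pairing C x y)"

definition obj :: "'o \<times> 'm \<Rightarrow> bool" where
  "obj A \<longleftrightarrow> homotopy_eqrel C (fst A) (snd A)"

lemma eqv_arrD:
  assumes "eqv A x y"
  shows "x \<in> Arr C" "y \<in> Arr C" "Dom C y = Dom C x" "Cod C x = fst A" "Cod C y = fst A"
  using assms by (auto simp: eqv_def)

lemma eqv_iff:
  assumes "p \<in> Arr C" "Cod C p = Prod C X X" "X \<in> Obj C"
  shows "eqv (X, p) x y \<longleftrightarrow>
    (\<exists>h. h \<in> Arr C \<and> Cod C h = Dom C p \<and> pr1 C X X \<cdot> p \<cdot> h = x \<and> pr2 C X X \<cdot> p \<cdot> h = y)"
proof
  assume e: "eqv (X, p) x y"
  then obtain h where h: "h \<in> Arr C" "Cod C h = Dom C p" "p \<cdot> h = pairing C x y"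
    unfolding eqv_def lifts_def by auto
  have "pr1 C X X \<cdot> p \<cdot> h = x \<and> pr2 C X X \<cdot> p \<cdot> h = y" using h e by (simp add: eqv_def)
  with h show "\<exists>h. h \<in> Arr C \<and> Cod C h = Dom C p \<and> pr1 C X X \<cdot> p \<cdot> h = x \<and> pr2 C X X \<cdot> p \<cdot> h = y"
    by blast
next
  assume "\<exists>h. h \<in> Arr C \<and> Cod C h = Dom C p \<and> pr1 C X X \<cdot> p \<cdot> h = x \<and> pr2 C X X \<cdot> p \<cdot> h = y"
  then obtain h where h: "h \<in> Arr C" "Cod C h = Dom C p" "pr1 C X X \<cdot> p \<cdot> h = x"
    "pr2 C X X \<cdot> p \<cdot> h = y"
    by auto
  have "pairing C x y = p \<cdot> h" using pairing_eta[of "p \<cdot> h" X X] h assms by simp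
  moreover have "Dom C x = Dom C h" "x \<in> Arr C" "y \<in> Arr C" "Dom C y = Dom C h" "Cod C x = X" "Cod C y = X"
    unfolding h(3,4)[symmetric] using h(1,2) assms by simp_all
  ultimately show "eqv (X, p) x y" using h(1,2) liftsI[of h p] unfolding eqv_def by simp
qed

lemma eqv_comp:
  assumes "eqv A x y" "snd A \<in> Arr C" "k \<in> Arr C" "Cod C k = Dom C x"
  shows "eqv A (x \<cdot> k) (y \<cdot> k)"
  using assms lifts_comp[of "snd A" "pairing C x y" k] by (auto simp: eqv_def)

lemma objD:
  assumes "obj A"
  shows "fst A \<in> Obj C" "snd A \<in> Fib C" "Cod C (snd A) = Prod C (fst A) (fst A)"
  using assms by (auto simp: obj_def homotopy_eqrel_def Hom_iff)

lemma eqv_refl: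
  assumes A: "obj A" and x: "x \<in> Arr C" "Cod C x = fst A"
  shows "eqv A x x"
proof -
  obtain \<rho> where \<rho>: "\<rho> \<in> Arr C" "Dom C \<rho> = fst A" "Cod C \<rho> = Dom C (snd A)" "snd A \<cdot> \<rho> = diag C (fst A)"
    using A by (auto simp: obj_def homotopy_eqrel_def Hom_iff Let_def)
  have "snd A \<cdot> \<rho> \<cdot> x = pairing C x x"
    using Comp_eq_comp[OF \<rho>(4), of x] \<rho>(1-3) x objD[OF A] by (simp add: diag_comp)
  then show ?thesis
    using \<rho> x objD[OF A] unfolding eqv_def by (auto intro!: liftsI[of "\<rho> \<cdot> x"])
qed

lemma eqv_sym:
  assumes A: "obj A" and e: "eqv A x y"
  shows "eqv A y x"
proof -
  obtain X p where [simp]: "A = (X, p)" by (cases A)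
  note D = objD[OF A, simplified]
  obtain \<sigma> where \<sigma>: "\<sigma> \<in> Arr C" "Dom C \<sigma> = Dom C p" "Cod C \<sigma> = Dom C p"
    "(pr1 C X X \<cdot> p) \<cdot> \<sigma> = pr2 C X X \<cdot> p" "(pr2 C X X \<cdot> p) \<cdot> \<sigma> = pr1 C X X \<cdot> p"
    using A by (auto simp: obj_def homotopy_eqrel_def Hom_iff Let_def)
  obtain h where h: "h \<in> Arr C" "Cod C h = Dom C p" "pr1 C X X \<cdot> p \<cdot> h = x" "pr2 C X X \<cdot> p \<cdot> h = y"
    using e D eqv_iff[of p X x y] by auto
  have "pr1 C X X \<cdot> p \<cdot> \<sigma> \<cdot> h = ((pr1 C X X \<cdot> p) \<cdot> \<sigma>) \<cdot> h" using \<sigma>(1-3) h D by simp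
  then have 1: "pr1 C X X \<cdot> p \<cdot> \<sigma> \<cdot> h = y" unfolding \<sigma>(4) using h D by simp
  have "pr2 C X X \<cdot> p \<cdot> \<sigma> \<cdot> h = ((pr2 C X X \<cdot> p) \<cdot> \<sigma>) \<cdot> h" using \<sigma>(1-3) h D by simp
  then have 2: "pr2 C X X \<cdot> p \<cdot> \<sigma> \<cdot> h = x" unfolding \<sigma>(5) using h D by simp
  have "eqv (X, p) y x"
    using 1 2 \<sigma>(1-3) h(1,2) D by (subst eqv_iff) (auto intro!: exI[of _ "\<sigma> \<cdot> h"])
  then show ?thesis by simp
qed

lemma eqv_trans:
  assumes A: "obj A" and e: "eqv A x y" "eqv A y z"
  shows "eqv A x z"
proof -
  obtain X p where [simp]: "A = (X, p)" by (cases A)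
  note D = objD[OF A, simplified]
  have "\<exists>q1 q2. is_pullback C (pr2 C X X \<cdot> p) (pr1 C X X \<cdot> p) q1 q2 \<and> (\<exists>\<tau>. \<tau> \<in> Arr C \<and> Dom C \<tau> = Dom C q1 \<and>
      Cod C \<tau> = Dom C p \<and> (pr1 C X X \<cdot> p) \<cdot> \<tau> = (pr1 C X X \<cdot> p) \<cdot> q1 \<and>
      (pr2 C X X \<cdot> p) \<cdot> \<tau> = (pr2 C X X \<cdot> p) \<cdot> q2)"
    using A by (fastforce simp: obj_def homotopy_eqrel_def Hom_iff Let_def)
  then obtain q1 q2 \<tau> where pb: "is_pullback C (pr2 C X X \<cdot> p) (pr1 C X X \<cdot> p) q1 q2"
    and \<tau>: "\<tau> \<in> Arr C" "Dom C \<tau> = Dom C q1" "Cod C \<tau> = Dom C p"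
    "(pr1 C X X \<cdot> p) \<cdot> \<tau> = (pr1 C X X \<cdot> p) \<cdot> q1" "(pr2 C X X \<cdot> p) \<cdot> \<tau> = (pr2 C X X \<cdot> p) \<cdot> q2"
    by auto
  obtain h where h: "h \<in> Arr C" "Cod C h = Dom C p" "pr1 C X X \<cdot> p \<cdot> h = x" "pr2 C X X \<cdot> p \<cdot> h = y"
    using e(1) D eqv_iff[of p X x y] by auto
  obtain k where k: "k \<in> Arr C" "Cod C k = Dom C p" "pr1 C X X \<cdot> p \<cdot> k = y" "pr2 C X X \<cdot> p \<cdot> k = z"
    using e(2) D eqv_iff[of p X y z] by auto
  have Q: "q1 \<in> Arr C" "q2 \<in> Arr C" "Cod C q1 = Dom C p" "Cod C q2 = Dom C p" "Dom C q2 = Dom C q1"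
    using pullback_arrD[OF pb] D by auto
  have dom: "Dom C k = Dom C h"
    using arg_cong[OF h(4), of "Dom C"] arg_cong[OF k(3), of "Dom C"] h(1,2) k(1,2) D by simp
  obtain m where m: "m \<in> Arr C" "Dom C m = Dom C h" "Cod C m = Dom C q1" "q1 \<cdot> m = h" "q2 \<cdot> m = k"
    by (rule pullback_factor[OF pb, of h k]) (use h k dom D in auto)
  have "pr1 C X X \<cdot> p \<cdot> \<tau> \<cdot> m = ((pr1 C X X \<cdot> p) \<cdot> \<tau>) \<cdot> m" using \<tau>(1-3) m D Q by simp
  then have 1: "pr1 C X X \<cdot> p \<cdot> \<tau> \<cdot> m = x" unfolding \<tau>(4) using h m D Q by simp
  have "pr2 C X X \<cdot> p \<cdot> \<tau> \<cdot> m = ((pr2 C X X \<cdot> p) \<cdot> \<tau>) \<cdot> m" using \<tau>(1-3) m D Q by simp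
  then have 2: "pr2 C X X \<cdot> p \<cdot> \<tau> \<cdot> m = z" unfolding \<tau>(5) using k m D Q by simp
  have "eqv (X, p) x z"
    using 1 2 \<tau>(1-3) m(1-3) D Q by (subst eqv_iff) (auto intro!: exI[of _ "\<tau> \<cdot> m"])
  then show ?thesis by simp
qed

text \<open>
  The structure maps of a homotopy equivalence relation are the closure properties of its
  relation on generalised elements, instantiated at the universal elements.
\<close>

lemma objI:
  assumes p: "p \<in> Fib C" "Cod C p = Prod C X X" "X \<in> Obj C"
    and refl: "eqv (X, p) (Ident C X) (Ident C X)"
    and sym: "\<And>x y. eqv (X, p) x y \<Longrightarrow> eqv (X, p) y x"
    and trans: "\<And>x y z. eqv (X, p) x y \<Longrightarrow> eqv (X, p) y z \<Longrightarrow> eqv (X, p) x z"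
  shows "obj (X, p)"
proof -
  have pA: "p \<in> Arr C" using p by simp
  note iff = eqv_iff[OF pA p(2,3)]
  define p1 p2 where "p1 = pr1 C X X \<cdot> p" and "p2 = pr2 C X X \<cdot> p"
  have P: "p1 \<in> Fib C" "p2 \<in> Fib C" "Dom C p1 = Dom C p" "Dom C p2 = Dom C p" "Cod C p1 = X" "Cod C p2 = X"
    using p by (auto simp: p1_def p2_def intro: Fib_Comp)
  have pc: "pr1 C X X \<cdot> p \<cdot> h = p1 \<cdot> h" "pr2 C X X \<cdot> p \<cdot> h = p2 \<cdot> h" if "h \<in> Arr C" "Cod C h = Dom C p" for h
    using that p by (auto simp: p1_def p2_def)
  have "\<exists>\<rho> \<in> Hom C X (Dom C p). p \<cdot> \<rho> = diag C X"
  proof -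
    have "lifts p (diag C X)" using refl by (simp add: eqv_def diag_def)
    then show ?thesis using p by (elim liftsE) (auto simp: Hom_iff)
  qed
  moreover have "\<exists>\<sigma> \<in> Hom C (Dom C p) (Dom C p). p1 \<cdot> \<sigma> = p2 \<and> p2 \<cdot> \<sigma> = p1"
  proof -
    have "eqv (X, p) p1 p2" unfolding iff using pc[of "Ident C (Dom C p)"] p P
      by (intro exI[of _ "Ident C (Dom C p)"]) auto
    then have "eqv (X, p) p2 p1" by (rule sym)
    then obtain h where "h \<in> Arr C" "Cod C h = Dom C p" "pr1 C X X \<cdot> p \<cdot> h = p2" "pr2 C X X \<cdot> p \<cdot> h = p1"
      unfolding iff by blast
    then have h: "h \<in> Arr C" "Cod C h = Dom C p" "p1 \<cdot> h = p2" "p2 \<cdot> h = p1"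
      using pc[of h] by simp_all
    moreover have "Dom C h = Dom C p" using arg_cong[OF h(3), of "Dom C"] h(1,2) P by simp
    ultimately show ?thesis by (auto simp: Hom_iff)
  qed
  moreover have "\<exists>q1 q2. is_pullback C p2 p1 q1 q2 \<and>
      (\<exists>\<tau> \<in> Hom C (Dom C q1) (Dom C p). p1 \<cdot> \<tau> = p1 \<cdot> q1 \<and> p2 \<cdot> \<tau> = p2 \<cdot> q2)"
  proof -
    obtain q1 q2 where pb: "is_pullback C p2 p1 q1 q2"
      by (rule Fib_pullback_obtain[of p2 p1]) (use P in auto)
    note Q = pullback_arrD[OF pb]
    have "eqv (X, p) (p1 \<cdot> q1) (p2 \<cdot> q1)" unfolding iff using pc[of q1] Q P
      by (intro exI[of _ q1]) auto
    moreover have "eqv (X, p) (p2 \<cdot> q1) (p2 \<cdot> q2)" unfolding iff using pc[of q2] Q P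
      by (intro exI[of _ q2]) auto
    ultimately have "eqv (X, p) (p1 \<cdot> q1) (p2 \<cdot> q2)" by (rule trans)
    then obtain h where "h \<in> Arr C" "Cod C h = Dom C p" "pr1 C X X \<cdot> p \<cdot> h = p1 \<cdot> q1"
      "pr2 C X X \<cdot> p \<cdot> h = p2 \<cdot> q2"
      unfolding iff by blast
    then have h: "h \<in> Arr C" "Cod C h = Dom C p" "p1 \<cdot> h = p1 \<cdot> q1" "p2 \<cdot> h = p2 \<cdot> q2"
      using pc[of h] by simp_all
    have "Dom C h = Dom C q1" using arg_cong[OF h(3), of "Dom C"] h(1,2) P Q by simp
    with h have "\<exists>\<tau> \<in> Hom C (Dom C q1) (Dom C p). p1 \<cdot> \<tau> = p1 \<cdot> q1 \<and> p2 \<cdot> \<tau> = p2 \<cdot> q2"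
      by (intro bexI[of _ h]) (simp_all add: Hom_iff)
    with pb show ?thesis by blast
  qed
  ultimately show ?thesis
    using p unfolding obj_def homotopy_eqrel_def p1_def p2_def by (simp add: Hom_iff Let_def)
qed

section \<open>Homotopy\<close>

text \<open>
  Paths satisfy the Leibniz rule: a predicate \<open>p\<close> that holds of \<open>(a, x)\<close> holds of \<open>(a, y)\<close> when
  there is a path from \<open>x\<close> to \<open>y\<close>.  The points of \<open>p\<close> together with a path out of their second
  component form an object that retracts onto the domain of \<open>p\<close> by an acyclic fibration, so it is
  enough to transport along constant paths.
\<close>

lemma path_Leibniz:
  assumes po: "path_object C X r st" and p: "p \<in> Fib C" "Cod C p = Prod C Y X" "Y \<in> Obj C"
    and a: "lifts p (pairing C a x)" "a \<in> Arr C" "Cod C a = Y" "Dom C a = Dom C x"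
    and xy: "eqv (X, st) x y"
  shows "lifts p (pairing C a y)"
proof -
  note P = path_objectD[OF po] and E = path_object_ends[OF po]
  note XY = eqv_arrD[OF xy]
  define s t where "s = pr1 C X X \<cdot> st" and "t = pr2 C X X \<cdot> st"
  have S: "s \<in> Fib C \<inter> Weq C" "t \<in> Fib C" "Dom C s = Dom C st" "Dom C t = Dom C st" "Cod C s = X" "Cod C t = X"
    "s \<cdot> r = Ident C X" "t \<cdot> r = Ident C X"
    using P E by (auto simp: s_def t_def)
  have stc: "pr1 C X X \<cdot> st \<cdot> h = s \<cdot> h" "pr2 C X X \<cdot> st \<cdot> h = t \<cdot> h" if "h \<in> Arr C" "Cod C h = Dom C st" for h
    using that P by (auto simp: s_def t_def)
  define p1 p2 where "p1 = pr1 C Y X \<cdot> p" and "p2 = pr2 C Y X \<cdot> p"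
  have Q: "p1 \<in> Arr C" "p2 \<in> Arr C" "Dom C p1 = Dom C p" "Dom C p2 = Dom C p" "Cod C p1 = Y" "Cod C p2 = X"
    "pairing C p1 p2 = p"
    using p P pairing_eta[of p Y X] by (auto simp: p1_def p2_def)
  have pc: "pr1 C Y X \<cdot> p \<cdot> h = p1 \<cdot> h" "pr2 C Y X \<cdot> p \<cdot> h = p2 \<cdot> h" if "h \<in> Arr C" "Cod C h = Dom C p" for h
    using that p P by (auto simp: p1_def p2_def)
  obtain n m where pb: "is_pullback C s p2 n m"
    by (rule Fib_pullback_obtain[of s p2]) (use S Q in auto)
  have N: "n \<in> Arr C" "m \<in> Fib C \<inter> Weq C" "m \<in> Arr C" "Dom C m = Dom C n" "Cod C n = Dom C st" "Cod C m = Dom C p"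
    using pullback_arrD[OF pb] acyclic_Fib_pullback[OF S(1) pb] S Q by auto
  have "s \<cdot> r \<cdot> p2 = p2 \<cdot> Ident C (Dom C p)"
    using Comp_eq_comp[OF S(7), of p2] S P Q by simp
  then obtain e where e: "e \<in> Arr C" "Dom C e = Dom C p" "Cod C e = Dom C n" "n \<cdot> e = r \<cdot> p2"
    "m \<cdot> e = Ident C (Dom C p)"
    using pullback_factor[OF pb, of "r \<cdot> p2" "Ident C (Dom C p)"] S P Q p by auto
  have "e \<in> Weq C" using Weq_cancel_left[of m e] e N p by (auto simp: Weq_Ident)
  have te: "(t \<cdot> n) \<cdot> e = p2"
  proof -
    have "(t \<cdot> n) \<cdot> e = t \<cdot> r \<cdot> p2" using S N e by simp
    also have "\<dots> = p2" using Comp_eq_comp[OF S(8), of p2] S P Q by simp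
    finally show ?thesis .
  qed
  have "(p1 \<cdot> m) \<cdot> e = p1" using Q N e by simp
  then have "p \<cdot> Ident C (Dom C p) = pairing C (p1 \<cdot> m) (t \<cdot> n) \<cdot> e"
    using te Q N S e p by (subst pairing_comp) auto
  then obtain l where l: "l \<in> Arr C" "Dom C l = Cod C e" "Cod C l = Dom C p"
    "p \<cdot> l = pairing C (p1 \<cdot> m) (t \<cdot> n)"
    using lifting[OF \<open>e \<in> Weq C\<close> p(1), of "Ident C (Dom C p)" "pairing C (p1 \<cdot> m) (t \<cdot> n)"] Q N S e p by auto
  obtain h where h: "h \<in> Arr C" "Dom C h = Dom C x" "Cod C h = Dom C p" "p \<cdot> h = pairing C a x"
    using a XY p(1) by (elim liftsE) simp_all
  have h12: "p1 \<cdot> h = a" "p2 \<cdot> h = x" using pc[of h] h a XY by auto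
  have stA: "st \<in> Arr C" using P by simp
  obtain k where "k \<in> Arr C" "Cod C k = Dom C st" "pr1 C X X \<cdot> st \<cdot> k = x" "pr2 C X X \<cdot> st \<cdot> k = y"
    using xy unfolding eqv_iff[OF stA P(7,1)] by blast
  then have k: "k \<in> Arr C" "Cod C k = Dom C st" "s \<cdot> k = x" "t \<cdot> k = y"
    using stc[of k] by simp_all
  have dk: "Dom C k = Dom C x" using arg_cong[OF k(3), of "Dom C"] k(1,2) S(1-6) by simp
  obtain d where d: "d \<in> Arr C" "Dom C d = Dom C x" "Cod C d = Dom C n" "n \<cdot> d = k" "m \<cdot> d = h"
    by (rule pullback_factor[OF pb, of k h]) (use k h S Q dk h12 in auto)
  have "p \<cdot> l \<cdot> d = pairing C (p1 \<cdot> m) (t \<cdot> n) \<cdot> d"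
    using Comp_eq_comp[OF l(4), of d] l(1-3) d p e by simp
  also have "\<dots> = pairing C a y"
    using d N S Q k h h12 by (subst pairing_comp) auto
  finally show ?thesis
    using l d e by (intro liftsI[of "l \<cdot> d"]) simp_all
qed

text \<open>Symmetry and transitivity are the Leibniz rule for being related to \<open>a\<close>, from either side.\<close>

lemma path_object_obj:
  assumes po: "path_object C X r st"
  shows "obj (X, st)"
proof (rule objI)
  note P = path_objectD[OF po]
  show p: "st \<in> Fib C" "Cod C st = Prod C X X" "X \<in> Obj C" using P by auto
  have rfl: "eqv (X, st) x x" if "x \<in> Arr C" "Cod C x = X" for x
  proof -
    have "st \<cdot> r \<cdot> x = pairing C x x"
      using Comp_eq_comp[OF P(8), of x] P that by (simp add: diag_comp)
    then show ?thesis using P that unfolding eqv_def by (auto intro!: liftsI[of "r \<cdot> x"])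
  qed
  show "eqv (X, st) (Ident C X) (Ident C X)" using p by (intro rfl) auto
  show "eqv (X, st) y x" if xy: "eqv (X, st) x y" for x y
  proof -
    note XY = eqv_arrD[OF xy]
    obtain p' where p': "p' \<in> Fib C" "Cod C p' = Prod C X X"
      "\<And>g. g \<in> Arr C \<Longrightarrow> Cod C g = Prod C X X \<Longrightarrow>
        lifts p' g \<longleftrightarrow> lifts st (pairing C (pr2 C X X) (pr1 C X X) \<cdot> g)"
      by (rule lifts_reindex[of st "pairing C (pr2 C X X) (pr1 C X X)"]) (use p in auto)
    have *: "lifts p' (pairing C u v) \<longleftrightarrow> lifts st (pairing C v u)"
      if "u \<in> Arr C" "v \<in> Arr C" "Dom C v = Dom C u" "Cod C u = X" "Cod C v = X" for u v
      using that p by (subst p'(3)) auto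
    have "lifts p' (pairing C x y)"
      using rfl[of x] XY p'
      by (intro path_Leibniz[OF po p'(1,2) p(3) _ _ _ _ xy]) (auto simp: * eqv_def)
    then show ?thesis using XY * by (auto simp: eqv_def)
  qed
  show "eqv (X, st) x z" if xy: "eqv (X, st) x y" and yz: "eqv (X, st) y z" for x y z
    using path_Leibniz[OF po p(1,2,3) _ _ _ _ yz, of x] eqv_arrD[OF xy] eqv_arrD[OF yz] xy
    by (auto simp: eqv_def)
qed

text \<open>Transport the pair \<open>(x, x)\<close> along the path from \<open>x\<close> to \<open>y\<close>.\<close>

lemma path_eqv:
  assumes po: "path_object C X r st" and A: "obj (X, p)" and xy: "eqv (X, st) x y"
  shows "eqv (X, p) x y"
proof -
  note P = objD[OF A] and XY = eqv_arrD[OF xy]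
  have "lifts p (pairing C x y)"
    using path_Leibniz[OF po _ _ _ _ _ _ _ xy, of p X x] P XY eqv_refl[OF A, of x]
    by (auto simp: eqv_def)
  then show ?thesis using XY by (auto simp: eqv_def)
qed

text \<open>
  The finest relation on \<open>X\<close>.  Which path object is chosen does not matter, by \<open>path_eqv\<close>.
\<close>

definition disc :: "'o \<Rightarrow> 'o \<times> 'm" where
  "disc X = (X, SOME st. \<exists>r. path_object C X r st)"

lemma disc_path: "X \<in> Obj C \<Longrightarrow> \<exists>r. path_object C X r (snd (disc X))"
  unfolding disc_def snd_conv by (rule someI_ex) (use path_object_ex in blast)

lemma fst_disc [simp]: "fst (disc X) = X"
  by (simp add: disc_def)

lemma obj_disc [simp]: "X \<in> Obj C \<Longrightarrow> obj (disc X)"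
  using disc_path[of X] path_object_obj by (metis fst_disc prod.collapse)

lemma homotopic_iff:
  assumes x: "Cod C x = X"
  shows "homotopic C x y \<longleftrightarrow> eqv (disc X) x y"
proof -
  have *: "homotopic C x y \<longleftrightarrow> (\<exists>r st. path_object C X r st \<and> eqv (X, st) x y)"
  proof
    assume "homotopic C x y"
    then obtain r st h where po: "path_object C X r st" and h: "h \<in> Arr C" "Dom C h = Dom C x"
      "Cod C h = Dom C st" "(pr1 C X X \<cdot> st) \<cdot> h = x" "(pr2 C X X \<cdot> st) \<cdot> h = y"
      using x unfolding homotopic_def by (clarsimp simp: Hom_iff)
    note P = path_objectD[OF po]
    have "eqv (X, st) x y" using h P by (subst eqv_iff) auto
    with po show "\<exists>r st. path_object C X r st \<and> eqv (X, st) x y" by blast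
  next
    assume "\<exists>r st. path_object C X r st \<and> eqv (X, st) x y"
    then obtain r st where po: "path_object C X r st" and e: "eqv (X, st) x y" by blast
    note P = path_objectD[OF po] and XY = eqv_arrD[OF e]
    obtain h where h: "h \<in> Arr C" "Cod C h = Dom C st" "pr1 C X X \<cdot> st \<cdot> h = x" "pr2 C X X \<cdot> st \<cdot> h = y"
      using e P by (subst (asm) eqv_iff) auto
    have "Dom C h = Dom C x" using arg_cong[OF h(3), of "Dom C"] h(1,2) P by simp
    then have "\<exists>h \<in> Hom C (Dom C x) (Dom C st). (pr1 C X X \<cdot> st) \<cdot> h = x \<and> (pr2 C X X \<cdot> st) \<cdot> h = y"
      using h P by (intro bexI[of _ h]) (auto simp: Hom_iff)
    then show "homotopic C x y"
      using po XY x unfolding homotopic_def Hom_iff by auto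
  qed
  show ?thesis
  proof
    assume "homotopic C x y"
    then obtain r st where po: "path_object C X r st" and e: "eqv (X, st) x y" using * by blast
    then have "obj (X, snd (disc X))" using obj_disc[of X] path_objectD[OF po] by (simp add: disc_def)
    from path_eqv[OF po this e] show "eqv (disc X) x y" by (simp add: disc_def)
  next
    assume e: "eqv (disc X) x y"
    then have "X \<in> Obj C" using eqv_arrD[OF e] x by auto
    with e * disc_path show "homotopic C x y" by (metis fst_disc prod.collapse)
  qed
qed

lemma homotopic_arrD:
  assumes "homotopic C x y"
  shows "x \<in> Arr C" "y \<in> Arr C" "Dom C y = Dom C x" "Cod C y = Cod C x"
  using assms by (auto simp: homotopic_def Hom_iff)

lemma homotopic_eqv:
  assumes A: "obj A" and xy: "homotopic C x y" "Cod C x = fst A"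
  shows "eqv A x y"
proof -
  have "fst A \<in> Obj C" using objD[OF A] by simp
  then obtain r where "path_object C (fst A) r (snd (disc (fst A)))" using disc_path by blast
  from path_eqv[OF this, of "snd A" x y] A xy homotopic_iff[OF xy(2)] show ?thesis
    by (simp add: disc_def)
qed

lemma homotopic_refl: "x \<in> Arr C \<Longrightarrow> homotopic C x x"
  using eqv_refl[of "disc (Cod C x)" x] homotopic_iff[of x "Cod C x" x] by auto

lemma homotopic_sym: "homotopic C x y \<Longrightarrow> homotopic C y x"
  using eqv_sym[of "disc (Cod C x)" x y] homotopic_iff[of x "Cod C x" y]
    homotopic_iff[of y "Cod C x" x] homotopic_arrD[of x y] by auto

lemma homotopic_trans: "homotopic C x y \<Longrightarrow> homotopic C y z \<Longrightarrow> homotopic C x z"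
  using eqv_trans[of "disc (Cod C x)" x y z] homotopic_iff[of x "Cod C x" y]
    homotopic_iff[of y "Cod C x" z] homotopic_iff[of x "Cod C x" z]
    homotopic_arrD[of x y] by auto

lemma homotopic_comp:
  assumes "homotopic C x y" "k \<in> Arr C" "Cod C k = Dom C x"
  shows "homotopic C (x \<cdot> k) (y \<cdot> k)"
proof -
  note XY = homotopic_arrD[OF assms(1)]
  have "snd (disc (Cod C x)) \<in> Fib C" using objD(2)[of "disc (Cod C x)"] XY by simp
  then show ?thesis
    using eqv_comp[of "disc (Cod C x)" x y k] assms homotopic_iff[of x "Cod C x" y]
      homotopic_iff[of "x \<cdot> k" "Cod C x" "y \<cdot> k"] XY by auto
qed

text \<open>The Leibniz rule for a predicate pulled back to a product, so that it ignores the parameter.\<close>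

lemma homotopic_lifts:
  assumes p: "p \<in> Fib C" and g: "lifts p g" "Cod C g = Cod C p" "g \<in> Arr C" and h: "homotopic C g g'"
  shows "lifts p g'"
proof -
  define X where "X = Cod C p"
  have X: "X \<in> Obj C" "Cod C p = X" using p by (auto simp: X_def)
  note G = homotopic_arrD[OF h]
  obtain r where po: "path_object C X r (snd (disc X))" using disc_path X by blast
  obtain p' where p': "p' \<in> Fib C" "Cod C p' = Prod C X X"
    "\<And>u. u \<in> Arr C \<Longrightarrow> Cod C u = Prod C X X \<Longrightarrow> lifts p' u \<longleftrightarrow> lifts p (pr2 C X X \<cdot> u)"
    by (rule lifts_reindex[of p "pr2 C X X"]) (use p X in auto)
  have e: "eqv (X, snd (disc X)) g g'" using homotopic_iff[of g X g'] h g X by (simp add: disc_def)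
  have "lifts p' (pairing C g g')"
    using path_Leibniz[OF po p'(1,2) X(1) _ _ _ _ e, of g] p'(3)[of "pairing C g g"] g X by simp
  then show ?thesis using p'(3)[of "pairing C g g'"] g X G by simp
qed

lemma homotopic_postcomp:
  assumes h: "homotopic C x y" and k: "k \<in> Arr C" "Dom C k = Cod C x"
  shows "homotopic C (k \<cdot> x) (k \<cdot> y)"
proof -
  note G = homotopic_arrD[OF h]
  define X Z where "X = Cod C x" and "Z = Cod C k"
  have X: "X \<in> Obj C" "Cod C x = X" "Z \<in> Obj C" "Cod C k = Z" "Dom C k = X"
    using G k by (auto simp: X_def Z_def)
  obtain r where po: "path_object C X r (snd (disc X))" using disc_path X by blast
  note D = objD[OF obj_disc[OF X(3)]]
  obtain p' where p': "p' \<in> Fib C" "Cod C p' = Prod C X X"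
    "\<And>u. u \<in> Arr C \<Longrightarrow> Cod C u = Prod C X X \<Longrightarrow> lifts p' u \<longleftrightarrow> lifts (snd (disc Z)) (prod_map C k k \<cdot> u)"
    by (rule lifts_reindex[of "snd (disc Z)" "prod_map C k k"]) (use D k X in auto)
  have e: "eqv (X, snd (disc X)) x y" using homotopic_iff[of x X y] h X by (simp add: disc_def)
  have "eqv (disc Z) (k \<cdot> x) (k \<cdot> x)" using eqv_refl[of "disc Z" "k \<cdot> x"] k X G by auto
  then have "lifts p' (pairing C x x)" using p'(3)[of "pairing C x x"] k X G by (simp add: eqv_def)
  then have "lifts p' (pairing C x y)"
    using path_Leibniz[OF po p'(1,2) X(1) _ _ _ _ e, of x] G X by simp
  then have "eqv (disc Z) (k \<cdot> x) (k \<cdot> y)"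
    using p'(3)[of "pairing C x y"] k X G by (simp add: eqv_def)
  then show ?thesis using homotopic_iff[of "k \<cdot> x" Z "k \<cdot> y"] k X G by simp
qed

end

section \<open>Constructions of homotopy equivalence relations\<close>

context path_category
begin

lemma eqv_comp':
  assumes "obj A" "eqv A x y" "k \<in> Arr C" "Cod C k = Dom C x"
  shows "eqv A (x \<cdot> k) (y \<cdot> k)"
  using eqv_comp assms objD(2)[OF assms(1)] by simp

lemma obj_total:
  assumes "X \<in> Obj C"
  shows "obj (X, Ident C (Prod C X X))"
    and "eqv (X, Ident C (Prod C X X)) x y \<longleftrightarrow>
      x \<in> Arr C \<and> y \<in> Arr C \<and> Dom C y = Dom C x \<and> Cod C x = X \<and> Cod C y = X"
proof -
  show *: "eqv (X, Ident C (Prod C X X)) x y \<longleftrightarrow>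
      x \<in> Arr C \<and> y \<in> Arr C \<and> Dom C y = Dom C x \<and> Cod C x = X \<and> Cod C y = X" for x y
    using assms unfolding eqv_def by (auto intro!: liftsI[of "pairing C x y"])
  show "obj (X, Ident C (Prod C X X))"
    using assms by (intro objI) (simp_all add: *)
qed

lemma obj_inverse_image:
  assumes A: "obj A" and f: "f \<in> Arr C" "Cod C f = fst A"
  obtains p where "obj (Dom C f, p)" "\<And>x y. eqv (Dom C f, p) x y \<longleftrightarrow>
    x \<in> Arr C \<and> y \<in> Arr C \<and> Cod C x = Dom C f \<and> Cod C y = Dom C f \<and> eqv A (f \<cdot> x) (f \<cdot> y)"
proof -
  note D = objD[OF A]
  obtain p where p: "p \<in> Fib C" "Cod C p = Prod C (Dom C f) (Dom C f)"
    "\<And>g. g \<in> Arr C \<Longrightarrow> Cod C g = Prod C (Dom C f) (Dom C f) \<Longrightarrow>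
      lifts p g \<longleftrightarrow> lifts (snd A) (prod_map C f f \<cdot> g)"
    by (rule lifts_reindex[of "snd A" "prod_map C f f"]) (use D f in auto)
  have *: "eqv (Dom C f, p) x y \<longleftrightarrow>
    x \<in> Arr C \<and> y \<in> Arr C \<and> Cod C x = Dom C f \<and> Cod C y = Dom C f \<and> eqv A (f \<cdot> x) (f \<cdot> y)" for x y
    unfolding eqv_def using f p(3)[of "pairing C x y"] by auto
  have "obj (Dom C f, p)"
  proof (rule objI)
    show "eqv (Dom C f, p) (Ident C (Dom C f)) (Ident C (Dom C f))"
      using eqv_refl[OF A f] f by (simp add: *)
    show "eqv (Dom C f, p) y x" if "eqv (Dom C f, p) x y" for x y
      using that eqv_sym[OF A] by (simp add: *)
    show "eqv (Dom C f, p) x z" if "eqv (Dom C f, p) x y" "eqv (Dom C f, p) y z" for x y z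
      using that eqv_trans[OF A, of "f \<cdot> x" "f \<cdot> y" "f \<cdot> z"] by (simp add: *)
  qed (use p(1,2) f in auto)
  with * show thesis by (intro that) auto
qed

lemma obj_conj:
  assumes A: "obj (X, p)" and B: "obj (X, q)"
  obtains r where "obj (X, r)" "\<And>x y. eqv (X, r) x y \<longleftrightarrow> eqv (X, p) x y \<and> eqv (X, q) x y"
proof -
  note D = objD[OF A] objD[OF B]
  obtain r where r: "r \<in> Fib C" "Cod C r = Prod C X X"
    "\<And>g. g \<in> Arr C \<Longrightarrow> Cod C g = Prod C X X \<Longrightarrow> lifts r g \<longleftrightarrow> lifts p g \<and> lifts q g"
    by (rule lifts_conj[of p q]) (use D in auto)
  have *: "eqv (X, r) x y \<longleftrightarrow> eqv (X, p) x y \<and> eqv (X, q) x y" for x y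
    unfolding eqv_def using r(3)[of "pairing C x y"] by auto
  have "obj (X, r)"
  proof (rule objI)
    show "eqv (X, r) (Ident C X) (Ident C X)"
      using eqv_refl[OF A] eqv_refl[OF B] D by (simp add: *)
    show "eqv (X, r) y x" if "eqv (X, r) x y" for x y
      using that eqv_sym[OF A] eqv_sym[OF B] by (simp add: *)
    show "eqv (X, r) x z" if "eqv (X, r) x y" "eqv (X, r) y z" for x y z
      using that eqv_trans[OF A, of x y z] eqv_trans[OF B, of x y z] by (simp add: *)
  qed (use r(1,2) D in auto)
  with * show thesis by (intro that) auto
qed

text \<open>
  With the projections of an internal equivalence relation as \<open>u\<close> and \<open>v\<close> this is the relation of
  its quotient; with homotopy as \<open>A\<close> it is the replacement by a fibration of the map into the
  product given by \<open>u\<close> and \<open>v\<close>, as needed for sums.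
\<close>

lemma span_relation:
  assumes A: "obj A" and u: "u \<in> Arr C" "Cod C u = fst A" and v: "v \<in> Arr C" "Cod C v = fst A" "Dom C v = Dom C u"
  obtains p where "p \<in> Fib C" "Cod C p = Prod C (fst A) (fst A)" "\<And>x y. eqv (fst A, p) x y \<longleftrightarrow>
    (\<exists>n. n \<in> Arr C \<and> Cod C n = Dom C u \<and> eqv A x (u \<cdot> n) \<and> eqv A y (v \<cdot> n))"
proof -
  define X N XX where "X = fst A" and "N = Dom C u" and "XX = Prod C X X"
  note D = objD[OF A, folded X_def]
  have XN: "X \<in> Obj C" "N \<in> Obj C" "XX \<in> Obj C" "Cod C u = X" "Cod C v = X" "Dom C u = N" "Dom C v = N"
    "Prod C X X = XX"
    using u v D by (auto simp: X_def N_def XX_def)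
  define a b where "a = pairing C (pr1 C X X \<cdot> pr1 C XX N) (u \<cdot> pr2 C XX N)"
    and "b = pairing C (pr2 C X X \<cdot> pr1 C XX N) (v \<cdot> pr2 C XX N)"
  have ab: "a \<in> Arr C" "b \<in> Arr C" "Dom C a = Prod C XX N" "Dom C b = Prod C XX N" "Cod C a = XX" "Cod C b = XX"
    using XN u v by (auto simp: a_def b_def)
  have eval: "a \<cdot> pairing C (pairing C x y) n = pairing C x (u \<cdot> n)"
    "b \<cdot> pairing C (pairing C x y) n = pairing C y (v \<cdot> n)"
    if "x \<in> Arr C" "y \<in> Arr C" "n \<in> Arr C" "Dom C y = Dom C x" "Dom C n = Dom C x" "Cod C x = X"
      "Cod C y = X" "Cod C n = N" for x y n
    unfolding a_def b_def using that XN u(1) v(1) by simp_all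
  obtain q1 where q1: "q1 \<in> Fib C" "Cod C q1 = Prod C XX N"
    "\<And>g. g \<in> Arr C \<Longrightarrow> Cod C g = Prod C XX N \<Longrightarrow> lifts q1 g \<longleftrightarrow> lifts (snd A) (a \<cdot> g)"
    by (rule lifts_reindex[of "snd A" a]) (use D ab XN in auto)
  obtain q2 where q2: "q2 \<in> Fib C" "Cod C q2 = Prod C XX N"
    "\<And>g. g \<in> Arr C \<Longrightarrow> Cod C g = Prod C XX N \<Longrightarrow> lifts q2 g \<longleftrightarrow> lifts (snd A) (b \<cdot> g)"
    by (rule lifts_reindex[of "snd A" b]) (use D ab XN in auto)
  obtain q where q: "q \<in> Fib C" "Cod C q = Prod C XX N"
    "\<And>g. g \<in> Arr C \<Longrightarrow> Cod C g = Prod C XX N \<Longrightarrow> lifts q g \<longleftrightarrow> lifts q1 g \<and> lifts q2 g"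
    by (rule lifts_conj[of q1 q2]) (use q1(1,2) q2(1,2) in auto)
  obtain p where p: "p \<in> Fib C" "Cod C p = XX"
    "\<And>g. g \<in> Arr C \<Longrightarrow> Cod C g = XX \<Longrightarrow> lifts p g \<longleftrightarrow>
      (\<exists>n. n \<in> Arr C \<and> Dom C n = Dom C g \<and> Cod C n = N \<and> lifts q (pairing C g n))"
    by (rule lifts_exists[OF q(1,2)]) (use XN in auto)
  have "eqv (X, p) x y \<longleftrightarrow> (\<exists>n. n \<in> Arr C \<and> Cod C n = N \<and> eqv A x (u \<cdot> n) \<and> eqv A y (v \<cdot> n))" for x y
  proof (cases "x \<in> Arr C \<and> y \<in> Arr C \<and> Dom C y = Dom C x \<and> Cod C x = X \<and> Cod C y = X")
    case True
    then have xy: "x \<in> Arr C" "y \<in> Arr C" "Dom C y = Dom C x" "Cod C x = X" "Cod C y = X" by auto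
    have lq: "lifts q (pairing C (pairing C x y) n) \<longleftrightarrow> eqv A x (u \<cdot> n) \<and> eqv A y (v \<cdot> n)"
      if n: "n \<in> Arr C" "Dom C n = Dom C x" "Cod C n = N" for n
    proof -
      have "lifts q (pairing C (pairing C x y) n) \<longleftrightarrow>
          lifts (snd A) (pairing C x (u \<cdot> n)) \<and> lifts (snd A) (pairing C y (v \<cdot> n))"
        using q(3) q1(3) q2(3) eval[of x y n] n xy XN by simp
      then show ?thesis using n xy XN u(1) v(1) unfolding eqv_def by (simp add: X_def)
    qed
    have "eqv (X, p) x y \<longleftrightarrow> lifts p (pairing C x y)" using xy by (simp add: eqv_def)
    also have "\<dots> \<longleftrightarrow> (\<exists>n. n \<in> Arr C \<and> Dom C n = Dom C x \<and> Cod C n = N \<and>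
        lifts q (pairing C (pairing C x y) n))"
      using p(3)[of "pairing C x y"] xy XN by simp
    also have "\<dots> \<longleftrightarrow> (\<exists>n. n \<in> Arr C \<and> Dom C n = Dom C x \<and> Cod C n = N \<and>
        eqv A x (u \<cdot> n) \<and> eqv A y (v \<cdot> n))"
      using lq by blast
    also have "\<dots> \<longleftrightarrow> (\<exists>n. n \<in> Arr C \<and> Cod C n = N \<and> eqv A x (u \<cdot> n) \<and> eqv A y (v \<cdot> n))"
    proof -
      have "Dom C n = Dom C x" if "n \<in> Arr C" "Cod C n = N" "eqv A x (u \<cdot> n)" for n
        using eqv_arrD(3)[OF that(3)] that(1,2) XN u(1) by simp
      then show ?thesis by blast
    qed
    finally show ?thesis .
  next
    case False
    have R: "x \<in> Arr C \<and> y \<in> Arr C \<and> Dom C y = Dom C x \<and> Cod C x = X \<and> Cod C y = X"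
      if n: "n \<in> Arr C" "Cod C n = N" and e: "eqv A x (u \<cdot> n)" "eqv A y (v \<cdot> n)" for n
      using eqv_arrD[OF e(1)] eqv_arrD[OF e(2)] n XN u(1) v(1) by (simp add: X_def)
    have "\<not> eqv (X, p) x y" using False by (auto simp: eqv_def)
    with False R show ?thesis by blast
  qed
  then show thesis using p(1,2) by (intro that[of p]) (simp_all add: X_def N_def XX_def)
qed

section \<open>The homotopy exact completion in terms of elements\<close>

definition tracked :: "'o \<times> 'm \<Rightarrow> 'o \<times> 'm \<Rightarrow> 'm \<Rightarrow> bool" where
  "tracked A B f \<longleftrightarrow> obj A \<and> obj B \<and> f \<in> Arr C \<and> Dom C f = fst A \<and> Cod C f = fst B \<and>
    (\<forall>x y. eqv A x y \<longrightarrow> eqv B (f \<cdot> x) (f \<cdot> y))"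

lemma trackedD:
  assumes "tracked A B f"
  shows "obj A" "obj B" "f \<in> Arr C" "Dom C f = fst A" "Cod C f = fst B"
    "\<And>x y. eqv A x y \<Longrightarrow> eqv B (f \<cdot> x) (f \<cdot> y)"
  using assms by (auto simp: tracked_def)

lemma trackedI:
  assumes "obj A" "obj B" "f \<in> Arr C" "Dom C f = fst A" "Cod C f = fst B"
    "\<And>x y. eqv A x y \<Longrightarrow> eqv B (f \<cdot> x) (f \<cdot> y)"
  shows "tracked A B f"
  using assms by (auto simp: tracked_def)

lemma tracked_Ident: "obj A \<Longrightarrow> tracked A A (Ident C (fst A))"
  using objD(1) by (intro trackedI) (simp_all add: eqv_def)

lemma tracked_comp:
  assumes f: "tracked A B f" and g: "tracked B D g"
  shows "tracked A D (g \<cdot> f)"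
proof (rule trackedI)
  note F = trackedD[OF f] and G = trackedD[OF g]
  show "eqv D ((g \<cdot> f) \<cdot> x) ((g \<cdot> f) \<cdot> y)" if e: "eqv A x y" for x y
    using G(6)[OF F(6)[OF e]] eqv_arrD[OF e] F(3-5) G(3-5) by simp
qed (use trackedD[OF f] trackedD[OF g] in auto)

text \<open>Elements of the underlying object of \<open>A\<close> are maps into \<open>A\<close> from objects with the path relation.\<close>

lemma tracked_disc:
  assumes A: "obj A" and f: "f \<in> Arr C" "Cod C f = fst A"
  shows "tracked (disc (Dom C f)) A f"
proof (rule trackedI)
  show "eqv A (f \<cdot> x) (f \<cdot> y)" if e: "eqv (disc (Dom C f)) x y" for x y
  proof -
    note E = eqv_arrD[OF e]
    have "homotopic C x y" using homotopic_iff[of x "Dom C f" y] E e by simp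
    then have "homotopic C (f \<cdot> x) (f \<cdot> y)" using f E by (intro homotopic_postcomp) auto
    then show ?thesis using f E by (intro homotopic_eqv[OF A]) auto
  qed
qed (use A f in auto)

text \<open>
  A map that respects the relations on all elements does so on the universal related pair, the two
  projections of the relation, and this is a tracking map.
\<close>

lemma tracked_iff:
  "tracked A B f \<longleftrightarrow> obj A \<and> obj B \<and> f \<in> Arr C \<and> Dom C f = fst A \<and> Cod C f = fst B \<and>
    (\<exists>\<phi> \<in> Hom C (Dom C (snd A)) (Dom C (snd B)). snd B \<cdot> \<phi> = prod_map C f f \<cdot> snd A)"
  (is "?L \<longleftrightarrow> ?R")
proof
  assume L: ?L
  obtain X p where [simp]: "A = (X, p)" by (cases A)
  note T = trackedD[OF L]
  note P = objD[OF T(1), simplified] and Q = objD[OF T(2)]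
  have "eqv A (pr1 C X X \<cdot> p) (pr2 C X X \<cdot> p)"
    using P liftsI[of "Ident C (Dom C p)" p p] pairing_eta[of p X X] by (simp add: eqv_def)
  from T(6)[OF this] have "lifts (snd B) (pairing C (f \<cdot> pr1 C X X \<cdot> p) (f \<cdot> pr2 C X X \<cdot> p))"
    by (simp add: eqv_def)
  then have *: "lifts (snd B) (prod_map C f f \<cdot> p)" using T P prod_map_comp[of f f p] by simp
  obtain \<phi> where "\<phi> \<in> Arr C" "Dom C \<phi> = Dom C (prod_map C f f \<cdot> p)" "Cod C \<phi> = Dom C (snd B)"
    "snd B \<cdot> \<phi> = prod_map C f f \<cdot> p"
    by (rule liftsE[OF *]) (use Q in auto)
  then show ?R using T(1-5) P by (auto simp: Hom_iff)
next
  assume R: ?R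
  then obtain \<phi> where \<phi>: "\<phi> \<in> Arr C" "Dom C \<phi> = Dom C (snd A)" "Cod C \<phi> = Dom C (snd B)"
    "snd B \<cdot> \<phi> = prod_map C f f \<cdot> snd A"
    by (auto simp: Hom_iff)
  have A: "obj A" and B: "obj B" and f: "f \<in> Arr C" "Dom C f = fst A" "Cod C f = fst B" using R by auto
  note P = objD[OF A] and Q = objD[OF B]
  show ?L
  proof (rule trackedI[OF A B f])
    fix x y assume e: "eqv A x y"
    note E = eqv_arrD[OF e]
    obtain h where h: "h \<in> Arr C" "Cod C h = Dom C (snd A)" "snd A \<cdot> h = pairing C x y"
      using e unfolding eqv_def lifts_def by blast
    have "snd B \<cdot> \<phi> \<cdot> h = (prod_map C f f \<cdot> snd A) \<cdot> h"
      using Comp_eq_comp[OF \<phi>(4), of h] \<phi>(1-3) h(1,2) Q by simp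
    also have "\<dots> = pairing C (f \<cdot> x) (f \<cdot> y)"
      using h E P f by simp
    finally have "lifts (snd B) (pairing C (f \<cdot> x) (f \<cdot> y))"
      using \<phi> h by (intro liftsI[of "\<phi> \<cdot> h"]) auto
    then show "eqv B (f \<cdot> x) (f \<cdot> y)" using E f by (simp add: eqv_def)
  qed
qed

lemma eqrel_cat_simps:
  "Obj (eqrel_cat C) = {A. obj A}"
  "Arr (eqrel_cat C) = {(A, B, f). tracked A B f}"
  "Dom (eqrel_cat C) (A, B, f) = A"
  "Cod (eqrel_cat C) (A, B, f) = B"
  "Ident (eqrel_cat C) A = (A, A, Ident C (fst A))"
  "Comp (eqrel_cat C) (B', D, g) (A, B, f) = (A, D, g \<cdot> f)"
  unfolding eqrel_cat_def
  by (auto simp: obj_def tracked_iff Hom_iff Bex_def)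

lemma hex_rel_iff:
  "((A, B, f), (A', B', g)) \<in> hex_rel C \<longleftrightarrow>
    A' = A \<and> B' = B \<and> tracked A B f \<and> tracked A B g \<and> eqv B f g"
proof -
  have "(\<exists>H \<in> Hom C (fst A) (Dom C (snd B)). snd B \<cdot> H = pairing C f g) \<longleftrightarrow> eqv B f g"
    if T: "tracked A B f" "tracked A B g"
  proof -
    note F = trackedD[OF T(1)] and G = trackedD[OF T(2)]
    have "(\<exists>H \<in> Hom C (fst A) (Dom C (snd B)). snd B \<cdot> H = pairing C f g) \<longleftrightarrow>
        lifts (snd B) (pairing C f g)"
    proof
      assume "lifts (snd B) (pairing C f g)"
      then show "\<exists>H \<in> Hom C (fst A) (Dom C (snd B)). snd B \<cdot> H = pairing C f g"
        using objD(2)[OF F(2)] F G by (elim liftsE) (auto simp: Hom_iff)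
    qed (auto simp: Hom_iff intro: liftsI)
    then show ?thesis using F(1-5) G(1-5) by (simp add: eqv_def)
  qed
  then show ?thesis
    unfolding hex_rel_def eqrel_cat_simps by (cases A; cases B) auto
qed

lemma Hex_congruence: "category_congruence (eqrel_cat C) (hex_rel C)"
proof
  fix F assume "F \<in> Arr (eqrel_cat C)"
  then show "Dom (eqrel_cat C) F \<in> Obj (eqrel_cat C)" "Cod (eqrel_cat C) F \<in> Obj (eqrel_cat C)"
    by (auto simp: eqrel_cat_simps trackedD)
next
  fix A assume "A \<in> Obj (eqrel_cat C)"
  then show "Ident (eqrel_cat C) A \<in> Hom (eqrel_cat C) A A"
    by (auto simp: Hom_def eqrel_cat_simps tracked_Ident)
next
  fix F G A B D assume "F \<in> Hom (eqrel_cat C) A B" "G \<in> Hom (eqrel_cat C) B D"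
  then show "Comp (eqrel_cat C) G F \<in> Hom (eqrel_cat C) A D"
    by (auto simp: Hom_def eqrel_cat_simps intro: tracked_comp)
next
  fix F A B assume "F \<in> Hom (eqrel_cat C) A B"
  then show "Comp (eqrel_cat C) (Ident (eqrel_cat C) B) F = F"
    "Comp (eqrel_cat C) F (Ident (eqrel_cat C) A) = F"
    by (auto simp: Hom_def eqrel_cat_simps trackedD)
next
  fix F G H A B D E
  assume "F \<in> Hom (eqrel_cat C) A B" "G \<in> Hom (eqrel_cat C) B D" "H \<in> Hom (eqrel_cat C) D E"
  then show "Comp (eqrel_cat C) H (Comp (eqrel_cat C) G F) = Comp (eqrel_cat C) (Comp (eqrel_cat C) H G) F"
    by (auto simp: Hom_def eqrel_cat_simps trackedD)
next
  show "equiv (Arr (eqrel_cat C)) (hex_rel C)"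
  proof (rule equivI)
    show "hex_rel C \<subseteq> Arr (eqrel_cat C) \<times> Arr (eqrel_cat C)"
      by (auto simp: eqrel_cat_simps hex_rel_iff)
    show "refl_on (Arr (eqrel_cat C)) (hex_rel C)"
      by (auto simp: refl_on_def eqrel_cat_simps hex_rel_iff trackedD intro: eqv_refl)
    show "sym (hex_rel C)"
      by (auto simp: sym_def hex_rel_iff trackedD intro: eqv_sym)
    show "trans (hex_rel C)"
      by (auto simp: trans_def hex_rel_iff dest: trackedD(2) intro: eqv_trans)
  qed
next
  fix F G assume "(F, G) \<in> hex_rel C"
  then show "Dom (eqrel_cat C) G = Dom (eqrel_cat C) F \<and> Cod (eqrel_cat C) G = Cod (eqrel_cat C) F"
    by (cases F; cases G) (simp add: hex_rel_iff eqrel_cat_simps)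
next
  fix F F' G G' assume "(F, F') \<in> hex_rel C" "(G, G') \<in> hex_rel C" "Cod (eqrel_cat C) F = Dom (eqrel_cat C) G"
  moreover obtain A B f where "F = (A, B, f)" by (cases F)
  moreover obtain A' B' f' where "F' = (A', B', f')" by (cases F')
  moreover obtain B'' D g where "G = (B'', D, g)" by (cases G)
  moreover obtain B3 D' g' where "G' = (B3, D', g')" by (cases G')
  ultimately have eqs: "F = (A, B, f)" "F' = (A, B, f')" "G = (B, D, g)" "G' = (B, D, g')"
    and f: "tracked A B f" "tracked A B f'" "eqv B f f'" and g: "tracked B D g" "tracked B D g'" "eqv D g g'"
    by (simp_all add: hex_rel_iff eqrel_cat_simps)
 have "eqv D (g \<cdot> f) (g' \<cdot> f')"
    using eqv_trans[OF trackedD(2)[OF g(1)]] trackedD(6)[OF g(1) f(3)]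
      eqv_comp'[OF trackedD(2)[OF g(1)] g(3), of f'] trackedD[OF f(2)] trackedD[OF g(1)] by auto
  then show "(Comp (eqrel_cat C) G F, Comp (eqrel_cat C) G' F') \<in> hex_rel C"
    unfolding eqs using f g by (simp add: hex_rel_iff eqrel_cat_simps tracked_comp[of A B _ D])
qed

definition cls :: "'o \<times> 'm \<Rightarrow> 'o \<times> 'm \<Rightarrow> 'm \<Rightarrow> (('o \<times> 'm) \<times> ('o \<times> 'm) \<times> 'm) set" where
  "cls A B f = hex_rel C `` {(A, B, f)}"

lemma category_Hex: "category (Hex C)"
  unfolding Hex_def by (rule category_congruence.category_quotient[OF Hex_congruence])

lemma Hex_Obj: "A \<in> Obj (Hex C) \<longleftrightarrow> obj A"
  unfolding Hex_def quotient_cat_def by (simp add: eqrel_cat_simps)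

lemma Hex_Hom_iff: "\<alpha> \<in> Hom (Hex C) A B \<longleftrightarrow> (\<exists>f. tracked A B f \<and> \<alpha> = cls A B f)"
  unfolding Hex_def category_congruence.Hom_quotient_iff[OF Hex_congruence] cls_def
  by (cases A; cases B) (auto simp: eqrel_cat_simps)

lemma cls_simps [simp]:
  assumes "tracked A B f"
  shows "cls A B f \<in> Arr (Hex C)" "Dom (Hex C) (cls A B f) = A" "Cod (Hex C) (cls A B f) = B"
proof -
  have "cls A B f \<in> Hom (Hex C) A B" using assms Hex_Hom_iff by blast
  then show "cls A B f \<in> Arr (Hex C)" "Dom (Hex C) (cls A B f) = A" "Cod (Hex C) (cls A B f) = B"
    by (auto simp: Hom_def)
qed

lemma Hex_ArrE:
  assumes "F \<in> Arr (Hex C)" "Dom (Hex C) F = A" "Cod (Hex C) F = B"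
  obtains f where "tracked A B f" "F = cls A B f"
proof -
  have "F \<in> Hom (Hex C) A B" using assms by (simp add: Hom_def)
  then show thesis using that Hex_Hom_iff by blast
qed

lemma Hex_Comp [simp]:
  assumes "tracked A B f" "tracked B D g"
  shows "cls B D g \<cdot>\<^bsub>Hex C\<^esub> cls A B f = cls A D (g \<cdot> f)"
  using category_congruence.Comp_class[OF Hex_congruence, of "(A, B, f)" "(B, D, g)"] assms
  unfolding Hex_def cls_def by (simp add: eqrel_cat_simps)

lemma Hex_Ident: "Ident (Hex C) A = cls A A (Ident C (fst A))"
  using category_congruence.Ident_class[OF Hex_congruence, of A]
  unfolding Hex_def cls_def by (simp add: eqrel_cat_simps)

lemma cls_eq_iff:
  assumes "tracked A B f" "tracked A B g"
  shows "cls A B f = cls A B g \<longleftrightarrow> eqv B f g"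
  using category_congruence.class_eq_iff[OF Hex_congruence, of "(A, B, f)" "(A, B, g)"] assms
  unfolding cls_def by (simp add: eqrel_cat_simps hex_rel_iff)

text \<open>
  Pullbacks in the completion are detected by generalised elements of the underlying objects,
  because those are the same as maps out of objects carrying the path relation.
\<close>

definition el_pullback where
  "el_pullback A B D W f g p q \<longleftrightarrow> eqv D (f \<cdot> p) (g \<cdot> q) \<and>
    (\<forall>x y. x \<in> Arr C \<longrightarrow> y \<in> Arr C \<longrightarrow> Dom C y = Dom C x \<longrightarrow> Cod C x = fst A \<longrightarrow> Cod C y = fst B \<longrightarrow>
      eqv D (f \<cdot> x) (g \<cdot> y) \<longrightarrow>
      (\<exists>w. w \<in> Arr C \<and> Dom C w = Dom C x \<and> Cod C w = fst W \<and> eqv A (p \<cdot> w) x \<and> eqv B (q \<cdot> w) y)) \<and>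
    (\<forall>w w'. w \<in> Arr C \<longrightarrow> w' \<in> Arr C \<longrightarrow> Dom C w' = Dom C w \<longrightarrow> Cod C w = fst W \<longrightarrow> Cod C w' = fst W \<longrightarrow>
      eqv A (p \<cdot> w) (p \<cdot> w') \<longrightarrow> eqv B (q \<cdot> w) (q \<cdot> w') \<longrightarrow> eqv W w w')"

lemma el_pullbackD:
  assumes "el_pullback A B D W f g p q"
  shows "eqv D (f \<cdot> p) (g \<cdot> q)"
    "\<And>x y. x \<in> Arr C \<Longrightarrow> y \<in> Arr C \<Longrightarrow> Dom C y = Dom C x \<Longrightarrow> Cod C x = fst A \<Longrightarrow> Cod C y = fst B \<Longrightarrow>
      eqv D (f \<cdot> x) (g \<cdot> y) \<Longrightarrow>
      \<exists>w. w \<in> Arr C \<and> Dom C w = Dom C x \<and> Cod C w = fst W \<and> eqv A (p \<cdot> w) x \<and> eqv B (q \<cdot> w) y"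
    "\<And>w w'. w \<in> Arr C \<Longrightarrow> w' \<in> Arr C \<Longrightarrow> Dom C w' = Dom C w \<Longrightarrow> Cod C w = fst W \<Longrightarrow> Cod C w' = fst W \<Longrightarrow>
      eqv A (p \<cdot> w) (p \<cdot> w') \<Longrightarrow> eqv B (q \<cdot> w) (q \<cdot> w') \<Longrightarrow> eqv W w w'"
  using assms unfolding el_pullback_def by simp_all

lemma Hex_pullback_iff:
  assumes f: "tracked A D f" and g: "tracked B D g" and p: "tracked W A p" and q: "tracked W B q"
  shows "is_pullback (Hex C) (cls A D f) (cls B D g) (cls W A p) (cls W B q) \<longleftrightarrow>
    el_pullback A B D W f g p q" (is "?L \<longleftrightarrow> ?R")
proof
  note F = trackedD[OF f] and G = trackedD[OF g] and P = trackedD[OF p] and Q = trackedD[OF q]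
  note fp = tracked_comp[OF p f] and gq = tracked_comp[OF q g]
  note H = category_Hex
  {
    assume L: ?L
    show ?R
      unfolding el_pullback_def
    proof (intro conjI allI impI)
      show "eqv D (f \<cdot> p) (g \<cdot> q)"
        using category.pullback_arrD(9)[OF H L] f g p q cls_eq_iff[OF fp gq] by simp
    next
      fix x y assume x: "x \<in> Arr C" "Cod C x = fst A" and y: "y \<in> Arr C" "Dom C y = Dom C x" "Cod C y = fst B"
        and xy: "eqv D (f \<cdot> x) (g \<cdot> y)"
      define Z where "Z = disc (Dom C x)"
      have xt: "tracked Z A x" and yt: "tracked Z B y"
        using tracked_disc[OF F(1) x] tracked_disc[OF G(1) y(1,3)] y(2) by (auto simp: Z_def)
      have eq: "cls A D f \<cdot>\<^bsub>Hex C\<^esub> cls Z A x = cls B D g \<cdot>\<^bsub>Hex C\<^esub> cls Z B y"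
        using xt yt f g xy cls_eq_iff[OF tracked_comp[OF xt f] tracked_comp[OF yt g]] by simp
      obtain h where h: "h \<in> Arr (Hex C)" "Dom (Hex C) h = Z" "Cod (Hex C) h = W"
        "cls W A p \<cdot>\<^bsub>Hex C\<^esub> h = cls Z A x" "cls W B q \<cdot>\<^bsub>Hex C\<^esub> h = cls Z B y"
        by (rule category.pullback_factor[OF H L, of "cls Z A x" "cls Z B y"]) (use xt yt f g p q eq in auto)
      obtain w where w: "tracked Z W w" "h = cls Z W w" by (rule Hex_ArrE[OF h(1-3)])
      note WD = trackedD[OF w(1)]
      have "eqv A (p \<cdot> w) x" "eqv B (q \<cdot> w) y"
        using h(4,5) w p q cls_eq_iff[OF tracked_comp[OF w(1) p] xt] cls_eq_iff[OF tracked_comp[OF w(1) q] yt]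
        by auto
      then show "\<exists>w. w \<in> Arr C \<and> Dom C w = Dom C x \<and> Cod C w = fst W \<and> eqv A (p \<cdot> w) x \<and> eqv B (q \<cdot> w) y"
        using WD(3-5) by (intro exI[of _ w]) (simp add: Z_def)
    next
      fix w w' assume w: "w \<in> Arr C" "Cod C w = fst W" and w': "w' \<in> Arr C" "Dom C w' = Dom C w" "Cod C w' = fst W"
        and e: "eqv A (p \<cdot> w) (p \<cdot> w')" "eqv B (q \<cdot> w) (q \<cdot> w')"
      define Z where "Z = disc (Dom C w)"
      have t: "tracked Z W w" "tracked Z W w'"
        using tracked_disc[OF P(1) w] tracked_disc[OF P(1) w'(1,3)] w'(2) by (auto simp: Z_def)
      have "cls Z W w = cls Z W w'"
        by (rule category.pullback_unique[OF H L])
          (use t p q e cls_eq_iff[OF tracked_comp[OF t(1) p] tracked_comp[OF t(2) p]]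
            cls_eq_iff[OF tracked_comp[OF t(1) q] tracked_comp[OF t(2) q]] in auto)
      then show "eqv W w w'" using cls_eq_iff[OF t] by simp
    qed
  next
    assume R: ?R
    note R = el_pullbackD[OF R]
    show ?L
    proof (rule category.pullbackI[OF H])
      show "cls A D f \<cdot>\<^bsub>Hex C\<^esub> cls W A p = cls B D g \<cdot>\<^bsub>Hex C\<^esub> cls W B q"
        using R(1) cls_eq_iff[OF fp gq] f g p q by simp
    next
      fix u v assume u: "u \<in> Arr (Hex C)" "Cod (Hex C) u = Dom (Hex C) (cls A D f)"
        and v: "v \<in> Arr (Hex C)" "Dom (Hex C) v = Dom (Hex C) u" "Cod (Hex C) v = Dom (Hex C) (cls B D g)"
        and eq: "cls A D f \<cdot>\<^bsub>Hex C\<^esub> u = cls B D g \<cdot>\<^bsub>Hex C\<^esub> v"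
      obtain U where U: "Dom (Hex C) u = U" by simp
      obtain x where x: "tracked U A x" "u = cls U A x"
        by (rule Hex_ArrE[of u U A]) (use u f U in simp_all)
      obtain y where y: "tracked U B y" "v = cls U B y"
        by (rule Hex_ArrE[of v U B]) (use v g U in simp_all)
      note X = trackedD[OF x(1)] and Y = trackedD[OF y(1)]
      have "eqv D (f \<cdot> x) (g \<cdot> y)"
        using eq f g x y cls_eq_iff[OF tracked_comp[OF x(1) f] tracked_comp[OF y(1) g]] by simp
      then obtain w where w: "w \<in> Arr C" "Dom C w = Dom C x" "Cod C w = fst W" "eqv A (p \<cdot> w) x" "eqv B (q \<cdot> w) y"
        using R(2)[of x y] X Y by auto
      have w_eqv: "eqv W (w \<cdot> a) (w \<cdot> b)" if ab: "eqv U a b" for a b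
      proof (rule R(3))
        note AB = eqv_arrD[OF ab]
        have "eqv A (p \<cdot> w \<cdot> k) (x \<cdot> k)" "eqv B (q \<cdot> w \<cdot> k) (y \<cdot> k)"
          if "k \<in> Arr C" "Cod C k = fst U" for k
          using eqv_comp'[OF F(1) w(4), of k] eqv_comp'[OF G(1) w(5), of k] that
            w(1-3) X(3-5) P(3-5) Q(3-5) by simp_all
        note xy = this[OF AB(1,4)] this[OF AB(2,5)]
        show "eqv A (p \<cdot> w \<cdot> a) (p \<cdot> w \<cdot> b)"
          by (rule eqv_trans[OF F(1) xy(1) eqv_trans[OF F(1) X(6)[OF ab] eqv_sym[OF F(1) xy(3)]]])
        show "eqv B (q \<cdot> w \<cdot> a) (q \<cdot> w \<cdot> b)"
          by (rule eqv_trans[OF G(1) xy(2) eqv_trans[OF G(1) Y(6)[OF ab] eqv_sym[OF G(1) xy(4)]]])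
      qed (use eqv_arrD[OF ab] w X in auto)
      have t: "tracked U W w"
        by (rule trackedI) (use w(1-3) X P w_eqv in auto)
      show "\<exists>h. h \<in> Arr (Hex C) \<and> Dom (Hex C) h = Dom (Hex C) u \<and> Cod (Hex C) h = Dom (Hex C) (cls W A p) \<and>
          cls W A p \<cdot>\<^bsub>Hex C\<^esub> h = u \<and> cls W B q \<cdot>\<^bsub>Hex C\<^esub> h = v"
        using t p q x y w cls_eq_iff[OF tracked_comp[OF t p] x(1)] cls_eq_iff[OF tracked_comp[OF t q] y(1)]
        by (intro exI[of _ "cls U W w"]) simp
    next
      fix h k assume h: "h \<in> Arr (Hex C)" "Cod (Hex C) h = Dom (Hex C) (cls W A p)"
        and k: "k \<in> Arr (Hex C)" "Cod (Hex C) k = Dom (Hex C) (cls W A p)" "Dom (Hex C) k = Dom (Hex C) h"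
        and eq: "cls W A p \<cdot>\<^bsub>Hex C\<^esub> h = cls W A p \<cdot>\<^bsub>Hex C\<^esub> k" "cls W B q \<cdot>\<^bsub>Hex C\<^esub> h = cls W B q \<cdot>\<^bsub>Hex C\<^esub> k"
      obtain U where U: "Dom (Hex C) h = U" by simp
      obtain w where w: "tracked U W w" "h = cls U W w" by (rule Hex_ArrE[of h U W]) (use h p U in simp_all)
      obtain w' where w': "tracked U W w'" "k = cls U W w'" by (rule Hex_ArrE[of k U W]) (use k p U in simp_all)
      have "eqv A (p \<cdot> w) (p \<cdot> w')" "eqv B (q \<cdot> w) (q \<cdot> w')"
        using eq w w' p q cls_eq_iff[OF tracked_comp[OF w(1) p] tracked_comp[OF w'(1) p]]
          cls_eq_iff[OF tracked_comp[OF w(1) q] tracked_comp[OF w'(1) q]] by simp_all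
      then have "eqv W w w'" using R(3)[of w w'] trackedD(3-5)[OF w(1)] trackedD(3-5)[OF w'(1)] by simp
      then show "h = k" using w w' cls_eq_iff[OF w(1) w'(1)] by simp
    qed (use f g p q in auto)
  }
qed

lemma Hex_pullbackE:
  assumes pb: "is_pullback (Hex C) (cls A D f) (cls B D g) P Q" and f: "tracked A D f" and g: "tracked B D g"
  obtains W p q where "tracked W A p" "tracked W B q" "P = cls W A p" "Q = cls W B q"
    "el_pullback A B D W f g p q"
proof -
  note D = category.pullback_arrD[OF category_Hex pb]
  obtain W where W: "Dom (Hex C) P = W" by simp
  obtain p where p: "tracked W A p" "P = cls W A p"
    by (rule Hex_ArrE[of P W A]) (use D f W in simp_all)
  obtain q where q: "tracked W B q" "Q = cls W B q"
    by (rule Hex_ArrE[of Q W B]) (use D g W in simp_all)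
  have "el_pullback A B D W f g p q"
    using Hex_pullback_iff[OF f g p(1) q(1)] pb p(2) q(2) by simp
  then show thesis by (rule that[OF p(1) q(1) p(2) q(2)])
qed

end

section \<open>Exactness\<close>

context path_category
begin

lemma Hex_Arr_cases:
  assumes "F \<in> Arr (Hex C)"
  obtains A B f where "tracked A B f" "F = cls A B f"
  by (rule Hex_ArrE[OF assms refl refl])

lemma Hex_terminal: "\<exists>T. terminal (Hex C) T"
proof -
  obtain T t where T: "T \<in> Obj C" "\<And>A. A \<in> Obj C \<Longrightarrow> t A \<in> Fib C \<and> Dom C (t A) = A \<and> Cod C (t A) = T"
    "\<And>f g. f \<in> Arr C \<Longrightarrow> g \<in> Arr C \<Longrightarrow> Dom C f = Dom C g \<Longrightarrow> Cod C f = T \<Longrightarrow> Cod C g = T \<Longrightarrow> f = g"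
    by (rule terminal_map, rule that)
  define I where "I = (T, Ident C (Prod C T T))"
  have I: "obj I" "fst I = T" using obj_total(1)[OF T(1)] by (auto simp: I_def)
  have "\<exists>!f. f \<in> Hom (Hex C) A I" if A: "obj A" for A
  proof
    have tA: "t (fst A) \<in> Arr C" "Dom C (t (fst A)) = fst A" "Cod C (t (fst A)) = T"
      using T(2)[OF objD(1)[OF A]] by auto
    have t: "tracked A I (t (fst A))"
      using A I tA unfolding tracked_def I_def obj_total(2)[OF T(1)] by (auto simp: eqv_arrD)
    show "cls A I (t (fst A)) \<in> Hom (Hex C) A I" using t Hex_Hom_iff by blast
    fix \<alpha> assume "\<alpha> \<in> Hom (Hex C) A I"
    then obtain f where f: "tracked A I f" "\<alpha> = cls A I f" using Hex_Hom_iff by blast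
    note F = trackedD(3-5)[OF f(1)]
    have "f = t (fst A)" by (rule T(3)) (use F I tA in simp_all)
    then show "\<alpha> = cls A I (t (fst A))" using f(2) by simp
  qed
  then show ?thesis
    using I unfolding terminal_def by (intro exI[of _ I] conjI ballI) (simp_all add: Hex_Obj)
qed

text \<open>
  The underlying object is the domain of the fibration over the product that expresses that the
  images agree in \<open>D\<close>; its relation compares both components.
\<close>

lemma Hex_pullback_ex:
  assumes f: "tracked A D f" and g: "tracked B D g"
  obtains W p q where "tracked W A p" "tracked W B q" "el_pullback A B D W f g p q"
proof -
  note F = trackedD[OF f] and G = trackedD[OF g]
  note OA = objD[OF F(1)] and OB = objD[OF G(1)] and OD = objD[OF F(2)]
  obtain w where w: "w \<in> Fib C" "Cod C w = Prod C (fst A) (fst B)"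
    "\<And>k. k \<in> Arr C \<Longrightarrow> Cod C k = Prod C (fst A) (fst B) \<Longrightarrow>
      lifts w k \<longleftrightarrow> lifts (snd D) (prod_map C f g \<cdot> k)"
    by (rule lifts_reindex[of "snd D" "prod_map C f g"]) (use F(3-5) G(3-5) OD in auto)
  define p q where "p = pr1 C (fst A) (fst B) \<cdot> w" and "q = pr2 C (fst A) (fst B) \<cdot> w"
  have PQ: "p \<in> Arr C" "q \<in> Arr C" "Dom C p = Dom C w" "Dom C q = Dom C w" "Cod C p = fst A" "Cod C q = fst B"
    using w(1,2) OA(1) OB(1) by (simp_all add: p_def q_def)
  obtain R1 where R1: "obj (Dom C p, R1)" "\<And>x y. eqv (Dom C p, R1) x y \<longleftrightarrow>
      x \<in> Arr C \<and> y \<in> Arr C \<and> Cod C x = Dom C p \<and> Cod C y = Dom C p \<and> eqv A (p \<cdot> x) (p \<cdot> y)"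
    by (rule obj_inverse_image[OF F(1) PQ(1,5)], rule that)
  obtain R2 where R2: "obj (Dom C q, R2)" "\<And>x y. eqv (Dom C q, R2) x y \<longleftrightarrow>
      x \<in> Arr C \<and> y \<in> Arr C \<and> Cod C x = Dom C q \<and> Cod C y = Dom C q \<and> eqv B (q \<cdot> x) (q \<cdot> y)"
    by (rule obj_inverse_image[OF G(1) PQ(2,6)], rule that)
  obtain R where R: "obj (Dom C w, R)" "\<And>x y. eqv (Dom C w, R) x y \<longleftrightarrow>
      eqv (Dom C w, R1) x y \<and> eqv (Dom C w, R2) x y"
    by (rule obj_conj[OF R1(1)[unfolded PQ] R2(1)[unfolded PQ]], rule that)
  define W where "W = (Dom C w, R)"
  have W: "obj W" "fst W = Dom C w" "\<And>x y. eqv W x y \<longleftrightarrow> x \<in> Arr C \<and> y \<in> Arr C \<and> Cod C x = Dom C w \<and>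
      Cod C y = Dom C w \<and> eqv A (p \<cdot> x) (p \<cdot> y) \<and> eqv B (q \<cdot> x) (q \<cdot> y)"
    using R R1(2) R2(2) unfolding W_def PQ by auto
  have t: "tracked W A p" "tracked W B q"
    using F(1) G(1) W PQ by (auto intro!: trackedI)
  have wc: "pairing C (p \<cdot> k) (q \<cdot> k) = w \<cdot> k" if "k \<in> Arr C" "Cod C k = Dom C w" for k
    using pairing_eta[of "w \<cdot> k" "fst A" "fst B"] that w(1,2) OA(1) OB(1) by (simp add: p_def q_def)
  have lw: "lifts w (pairing C x y) \<longleftrightarrow> eqv D (f \<cdot> x) (g \<cdot> y)"
    if "x \<in> Arr C" "y \<in> Arr C" "Dom C y = Dom C x" "Cod C x = fst A" "Cod C y = fst B" for x y
    using w(3)[of "pairing C x y"] that F(3-5) G(3-5) by (simp add: eqv_def)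
  have "el_pullback A B D W f g p q"
    unfolding el_pullback_def
  proof (intro conjI allI impI)
    have "lifts w w" using w(1) by (intro liftsI[of "Ident C (Dom C w)"]) auto
    then show "eqv D (f \<cdot> p) (g \<cdot> q)"
      using lw[of p q] PQ wc[of "Ident C (Dom C w)"] w(1) by simp
  next
    fix x y assume xy: "x \<in> Arr C" "y \<in> Arr C" "Dom C y = Dom C x" "Cod C x = fst A" "Cod C y = fst B"
      and e: "eqv D (f \<cdot> x) (g \<cdot> y)"
    then have "lifts w (pairing C x y)" using lw by simp
    then obtain h where h: "h \<in> Arr C" "Dom C h = Dom C (pairing C x y)" "Cod C h = Dom C w" "w \<cdot> h = pairing C x y"
      using w(1) by (elim liftsE) auto
    have "p \<cdot> h = x \<and> q \<cdot> h = y"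
      using h w(1,2) xy OA(1) OB(1) by (simp add: p_def q_def)
    then show "\<exists>w. w \<in> Arr C \<and> Dom C w = Dom C x \<and> Cod C w = fst W \<and> eqv A (p \<cdot> w) x \<and> eqv B (q \<cdot> w) y"
      using h xy W(2) eqv_refl[OF F(1), of x] eqv_refl[OF G(1), of y] by (intro exI[of _ h]) simp
  qed (use W in auto)
  with t show thesis by (rule that)
qed

text \<open>
  Quotient maps of the completion are those that have a section which need not respect the
  relations: objects with the path relation are projective, and each object is covered by one.
\<close>

lemma coequalizer_of_split:
  assumes e: "tracked A B e" and s: "s \<in> Arr C" "Dom C s = fst B" "Cod C s = fst A"
    and es: "eqv B (e \<cdot> s) (Ident C (fst B))"
    and u: "tracked W A u" and v: "tracked W A v" and uv: "eqv B (e \<cdot> u) (e \<cdot> v)"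
    and cover: "\<And>x y. \<lbrakk>x \<in> Arr C; y \<in> Arr C; Dom C y = Dom C x; Cod C x = fst A; Cod C y = fst A;
      eqv B (e \<cdot> x) (e \<cdot> y)\<rbrakk> \<Longrightarrow> \<exists>w. w \<in> Arr C \<and> Dom C w = Dom C x \<and> Cod C w = fst W \<and>
        eqv A (u \<cdot> w) x \<and> eqv A (v \<cdot> w) y"
  shows "is_coequalizer (Hex C) (cls W A u) (cls W A v) (cls A B e)"
proof -
  note E = trackedD[OF e] and U = trackedD[OF u] and V = trackedD[OF v]
  have esb: "eqv B (e \<cdot> s \<cdot> b) b" if "b \<in> Arr C" "Cod C b = fst B" for b
    using eqv_comp'[OF E(2) es, of b] that E(3-5) s by simp
  have univ: "\<exists>!h. h \<in> Hom (Hex C) B Y \<and> h \<cdot>\<^bsub>Hex C\<^esub> cls A B e = F"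
    if F: "F \<in> Hom (Hex C) A Y" and eq: "F \<cdot>\<^bsub>Hex C\<^esub> cls W A u = F \<cdot>\<^bsub>Hex C\<^esub> cls W A v" for F Y
  proof -
    obtain f where f: "tracked A Y f" "F = cls A Y f" using F Hex_Hom_iff by blast
    note T = trackedD[OF f(1)]
    have fuv: "eqv Y (f \<cdot> u) (f \<cdot> v)"
      using eq f u v cls_eq_iff[OF tracked_comp[OF u f(1)] tracked_comp[OF v f(1)]] by simp
    have K: "eqv Y (f \<cdot> x) (f \<cdot> y)"
      if xy: "x \<in> Arr C" "y \<in> Arr C" "Dom C y = Dom C x" "Cod C x = fst A" "Cod C y = fst A"
        "eqv B (e \<cdot> x) (e \<cdot> y)" for x y
    proof -
      obtain w where w: "w \<in> Arr C" "Cod C w = fst W" "eqv A (u \<cdot> w) x" "eqv A (v \<cdot> w) y"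
        using cover[OF xy] by blast
      have "eqv Y (f \<cdot> u \<cdot> w) (f \<cdot> v \<cdot> w)"
        using eqv_comp'[OF T(2) fuv, of w] w(1,2) T(3-5) U(3-5) V(3-5) by simp
      from eqv_trans[OF T(2) eqv_sym[OF T(2) T(6)[OF w(3)]] eqv_trans[OF T(2) this T(6)[OF w(4)]]]
      show ?thesis .
    qed
    have h: "tracked B Y (f \<cdot> s)"
    proof (rule trackedI)
      show "eqv Y ((f \<cdot> s) \<cdot> b) ((f \<cdot> s) \<cdot> c)" if bc: "eqv B b c" for b c
      proof -
        note BC = eqv_arrD[OF bc]
        have "eqv B (e \<cdot> s \<cdot> b) (e \<cdot> s \<cdot> c)"
          using eqv_trans[OF E(2) esb[OF BC(1,4)] eqv_trans[OF E(2) bc eqv_sym[OF E(2) esb[OF BC(2,5)]]]] .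
        then show ?thesis using K[of "s \<cdot> b" "s \<cdot> c"] BC s T(3-5) by simp
      qed
    qed (use E(2) T s in auto)
    have "eqv Y (f \<cdot> s \<cdot> e) f"
      using K[of "s \<cdot> e" "Ident C (fst A)"] esb[of e] E(3-5) s T(3-5) objD(1)[OF E(1)] by simp
    then have "cls B Y (f \<cdot> s) \<cdot>\<^bsub>Hex C\<^esub> cls A B e = F"
      using h e f cls_eq_iff[OF tracked_comp[OF e h] f(1)] s T(3-5) E(3-5) by simp
    moreover have "H = cls B Y (f \<cdot> s)" if H: "H \<in> Hom (Hex C) B Y" "H \<cdot>\<^bsub>Hex C\<^esub> cls A B e = F" for H
    proof -
      obtain k where k: "tracked B Y k" "H = cls B Y k" using H Hex_Hom_iff by blast
      note KD = trackedD[OF k(1)]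
      have "eqv Y (k \<cdot> e) f"
        using H(2) e k f cls_eq_iff[OF tracked_comp[OF e k(1)] f(1)] by simp
      then have "eqv Y (k \<cdot> e \<cdot> s) (f \<cdot> s)"
        using eqv_comp'[OF T(2), of "k \<cdot> e" f s] s T(3-5) E(3-5) KD(3-5) by simp
      moreover have "eqv Y (k \<cdot> e \<cdot> s) k" using KD(6)[OF es] KD(3-5) by simp
      ultimately have "eqv Y k (f \<cdot> s)" using eqv_trans[OF T(2)] eqv_sym[OF T(2)] by blast
      then show ?thesis using k cls_eq_iff[OF k(1) h] by simp
    qed
    moreover have "cls B Y (f \<cdot> s) \<in> Hom (Hex C) B Y" using h Hex_Hom_iff by blast
    ultimately show ?thesis by blast
  qed
  show ?thesis
    unfolding is_coequalizer_def
  proof (intro conjI allI ballI impI)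
    show "cls A B e \<cdot>\<^bsub>Hex C\<^esub> cls W A u = cls A B e \<cdot>\<^bsub>Hex C\<^esub> cls W A v"
      using u v e uv cls_eq_iff[OF tracked_comp[OF u e] tracked_comp[OF v e]] by simp
  next
    fix Y F assume "F \<in> Hom (Hex C) (Cod (Hex C) (cls W A u)) Y"
      "F \<cdot>\<^bsub>Hex C\<^esub> cls W A u = F \<cdot>\<^bsub>Hex C\<^esub> cls W A v"
    then show "\<exists>!h. h \<in> Hom (Hex C) (Cod (Hex C) (cls A B e)) Y \<and> h \<cdot>\<^bsub>Hex C\<^esub> cls A B e = F"
      using univ[of F Y] u e by simp
  qed (use u v e in \<open>auto simp: Hom_def\<close>)
qed

text \<open>
  For the implication from left to right, the map \<open>e\<close> factors through its image; as a coequaliser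
  it extends this factorisation to \<open>B\<close>, and that extension is the section.
\<close>

lemma regular_epi_iff:
  assumes e: "tracked A B e"
  shows "regular_epi (Hex C) (cls A B e) \<longleftrightarrow>
    (\<exists>s. s \<in> Arr C \<and> Dom C s = fst B \<and> Cod C s = fst A \<and> eqv B (e \<cdot> s) (Ident C (fst B)))"
proof
  note E = trackedD[OF e]
  assume "\<exists>s. s \<in> Arr C \<and> Dom C s = fst B \<and> Cod C s = fst A \<and> eqv B (e \<cdot> s) (Ident C (fst B))"
  then obtain s where s: "s \<in> Arr C" "Dom C s = fst B" "Cod C s = fst A" "eqv B (e \<cdot> s) (Ident C (fst B))"
    by blast
  obtain W u v where W: "tracked W A u" "tracked W A v" and pb: "el_pullback A A B W e e u v"
    by (rule Hex_pullback_ex[OF e e])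
  have "is_coequalizer (Hex C) (cls W A u) (cls W A v) (cls A B e)"
    using el_pullbackD(1,2)[OF pb] by (intro coequalizer_of_split[OF e s W]) auto
  then show "regular_epi (Hex C) (cls A B e)" unfolding regular_epi_def by blast
next
  note E = trackedD[OF e]
  assume "regular_epi (Hex C) (cls A B e)"
  then obtain U V where coeq: "is_coequalizer (Hex C) U V (cls A B e)" unfolding regular_epi_def by blast
  have UV: "U \<in> Arr (Hex C)" "V \<in> Hom (Hex C) (Dom (Hex C) U) (Cod (Hex C) U)" "Cod (Hex C) U = A"
    "cls A B e \<cdot>\<^bsub>Hex C\<^esub> U = cls A B e \<cdot>\<^bsub>Hex C\<^esub> V"
    using coeq e unfolding is_coequalizer_def by (auto simp: Hom_def)
  have ex: "\<exists>!h. h \<in> Hom (Hex C) B Y \<and> h \<cdot>\<^bsub>Hex C\<^esub> cls A B e = F"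
    if "F \<in> Hom (Hex C) A Y" "F \<cdot>\<^bsub>Hex C\<^esub> U = F \<cdot>\<^bsub>Hex C\<^esub> V" for F Y
    using coeq that UV(3) e unfolding is_coequalizer_def by (simp del: split_paired_All)
  obtain W where W: "Dom (Hex C) U = W" by simp
  obtain u where u: "tracked W A u" "U = cls W A u"
    by (rule Hex_ArrE[OF UV(1) W UV(3)])
  obtain v where v: "tracked W A v" "V = cls W A v"
    using UV(2,3) W Hex_Hom_iff by blast
  have uv: "eqv B (e \<cdot> u) (e \<cdot> v)"
    using UV(4) u v e cls_eq_iff[OF tracked_comp[OF u(1) e] tracked_comp[OF v(1) e]] by simp
  \<comment> \<open>The image of \<open>e\<close>: the underlying object of \<open>A\<close> with the relation pulled back from \<open>B\<close>.\<close>
  obtain p where p: "obj (Dom C e, p)" "\<And>x y. eqv (Dom C e, p) x y \<longleftrightarrow>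
      x \<in> Arr C \<and> y \<in> Arr C \<and> Cod C x = Dom C e \<and> Cod C y = Dom C e \<and> eqv B (e \<cdot> x) (e \<cdot> y)"
    by (rule obj_inverse_image[OF E(2,3,5)], rule that)
  define I where "I = (fst A, p)"
  have I: "obj I" "fst I = fst A" "\<And>x y. eqv I x y \<longleftrightarrow>
      x \<in> Arr C \<and> y \<in> Arr C \<and> Cod C x = fst A \<and> Cod C y = fst A \<and> eqv B (e \<cdot> x) (e \<cdot> y)"
    using p E(4) by (simp_all add: I_def)
  note OA = objD(1)[OF E(1)] and OB = objD(1)[OF E(2)]
  have q: "tracked A I (Ident C (fst A))"
  proof (rule trackedI)
    show "eqv I (Ident C (fst A) \<cdot> x) (Ident C (fst A) \<cdot> y)" if "eqv A x y" for x y
      using E(6)[OF that] eqv_arrD[OF that] I(3) by simp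
  qed (use E(1) I OA in auto)
  have m: "tracked I B e" using E I by (auto intro!: trackedI)
  have "cls A I (Ident C (fst A)) \<cdot>\<^bsub>Hex C\<^esub> U = cls A I (Ident C (fst A)) \<cdot>\<^bsub>Hex C\<^esub> V"
    using u v q uv I(3) cls_eq_iff[OF tracked_comp[OF u(1) q] tracked_comp[OF v(1) q]]
      trackedD(3-5)[OF u(1)] trackedD(3-5)[OF v(1)] by simp
  moreover have "cls A I (Ident C (fst A)) \<in> Hom (Hex C) A I" using q Hex_Hom_iff by blast
  ultimately obtain H where H: "H \<in> Hom (Hex C) B I" "H \<cdot>\<^bsub>Hex C\<^esub> cls A B e = cls A I (Ident C (fst A))"
    using ex by blast
  obtain h where h: "tracked B I h" "H = cls B I h" using H(1) Hex_Hom_iff by blast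
  note HD = trackedD[OF h(1)]
  have "eqv I (h \<cdot> e) (Ident C (fst A))"
    using H(2) h e q cls_eq_iff[OF tracked_comp[OF e h(1)] q] by simp
  then have ehe: "eqv B (e \<cdot> h \<cdot> e) e" using I E(3,4) OA by simp
  have eh: "tracked B B (e \<cdot> h)" by (rule tracked_comp[OF h(1) m])
  have "cls B B (e \<cdot> h) \<cdot>\<^bsub>Hex C\<^esub> cls A B e = cls A B e"
    using eh e ehe cls_eq_iff[OF tracked_comp[OF e eh] e] E(3-5) HD(3-5) I(2) by simp
  moreover have "cls B B (Ident C (fst B)) \<cdot>\<^bsub>Hex C\<^esub> cls A B e = cls A B e"
    using e tracked_Ident[OF E(2)] E(3-5) by simp
  moreover have "cls B B (e \<cdot> h) \<in> Hom (Hex C) B B" "cls B B (Ident C (fst B)) \<in> Hom (Hex C) B B"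
    "cls A B e \<in> Hom (Hex C) A B"
    using eh e tracked_Ident[OF E(2)] Hex_Hom_iff by blast+
  moreover have "cls A B e \<cdot>\<^bsub>Hex C\<^esub> U = cls A B e \<cdot>\<^bsub>Hex C\<^esub> V" by (rule UV(4))
  ultimately have "cls B B (e \<cdot> h) = cls B B (Ident C (fst B))" using ex by blast
  then have "eqv B (e \<cdot> h) (Ident C (fst B))"
    using cls_eq_iff[OF eh tracked_Ident[OF E(2)]] by simp
  then show "\<exists>s. s \<in> Arr C \<and> Dom C s = fst B \<and> Cod C s = fst A \<and> eqv B (e \<cdot> s) (Ident C (fst B))"
    using HD(3-5) I(2) by (intro exI[of _ h]) simp
qed

lemma regular_epi_pullback:
  assumes F: "regular_epi (Hex C) F" and pb: "is_pullback (Hex C) F G P Q"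
  shows "regular_epi (Hex C) Q"
proof -
  note D = category.pullback_arrD[OF category_Hex pb]
  obtain A E e where e: "tracked A E e" "F = cls A E e" by (rule Hex_Arr_cases[OF D(1)])
  have "Cod (Hex C) G = E" using D(5) e by simp
  then obtain B g where g: "tracked B E g" "G = cls B E g"
    using Hex_Arr_cases[OF D(2)] by (metis cls_simps(3))
  obtain W p q where W: "tracked W A p" "tracked W B q" "P = cls W A p" "Q = cls W B q"
    "el_pullback A B E W e g p q"
    by (rule Hex_pullbackE[OF pb[unfolded e(2) g(2)] e(1) g(1)])
  obtain s where s: "s \<in> Arr C" "Dom C s = fst E" "Cod C s = fst A" "eqv E (e \<cdot> s) (Ident C (fst E))"
    using F regular_epi_iff[OF e(1)] e(2) by blast
  note ED = trackedD[OF e(1)] and GD = trackedD[OF g(1)]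
  note OB = objD(1)[OF GD(1)]
  have "eqv E (e \<cdot> s \<cdot> g) (g \<cdot> Ident C (fst B))"
    using eqv_comp'[OF ED(2) s(4), of g] s(1-3) ED(3-5) GD(3-5) by simp
  then obtain w where w: "w \<in> Arr C" "Dom C w = Dom C (s \<cdot> g)" "Cod C w = fst W"
    "eqv B (q \<cdot> w) (Ident C (fst B))"
    using el_pullbackD(2)[OF W(5), of "s \<cdot> g" "Ident C (fst B)"] s(1-3) ED(3-5) GD(3-5) OB by auto
  then show ?thesis
    unfolding W(4) regular_epi_iff[OF W(2)] using s(1-3) GD(3-5) by (intro exI[of _ w]) simp
qed

text \<open>
  The coequaliser keeps the underlying object and takes the relation pulled back along \<open>f\<close>, so the
  identity is a section.
\<close>

lemma kernel_pair_coequalizer: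
  assumes pb: "is_pullback (Hex C) F F U V"
  shows "\<exists>e. is_coequalizer (Hex C) U V e"
proof -
  note D = category.pullback_arrD[OF category_Hex pb]
  obtain A B f where f: "tracked A B f" "F = cls A B f" by (rule Hex_Arr_cases[OF D(1)])
  obtain W u v where W: "tracked W A u" "tracked W A v" "U = cls W A u" "V = cls W A v"
    "el_pullback A A B W f f u v"
    by (rule Hex_pullbackE[OF pb[unfolded f(2)] f(1) f(1)])
  note E = trackedD[OF f(1)]
  obtain p where p: "obj (Dom C f, p)" "\<And>x y. eqv (Dom C f, p) x y \<longleftrightarrow>
      x \<in> Arr C \<and> y \<in> Arr C \<and> Cod C x = Dom C f \<and> Cod C y = Dom C f \<and> eqv B (f \<cdot> x) (f \<cdot> y)"
    by (rule obj_inverse_image[OF E(2,3,5)], rule that)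
  define I where "I = (fst A, p)"
  have I: "obj I" "fst I = fst A" "\<And>x y. eqv I x y \<longleftrightarrow>
      x \<in> Arr C \<and> y \<in> Arr C \<and> Cod C x = fst A \<and> Cod C y = fst A \<and> eqv B (f \<cdot> x) (f \<cdot> y)"
    using p E(4) by (simp_all add: I_def)
  note OA = objD(1)[OF E(1)]
  have q: "tracked A I (Ident C (fst A))"
  proof (rule trackedI)
    show "eqv I (Ident C (fst A) \<cdot> x) (Ident C (fst A) \<cdot> y)" if "eqv A x y" for x y
      using E(6)[OF that] eqv_arrD[OF that] I(3) by simp
  qed (use E(1) I OA in auto)
  have "is_coequalizer (Hex C) (cls W A u) (cls W A v) (cls A I (Ident C (fst A)))"
  proof (rule coequalizer_of_split[OF q, of "Ident C (fst A)"])
    show "eqv I (Ident C (fst A) \<cdot> Ident C (fst A)) (Ident C (fst I))"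
      using eqv_refl[OF I(1), of "Ident C (fst A)"] OA I(2) by simp
    show "eqv I (Ident C (fst A) \<cdot> u) (Ident C (fst A) \<cdot> v)"
      using el_pullbackD(1)[OF W(5)] I(3) trackedD(3-5)[OF W(1)] trackedD(3-5)[OF W(2)] by simp
    show "\<exists>w. w \<in> Arr C \<and> Dom C w = Dom C x \<and> Cod C w = fst W \<and> eqv A (u \<cdot> w) x \<and> eqv A (v \<cdot> w) y"
      if "x \<in> Arr C" "y \<in> Arr C" "Dom C y = Dom C x" "Cod C x = fst A" "Cod C y = fst A"
        "eqv I (Ident C (fst A) \<cdot> x) (Ident C (fst A) \<cdot> y)" for x y
      using el_pullbackD(2)[OF W(5) that(1-5)] that I(3) by simp
  qed (use W OA I in auto)
  then show ?thesis using W by blast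
qed

text \<open>
  An internal equivalence relation on \<open>A\<close> coarsens the relation of \<open>A\<close> on the same underlying
  object; its kernel pair is recovered because generalised elements factor by construction.
\<close>

lemma equivalence_relation_kernel_pair:
  assumes er: "equivalence_relation (Hex C) A P1 P2"
  shows "\<exists>F. kernel_pair (Hex C) F P1 P2"
proof -
  obtain W where W: "Dom (Hex C) P1 = W" by simp
  have P: "P1 \<in> Hom (Hex C) W A" "P2 \<in> Hom (Hex C) W A" "jointly_monic (Hex C) P1 P2"
    and refl: "\<exists>\<rho> \<in> Hom (Hex C) A W. P1 \<cdot>\<^bsub>Hex C\<^esub> \<rho> = Ident (Hex C) A \<and> P2 \<cdot>\<^bsub>Hex C\<^esub> \<rho> = Ident (Hex C) A"
    and sym: "\<exists>\<sigma> \<in> Hom (Hex C) W W. P1 \<cdot>\<^bsub>Hex C\<^esub> \<sigma> = P2 \<and> P2 \<cdot>\<^bsub>Hex C\<^esub> \<sigma> = P1"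
    and trans: "\<exists>Q1 Q2. is_pullback (Hex C) P2 P1 Q1 Q2 \<and> (\<exists>\<tau> \<in> Hom (Hex C) (Dom (Hex C) Q1) W.
      P1 \<cdot>\<^bsub>Hex C\<^esub> \<tau> = P1 \<cdot>\<^bsub>Hex C\<^esub> Q1 \<and> P2 \<cdot>\<^bsub>Hex C\<^esub> \<tau> = P2 \<cdot>\<^bsub>Hex C\<^esub> Q2)"
    using er unfolding equivalence_relation_def W by auto
  obtain p1 where p1: "tracked W A p1" "P1 = cls W A p1" using P(1) Hex_Hom_iff by blast
  obtain p2 where p2: "tracked W A p2" "P2 = cls W A p2" using P(2) Hex_Hom_iff by blast
  note T1 = trackedD[OF p1(1)] and T2 = trackedD[OF p2(1)]
  note OA = objD[OF T1(2)]
  note tr = eqv_trans[OF T1(2)] and sy = eqv_sym[OF T1(2)] and cmp = eqv_comp'[OF T1(2)]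
  have jm: "eqv W w w'" if w: "w \<in> Arr C" "w' \<in> Arr C" "Dom C w' = Dom C w" "Cod C w = fst W" "Cod C w' = fst W"
    and e: "eqv A (p1 \<cdot> w) (p1 \<cdot> w')" "eqv A (p2 \<cdot> w) (p2 \<cdot> w')" for w w'
  proof -
    define Z where "Z = disc (Dom C w)"
    have t: "tracked Z W w" "tracked Z W w'"
      using tracked_disc[OF T1(1) w(1,4)] tracked_disc[OF T1(1) w(2,5)] w(3) by (auto simp: Z_def)
    have "cls Z W w \<in> Hom (Hex C) Z W" "cls Z W w' \<in> Hom (Hex C) Z W" using t Hex_Hom_iff by blast+
    moreover have "P1 \<cdot>\<^bsub>Hex C\<^esub> cls Z W w = P1 \<cdot>\<^bsub>Hex C\<^esub> cls Z W w'" "P2 \<cdot>\<^bsub>Hex C\<^esub> cls Z W w = P2 \<cdot>\<^bsub>Hex C\<^esub> cls Z W w'"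
      using t p1 p2 e cls_eq_iff[OF tracked_comp[OF t(1) p1(1)] tracked_comp[OF t(2) p1(1)]]
        cls_eq_iff[OF tracked_comp[OF t(1) p2(1)] tracked_comp[OF t(2) p2(1)]] by simp_all
    ultimately have "cls Z W w = cls Z W w'" using P(3) unfolding jointly_monic_def W by blast
    then show ?thesis using cls_eq_iff[OF t] by simp
  qed
  obtain p where p: "p \<in> Fib C" "Cod C p = Prod C (fst A) (fst A)" "\<And>x y. eqv (fst A, p) x y \<longleftrightarrow>
      (\<exists>n. n \<in> Arr C \<and> Cod C n = Dom C p1 \<and> eqv A x (p1 \<cdot> n) \<and> eqv A y (p2 \<cdot> n))"
    by (rule span_relation[of A p1 p2]) (use T1(1-5) T2(3-5) in auto)
  define B where "B = (fst A, p)"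
  have Biff: "eqv B x y \<longleftrightarrow> (\<exists>n. n \<in> Arr C \<and> Cod C n = fst W \<and> eqv A x (p1 \<cdot> n) \<and> eqv A y (p2 \<cdot> n))" for x y
    using p(3) T1(4) by (simp add: B_def)
  \<comment> \<open>The relation contains that of \<open>A\<close> because \<open>W\<close> is reflexive.\<close>
  obtain r where r: "tracked A W r" "eqv A (p1 \<cdot> r) (Ident C (fst A))" "eqv A (p2 \<cdot> r) (Ident C (fst A))"
  proof -
    obtain \<rho> where \<rho>: "\<rho> \<in> Hom (Hex C) A W" "P1 \<cdot>\<^bsub>Hex C\<^esub> \<rho> = Ident (Hex C) A" "P2 \<cdot>\<^bsub>Hex C\<^esub> \<rho> = Ident (Hex C) A"
      using refl by blast
    obtain r where r: "tracked A W r" "\<rho> = cls A W r" using \<rho>(1) Hex_Hom_iff by blast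
    show thesis
      using that[OF r(1)] \<rho>(2,3) r p1 p2 cls_eq_iff[OF tracked_comp[OF r(1) p1(1)] tracked_Ident[OF T1(2)]]
        cls_eq_iff[OF tracked_comp[OF r(1) p2(1)] tracked_Ident[OF T1(2)]] by (simp add: Hex_Ident)
  qed
  note RD = trackedD[OF r(1)]
  have sub: "eqv B x y" if xy: "eqv A x y" for x y
  proof -
    note XY = eqv_arrD[OF xy]
    have "eqv A (p1 \<cdot> r \<cdot> x) x" "eqv A (p2 \<cdot> r \<cdot> x) x"
      using cmp[OF r(2), of x] cmp[OF r(3), of x] XY RD(3-5) T1(3-5) T2(3-5) by simp_all
    then have "eqv A x (p1 \<cdot> r \<cdot> x)" "eqv A y (p2 \<cdot> r \<cdot> x)"
      using sy tr[OF sy[OF xy]] by blast+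
    then show ?thesis unfolding Biff using XY RD(3-5) by (intro exI[of _ "r \<cdot> x"]) simp
  qed
  have Bsym: "eqv B y x" if xy: "eqv B x y" for x y
  proof -
    obtain \<sigma> where \<sigma>: "\<sigma> \<in> Hom (Hex C) W W" "P1 \<cdot>\<^bsub>Hex C\<^esub> \<sigma> = P2" "P2 \<cdot>\<^bsub>Hex C\<^esub> \<sigma> = P1"
      using sym by blast
    obtain s where s: "tracked W W s" "\<sigma> = cls W W s" using \<sigma>(1) Hex_Hom_iff by blast
    note S = trackedD[OF s(1)]
    have s12: "eqv A (p1 \<cdot> s) p2" "eqv A (p2 \<cdot> s) p1"
      using \<sigma>(2,3) s p1 p2 cls_eq_iff[OF tracked_comp[OF s(1) p1(1)] p2(1)]
        cls_eq_iff[OF tracked_comp[OF s(1) p2(1)] p1(1)] by simp_all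
    obtain n where n: "n \<in> Arr C" "Cod C n = fst W" "eqv A x (p1 \<cdot> n)" "eqv A y (p2 \<cdot> n)"
      using xy unfolding Biff by blast
    have "eqv A (p1 \<cdot> s \<cdot> n) (p2 \<cdot> n)" "eqv A (p2 \<cdot> s \<cdot> n) (p1 \<cdot> n)"
      using cmp[OF s12(1), of n] cmp[OF s12(2), of n] n(1,2) S(3-5) T1(3-5) T2(3-5) by simp_all
    then have "eqv A y (p1 \<cdot> s \<cdot> n)" "eqv A x (p2 \<cdot> s \<cdot> n)"
      using tr[OF n(4) sy] tr[OF n(3) sy] by blast+
    then show ?thesis unfolding Biff using n(1,2) S(3-5) by (intro exI[of _ "s \<cdot> n"]) simp
  qed
  have Btrans: "eqv B x z" if xy: "eqv B x y" and yz: "eqv B y z" for x y z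
  proof -
    obtain Q1 Q2 \<tau> where pb: "is_pullback (Hex C) P2 P1 Q1 Q2" and \<tau>: "\<tau> \<in> Hom (Hex C) (Dom (Hex C) Q1) W"
      "P1 \<cdot>\<^bsub>Hex C\<^esub> \<tau> = P1 \<cdot>\<^bsub>Hex C\<^esub> Q1" "P2 \<cdot>\<^bsub>Hex C\<^esub> \<tau> = P2 \<cdot>\<^bsub>Hex C\<^esub> Q2"
      using trans by blast
    obtain V q1 q2 where V: "tracked V W q1" "tracked V W q2" "Q1 = cls V W q1" "Q2 = cls V W q2"
      "el_pullback W W A V p2 p1 q1 q2"
      by (rule Hex_pullbackE[OF pb[unfolded p1(2) p2(2)] p2(1) p1(1)])
    have "\<tau> \<in> Hom (Hex C) V W" using \<tau>(1) V by simp
    then obtain t where t: "tracked V W t" "\<tau> = cls V W t" using Hex_Hom_iff by blast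
    have t12: "eqv A (p1 \<cdot> t) (p1 \<cdot> q1)" "eqv A (p2 \<cdot> t) (p2 \<cdot> q2)"
      using \<tau>(2,3) t V p1 p2 cls_eq_iff[OF tracked_comp[OF t(1) p1(1)] tracked_comp[OF V(1) p1(1)]]
        cls_eq_iff[OF tracked_comp[OF t(1) p2(1)] tracked_comp[OF V(2) p2(1)]] by simp_all
    note TD = trackedD[OF t(1)] and Q1 = trackedD[OF V(1)] and Q2 = trackedD[OF V(2)]
    obtain n where n: "n \<in> Arr C" "Cod C n = fst W" "eqv A x (p1 \<cdot> n)" "eqv A y (p2 \<cdot> n)"
      using xy unfolding Biff by blast
    obtain m where m: "m \<in> Arr C" "Cod C m = fst W" "eqv A y (p1 \<cdot> m)" "eqv A z (p2 \<cdot> m)"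
      using yz unfolding Biff by blast
    have nm: "eqv A (p2 \<cdot> n) (p1 \<cdot> m)" using tr[OF sy[OF n(4)] m(3)] .
    have "Dom C m = Dom C n" using eqv_arrD(3)[OF nm] n(1,2) m(1,2) T1(3-5) T2(3-5) by simp
    then obtain k where k: "k \<in> Arr C" "Cod C k = fst V" "eqv W (q1 \<cdot> k) n" "eqv W (q2 \<cdot> k) m"
      using el_pullbackD(2)[OF V(5) n(1) m(1) _ n(2) m(2) nm] by blast
    have "eqv A (p1 \<cdot> t \<cdot> k) (p1 \<cdot> q1 \<cdot> k)" "eqv A (p2 \<cdot> t \<cdot> k) (p2 \<cdot> q2 \<cdot> k)"
      using cmp[OF t12(1), of k] cmp[OF t12(2), of k] k(1,2) TD(3-5) Q1(3-5) Q2(3-5) T1(3-5) T2(3-5) by simp_all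
    then have "eqv A (p1 \<cdot> t \<cdot> k) (p1 \<cdot> n)" "eqv A (p2 \<cdot> t \<cdot> k) (p2 \<cdot> m)"
      using tr T1(6)[OF k(3)] T2(6)[OF k(4)] by blast+
    then have "eqv A x (p1 \<cdot> t \<cdot> k)" "eqv A z (p2 \<cdot> t \<cdot> k)"
      using tr[OF n(3) sy] tr[OF m(4) sy] by blast+
    then show ?thesis unfolding Biff using k(1,2) TD(3-5) by (intro exI[of _ "t \<cdot> k"]) simp
  qed
  have B: "obj B"
    unfolding B_def
  proof (rule objI[OF p(1,2) OA(1)], fold B_def)
    show "eqv B (Ident C (fst A)) (Ident C (fst A))"
      using OA(1) by (intro sub eqv_refl[OF T1(2)]) auto
  qed (rule Bsym Btrans; assumption)+
  have fB: "fst B = fst A" by (simp add: B_def)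
  have q: "tracked A B (Ident C (fst A))"
  proof (rule trackedI)
    show "eqv B (Ident C (fst A) \<cdot> x) (Ident C (fst A) \<cdot> y)" if "eqv A x y" for x y
      using sub[OF that] eqv_arrD[OF that] by simp
  qed (use T1(2) B OA fB in auto)
  have "el_pullback A A B W (Ident C (fst A)) (Ident C (fst A)) p1 p2"
    unfolding el_pullback_def
  proof (intro conjI allI impI)
    have "eqv B p1 p2"
      unfolding Biff using T1 T2 objD(1)[OF T1(1)] by (intro exI[of _ "Ident C (fst W)"]) (simp add: eqv_refl)
    then show "eqv B (Ident C (fst A) \<cdot> p1) (Ident C (fst A) \<cdot> p2)" using T1 T2 by simp
  next
    fix x y assume xy: "x \<in> Arr C" "y \<in> Arr C" "Dom C y = Dom C x" "Cod C x = fst A" "Cod C y = fst A"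
      and "eqv B (Ident C (fst A) \<cdot> x) (Ident C (fst A) \<cdot> y)"
    then have "eqv B x y" by simp
    then obtain n where n: "n \<in> Arr C" "Cod C n = fst W" "eqv A x (p1 \<cdot> n)" "eqv A y (p2 \<cdot> n)"
      unfolding Biff by blast
    have "Dom C n = Dom C x" using eqv_arrD(3)[OF n(3)] n(1,2) T1(3-5) by simp
    then show "\<exists>w. w \<in> Arr C \<and> Dom C w = Dom C x \<and> Cod C w = fst W \<and> eqv A (p1 \<cdot> w) x \<and> eqv A (p2 \<cdot> w) y"
      using n sy by (intro exI[of _ n]) simp
  qed (rule jm)
  then show ?thesis
    using Hex_pullback_iff[OF q q p1(1) p2(1)] p1(2) p2(2) unfolding kernel_pair_def by blast
qed

lemma Hex_finitely_complete: "finitely_complete (Hex C)"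
  unfolding finitely_complete_def
proof (intro conjI ballI impI)
  fix F G assume FG: "F \<in> Arr (Hex C)" "G \<in> Arr (Hex C)" "Cod (Hex C) F = Cod (Hex C) G"
  obtain A D f where f: "tracked A D f" "F = cls A D f" by (rule Hex_Arr_cases[OF FG(1)])
  have "Cod (Hex C) G = D" using FG(3) f by simp
  then obtain B g where g: "tracked B D g" "G = cls B D g"
    using Hex_Arr_cases[OF FG(2)] by (metis cls_simps(3))
  obtain W p q where W: "tracked W A p" "tracked W B q" "el_pullback A B D W f g p q"
    by (rule Hex_pullback_ex[OF f(1) g(1)])
  then show "\<exists>p q. is_pullback (Hex C) F G p q"
    using Hex_pullback_iff[OF f(1) g(1) W(1,2)] f(2) g(2) by blast
qed (rule Hex_terminal)

theorem Hex_exact: "exact_category (Hex C)"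
  unfolding exact_category_def regular_category_def kernel_pair_def
  using category_Hex Hex_finitely_complete kernel_pair_coequalizer regular_epi_pullback
    equivalence_relation_kernel_pair[unfolded kernel_pair_def] by blast

end

section \<open>Homotopy sums\<close>

context path_category
begin

lemma homotopy_congruence: "category_congruence C (homotopy_rel C)"
proof
  show "equiv (Arr C) (homotopy_rel C)"
  proof (rule equivI)
    show "homotopy_rel C \<subseteq> Arr C \<times> Arr C"
      by (auto simp: homotopy_rel_def homotopic_arrD)
    show "refl_on (Arr C) (homotopy_rel C)"
      by (auto simp: refl_on_def homotopy_rel_def homotopic_refl)
    show "sym (homotopy_rel C)"
      by (auto simp: sym_def homotopy_rel_def homotopic_sym)
    show "trans (homotopy_rel C)"
      by (auto simp: trans_def homotopy_rel_def intro: homotopic_trans)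
  qed
next
  fix f g assume "(f, g) \<in> homotopy_rel C"
  then show "Dom C g = Dom C f \<and> Cod C g = Cod C f"
    by (auto simp: homotopy_rel_def homotopic_arrD)
next
  fix f f' g g' assume fg: "(f, f') \<in> homotopy_rel C" "(g, g') \<in> homotopy_rel C" "Cod C f = Dom C g"
  then have h: "homotopic C f f'" "homotopic C g g'" by (auto simp: homotopy_rel_def)
  note D = homotopic_arrD[OF h(1)] homotopic_arrD[OF h(2)]
  have "homotopic C (g \<cdot> f) (g \<cdot> f')" by (rule homotopic_postcomp[OF h(1)]) (use D fg(3) in simp_all)
  moreover have "homotopic C (g \<cdot> f') (g' \<cdot> f')" by (rule homotopic_comp[OF h(2)]) (use D fg(3) in simp_all)
  ultimately show "(g \<cdot> f, g' \<cdot> f') \<in> homotopy_rel C"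
    using homotopic_trans by (auto simp: homotopy_rel_def)
qed

lemma homotopy_equivalence_Ident:
  assumes "A \<in> Obj C"
  shows "homotopy_equivalence C (Ident C A)"
proof -
  have "A \<in> Obj (Ho C)" using assms by (simp add: Ho_def quotient_cat_def)
  then have "is_iso (Ho C) (Ident (Ho C) A)"
    unfolding Ho_def
    by (rule category.is_iso_Ident[OF category_congruence.category_quotient[OF homotopy_congruence]])
  then show ?thesis
    using assms category_congruence.Ident_class[OF homotopy_congruence]
    by (simp add: homotopy_equivalence_def Ho_def)
qed

text \<open>A map into the source of \<open>h\<close> is enough to detect homotopy initial domains.\<close>

lemma homotopy_equivalence_back:
  assumes "homotopy_equivalence C h"
  obtains k where "k \<in> Arr C" "Dom C k = Cod C h" "Cod C k = Dom C h"
proof -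
  have h: "h \<in> Arr C" using assms by (simp add: homotopy_equivalence_def)
  obtain \<kappa> where "\<kappa> \<in> Hom (Ho C) (Cod C h) (Dom C h)"
    using assms h category_congruence.Dom_class[OF homotopy_congruence h]
      category_congruence.Cod_class[OF homotopy_congruence h]
    unfolding homotopy_equivalence_def is_iso_def Ho_def by auto
  then show thesis
    using that unfolding Ho_def category_congruence.Hom_quotient_iff[OF homotopy_congruence] by blast
qed

lemma homotopic_lift_iff:
  assumes po: "path_object C X r st" and x: "Cod C x = X"
  shows "homotopic C x y \<longleftrightarrow> eqv (X, st) x y"
proof -
  have X: "X \<in> Obj C" using path_objectD[OF po] by simp
  obtain r' where po': "path_object C X r' (snd (disc X))" using disc_path[OF X] by blast
  have d: "disc X = (X, snd (disc X))" by (simp add: disc_def)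
  show ?thesis
    using homotopic_iff[OF x] path_eqv[OF po path_object_obj[OF po']] path_eqv[OF po' path_object_obj[OF po]] d
    by metis
qed

text \<open>
  Points of a homotopy pullback are pairs with homotopic images: for the canonical one this is
  weak universality, and up to a homotopy equivalence it persists for any other.
\<close>

lemma homotopy_pullback_factor:
  assumes po: "path_object C (Cod C f) r st" and pb: "is_pullback C (prod_map C f g) st w \<pi>"
    and fg: "f \<in> Arr C" "g \<in> Arr C" "Cod C g = Cod C f"
    and uv: "u \<in> Arr C" "v \<in> Arr C" "Dom C v = Dom C u" "Cod C u = Dom C f" "Cod C v = Dom C g"
    and h: "homotopic C (f \<cdot> u) (g \<cdot> v)"
  obtains k where "k \<in> Arr C" "Dom C k = Dom C u" "Cod C k = Dom C w" "w \<cdot> k = pairing C u v"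
proof -
  have st: "st \<in> Arr C" using path_objectD[OF po] by simp
  have "eqv (Cod C f, st) (f \<cdot> u) (g \<cdot> v)"
    using homotopic_lift_iff[OF po, of "f \<cdot> u"] h fg uv by simp
  then obtain l where l: "l \<in> Arr C" "Cod C l = Dom C st" "st \<cdot> l = pairing C (f \<cdot> u) (g \<cdot> v)"
    unfolding eqv_def lifts_def by auto
  have dl: "Dom C l = Dom C u" using arg_cong[OF l(3), of "Dom C"] l(1,2) st fg uv by simp
  obtain k where "k \<in> Arr C" "Dom C k = Dom C u" "Cod C k = Dom C w" "w \<cdot> k = pairing C u v"
    by (rule pullback_factor[OF pb, of "pairing C u v" l]) (use l dl fg uv in simp_all)
  then show thesis by (rule that)
qed

lemma homotopy_pullback_ex:
  assumes fg: "f \<in> Arr C" "g \<in> Arr C" "Cod C g = Cod C f"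
  obtains a b where "is_homotopy_pullback C f g a b" "a \<in> Arr C" "b \<in> Arr C" "Dom C a = Dom C b"
    "Cod C a = Dom C f" "Cod C b = Dom C g" "homotopic C (f \<cdot> a) (g \<cdot> b)"
    "\<And>u v. \<lbrakk>u \<in> Arr C; v \<in> Arr C; Dom C v = Dom C u; Cod C u = Dom C f; Cod C v = Dom C g;
      homotopic C (f \<cdot> u) (g \<cdot> v)\<rbrakk> \<Longrightarrow>
      \<exists>k. k \<in> Arr C \<and> Dom C k = Dom C u \<and> Cod C k = Dom C b \<and> a \<cdot> k = u \<and> b \<cdot> k = v"
proof -
  obtain r st where po: "path_object C (Cod C f) r st" using path_object_ex[of "Cod C f"] fg by auto
  note P = path_objectD[OF po]
  obtain \<pi> w where pb': "is_pullback C st (prod_map C f g) \<pi> w" and "w \<in> Fib C"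
    by (rule Fib_pullback_obtain[of st "prod_map C f g"]) (use P fg in auto)
  have pb: "is_pullback C (prod_map C f g) st w \<pi>" by (rule pullback_sym[OF pb'])
  have W: "w \<in> Arr C" "\<pi> \<in> Arr C" "Dom C \<pi> = Dom C w" "Cod C w = Prod C (Dom C f) (Dom C g)" "Cod C \<pi> = Dom C st"
    "prod_map C f g \<cdot> w = st \<cdot> \<pi>"
    using pullback_arrD[OF pb] fg by simp_all
  define a b where "a = pr1 C (Dom C f) (Dom C g) \<cdot> w" and "b = pr2 C (Dom C f) (Dom C g) \<cdot> w"
  have ab: "a \<in> Arr C" "b \<in> Arr C" "Dom C a = Dom C w" "Dom C b = Dom C w" "Cod C a = Dom C f" "Cod C b = Dom C g"
    using W(1-5) fg by (simp_all add: a_def b_def)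
  have "st \<cdot> \<pi> = pairing C (f \<cdot> a) (g \<cdot> b)"
    using prod_map_comp[of f g w] W fg by (simp add: a_def b_def)
  then have "lifts st (pairing C (f \<cdot> a) (g \<cdot> b))" using W by (intro liftsI[of \<pi>]) simp_all
  then have "eqv (Cod C f, st) (f \<cdot> a) (g \<cdot> b)" using ab fg by (simp add: eqv_def)
  then have hom: "homotopic C (f \<cdot> a) (g \<cdot> b)" using homotopic_lift_iff[OF po, of "f \<cdot> a"] ab fg by simp
  have hp: "is_homotopy_pullback C f g a b"
    unfolding is_homotopy_pullback_def
  proof (intro conjI)
    have "\<exists>h \<in> Hom C (Dom C a) (Dom C w). homotopy_equivalence C h \<and>
        a = (pr1 C (Dom C f) (Dom C g) \<cdot> w) \<cdot> h \<and> b = (pr2 C (Dom C f) (Dom C g) \<cdot> w) \<cdot> h"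
      using homotopy_equivalence_Ident[of "Dom C w"] ab W(1)
      by (intro bexI[of _ "Ident C (Dom C w)"]) (simp_all add: Hom_iff a_def[symmetric] b_def[symmetric])
    with po pb show "\<exists>r st w \<pi>. path_object C (Cod C f) r st \<and> is_pullback C (prod_map C f g) st w \<pi> \<and>
       (\<exists>h \<in> Hom C (Dom C a) (Dom C w). homotopy_equivalence C h \<and>
          a = (pr1 C (Dom C f) (Dom C g) \<cdot> w) \<cdot> h \<and> b = (pr2 C (Dom C f) (Dom C g) \<cdot> w) \<cdot> h)"
      by blast
  qed (use ab fg hom in \<open>simp_all add: Hom_iff\<close>)
  have factor: "\<exists>k. k \<in> Arr C \<and> Dom C k = Dom C u \<and> Cod C k = Dom C b \<and> a \<cdot> k = u \<and> b \<cdot> k = v"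
    if uv: "u \<in> Arr C" "v \<in> Arr C" "Dom C v = Dom C u" "Cod C u = Dom C f" "Cod C v = Dom C g"
      "homotopic C (f \<cdot> u) (g \<cdot> v)" for u v
  proof -
    obtain k where k: "k \<in> Arr C" "Dom C k = Dom C u" "Cod C k = Dom C w" "w \<cdot> k = pairing C u v"
      by (rule homotopy_pullback_factor[OF po pb fg uv])
    have "a \<cdot> k = u" "b \<cdot> k = v" using k W(1,4) uv fg by (simp_all add: a_def b_def)
    then show ?thesis using k ab by (intro exI[of _ k]) simp
  qed
  show thesis by (rule that[OF hp _ _ _ _ _ hom factor]) (use ab in simp_all)
qed

lemma homotopy_pullback_map:
  assumes hp: "is_homotopy_pullback C f g a b"
    and uv: "u \<in> Arr C" "v \<in> Arr C" "Dom C v = Dom C u" "Cod C u = Dom C f" "Cod C v = Dom C g"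
    and h: "homotopic C (f \<cdot> u) (g \<cdot> v)"
  obtains k where "k \<in> Arr C" "Dom C k = Dom C u" "Cod C k = Dom C a"
proof -
  have fg: "f \<in> Arr C" "g \<in> Arr C" "Cod C g = Cod C f"
    using hp by (auto simp: is_homotopy_pullback_def Hom_iff)
  obtain r st w \<pi> e where po: "path_object C (Cod C f) r st" and pb: "is_pullback C (prod_map C f g) st w \<pi>"
    and e: "e \<in> Hom C (Dom C a) (Dom C w)" "homotopy_equivalence C e"
    using hp unfolding is_homotopy_pullback_def by blast
  obtain k where k: "k \<in> Arr C" "Dom C k = Dom C u" "Cod C k = Dom C w"
    using homotopy_pullback_factor[OF po pb fg uv h] by blast
  obtain l where l: "l \<in> Arr C" "Dom C l = Cod C e" "Cod C l = Dom C e"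
    by (rule homotopy_equivalence_back[OF e(2)])
  show thesis
    using k l e(1) by (intro that[of "l \<cdot> k"]) (simp_all add: Hom_iff)
qed

lemma homotopy_sumD:
  assumes "is_homotopy_sum C A B i j"
  shows "i \<in> Arr C" "j \<in> Arr C" "Dom C i = A" "Dom C j = B" "Cod C j = Cod C i"
  using assms by (auto simp: is_homotopy_sum_def Hom_iff)

lemma homotopy_sum_sym:
  assumes s: "is_homotopy_sum C A B i j"
  shows "is_homotopy_sum C B A j i"
proof -
  have cod: "Cod C j = Cod C i" using homotopy_sumD[OF s] by simp
  show ?thesis using s unfolding is_homotopy_sum_def cod by blast
qed

lemma homotopy_sum_copair:
  assumes "is_homotopy_sum C A B i j" "f \<in> Arr C" "g \<in> Arr C" "Dom C f = A" "Dom C g = B" "Cod C g = Cod C f"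
  obtains h where "h \<in> Arr C" "Dom C h = Cod C i" "Cod C h = Cod C f" "homotopic C (h \<cdot> i) f" "homotopic C (h \<cdot> j) g"
proof -
  have "\<exists>h \<in> Hom C (Cod C i) (Cod C f). homotopic C (h \<cdot> i) f \<and> homotopic C (h \<cdot> j) g"
  proof -
    have "f \<in> Hom C A (Cod C f)" "g \<in> Hom C B (Cod C f)" using assms by (simp_all add: Hom_iff)
    then show ?thesis using assms(1) unfolding is_homotopy_sum_def by blast
  qed
  then show thesis using that by (auto simp: Hom_iff)
qed

lemma homotopy_sum_unique:
  assumes s: "is_homotopy_sum C A B i j" and h: "h \<in> Arr C" "k \<in> Arr C" "Dom C h = Cod C i" "Dom C k = Cod C i"
    "Cod C k = Cod C h" and eq: "homotopic C (h \<cdot> i) (k \<cdot> i)" "homotopic C (h \<cdot> j) (k \<cdot> j)"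
  shows "homotopic C h k"
proof -
  note D = homotopy_sumD[OF s]
  have "k \<cdot> i \<in> Hom C A (Cod C h)" "k \<cdot> j \<in> Hom C B (Cod C h)" "h \<in> Hom C (Cod C i) (Cod C h)"
    "k \<in> Hom C (Cod C i) (Cod C h)" "homotopic C (k \<cdot> i) (k \<cdot> i)" "homotopic C (k \<cdot> j) (k \<cdot> j)"
    using D h by (simp_all add: Hom_iff homotopic_refl)
  with s eq show ?thesis unfolding is_homotopy_sum_def by blast
qed

text \<open>
  Predicates are local along homotopy sums: lifts over the two summands glue up to homotopy, and
  a predicate respects homotopy.
\<close>

lemma lifts_local:
  assumes s: "is_homotopy_sum C A B c d" and p: "p \<in> Fib C" and g: "g \<in> Arr C" "Dom C g = Cod C c" "Cod C g = Cod C p"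
    and l: "lifts p (g \<cdot> c)" "lifts p (g \<cdot> d)"
  shows "lifts p g"
proof -
  note D = homotopy_sumD[OF s]
  obtain u where u: "u \<in> Arr C" "Dom C u = Dom C (g \<cdot> c)" "Cod C u = Dom C p" "p \<cdot> u = g \<cdot> c"
    by (rule liftsE[OF l(1)]) (use p in auto)
  obtain v where v: "v \<in> Arr C" "Dom C v = Dom C (g \<cdot> d)" "Cod C v = Dom C p" "p \<cdot> v = g \<cdot> d"
    by (rule liftsE[OF l(2)]) (use p in auto)
  obtain h where h: "h \<in> Arr C" "Dom C h = Cod C c" "Cod C h = Dom C p" "homotopic C (h \<cdot> c) u" "homotopic C (h \<cdot> d) v"
    using homotopy_sum_copair[OF s u(1) v(1)] u v D g by auto
  have "homotopic C (p \<cdot> h \<cdot> c) (g \<cdot> c)" "homotopic C (p \<cdot> h \<cdot> d) (g \<cdot> d)"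
    using homotopic_postcomp[OF h(4), of p] homotopic_postcomp[OF h(5), of p] p h(1-3) u(4) v(4) D by simp_all
  then have "homotopic C (p \<cdot> h) g"
    by - (rule homotopy_sum_unique[OF s], use p h(1-3) g D in simp_all)
  moreover have "lifts p (p \<cdot> h)" using h by (intro liftsI[of h]) simp_all
  ultimately show ?thesis using p h(1-3) by (intro homotopic_lifts[of p "p \<cdot> h" g]) simp_all
qed

lemma lifts_homotopy_initial:
  assumes Z: "homotopy_initial C (Dom C g)" and p: "p \<in> Fib C" and g: "g \<in> Arr C" "Cod C g = Cod C p"
  shows "lifts p g"
proof -
  obtain h where h: "h \<in> Arr C" "Dom C h = Dom C g" "Cod C h = Dom C p"
  proof -
    have "Hom C (Dom C g) (Dom C p) \<noteq> {}" using Z p by (simp add: homotopy_initial_def)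
    then show thesis using that by (auto simp: Hom_iff)
  qed
  have "homotopic C (p \<cdot> h) g"
  proof -
    have "p \<cdot> h \<in> Hom C (Dom C g) (Cod C g)" "g \<in> Hom C (Dom C g) (Cod C g)" "Cod C g \<in> Obj C"
      using p h g by (simp_all add: Hom_iff)
    then show ?thesis using Z unfolding homotopy_initial_def by blast
  qed
  moreover have "lifts p (p \<cdot> h)" using h by (intro liftsI[of h]) simp_all
  ultimately show ?thesis using p h by (intro homotopic_lifts[of p "p \<cdot> h" g]) simp_all
qed

definition fibred :: "'o \<times> 'm \<Rightarrow> bool" where
  "fibred A \<longleftrightarrow> snd A \<in> Fib C \<and> Cod C (snd A) = Prod C (fst A) (fst A)"

lemma obj_fibred: "obj A \<Longrightarrow> fibred A"
  by (simp add: fibred_def objD)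

lemma eqv_local:
  assumes A: "fibred A" and s: "is_homotopy_sum C Z1 Z2 c d"
    and xy: "x \<in> Arr C" "y \<in> Arr C" "Dom C x = Cod C c" "Dom C y = Cod C c" "Cod C x = fst A" "Cod C y = fst A"
    and e: "eqv A (x \<cdot> c) (y \<cdot> c)" "eqv A (x \<cdot> d) (y \<cdot> d)"
  shows "eqv A x y"
proof -
  note D = homotopy_sumD[OF s]
  have "lifts (snd A) (pairing C x y)"
    by (rule lifts_local[OF s]) (use A xy D e in \<open>simp_all add: fibred_def eqv_def\<close>)
  then show ?thesis using xy by (simp add: eqv_def)
qed

lemma eqv_homotopy_initial:
  assumes A: "fibred A" and Z: "homotopy_initial C (Dom C x)"
    and xy: "x \<in> Arr C" "y \<in> Arr C" "Dom C y = Dom C x" "Cod C x = fst A" "Cod C y = fst A"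
  shows "eqv A x y"
proof -
  have "lifts (snd A) (pairing C x y)"
    by (rule lifts_homotopy_initial) (use A xy Z in \<open>simp_all add: fibred_def\<close>)
  then show ?thesis using xy by (simp add: eqv_def)
qed

lemma eqv_homotopic:
  assumes A: "obj A" and e: "eqv A x y" and h: "homotopic C x' x" "homotopic C y' y"
  shows "eqv A x' y'"
proof -
  note E = eqv_arrD[OF e] and H = homotopic_arrD[OF h(1)] homotopic_arrD[OF h(2)]
  have "eqv A x' x" "eqv A y' y" using homotopic_eqv[OF A] h E H by simp_all
  then show ?thesis using e eqv_trans[OF A] eqv_sym[OF A] by blast
qed

end

locale homotopy_extensive_category = path_category C
  for C :: "('o, 'm, 'z) path_cat_scheme" (structure) +
  assumes extensive: "homotopy_extensive C"
begin

lemma homotopy_initialD: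
  assumes "homotopy_initial C Z"
  shows "Z \<in> Obj C" "\<And>A. A \<in> Obj C \<Longrightarrow> \<exists>f. f \<in> Arr C \<and> Dom C f = Z \<and> Cod C f = A"
    "\<And>f g. f \<in> Arr C \<Longrightarrow> g \<in> Arr C \<Longrightarrow> Dom C f = Z \<Longrightarrow> Dom C g = Z \<Longrightarrow> Cod C g = Cod C f \<Longrightarrow> homotopic C f g"
proof -
  show "Z \<in> Obj C" using assms by (simp add: homotopy_initial_def)
  show "\<exists>f. f \<in> Arr C \<and> Dom C f = Z \<and> Cod C f = A" if "A \<in> Obj C" for A
  proof -
    have "Hom C Z A \<noteq> {}" using assms that by (simp add: homotopy_initial_def)
    then show ?thesis by (auto simp: Hom_iff)
  qed
  show "homotopic C f g" if "f \<in> Arr C" "g \<in> Arr C" "Dom C f = Z" "Dom C g = Z" "Cod C g = Cod C f" for f g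
  proof -
    have "f \<in> Hom C Z (Cod C f)" "g \<in> Hom C Z (Cod C f)" "Cod C f \<in> Obj C" using that by (simp_all add: Hom_iff)
    then show ?thesis using assms unfolding homotopy_initial_def by blast
  qed
qed

lemma homotopy_sum_ex:
  assumes "A \<in> Obj C" "B \<in> Obj C"
  obtains i j where "is_homotopy_sum C A B i j"
  using extensive assms unfolding homotopy_extensive_def by blast

text \<open>
  Stability, applied to the canonical homotopy pullbacks, splits any map into a sum.
\<close>

lemma homotopy_sum_split:
  assumes s: "is_homotopy_sum C A B i j" and x: "x \<in> Arr C" "Cod C x = Cod C i"
  obtains a c b d where "is_homotopy_sum C (Dom C c) (Dom C d) c d" "Cod C c = Dom C x"
    "a \<in> Arr C" "Dom C a = Dom C c" "Cod C a = A" "homotopic C (i \<cdot> a) (x \<cdot> c)"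
    "b \<in> Arr C" "Dom C b = Dom C d" "Cod C b = B" "homotopic C (j \<cdot> b) (x \<cdot> d)"
    "\<And>u v. \<lbrakk>u \<in> Arr C; v \<in> Arr C; Dom C v = Dom C u; Cod C u = A; Cod C v = Dom C x; homotopic C (i \<cdot> u) (x \<cdot> v)\<rbrakk> \<Longrightarrow>
      \<exists>k. k \<in> Arr C \<and> Dom C k = Dom C u \<and> Cod C k = Dom C c \<and> a \<cdot> k = u \<and> c \<cdot> k = v"
    "\<And>u v. \<lbrakk>u \<in> Arr C; v \<in> Arr C; Dom C v = Dom C u; Cod C u = B; Cod C v = Dom C x; homotopic C (j \<cdot> u) (x \<cdot> v)\<rbrakk> \<Longrightarrow>
      \<exists>k. k \<in> Arr C \<and> Dom C k = Dom C u \<and> Cod C k = Dom C d \<and> b \<cdot> k = u \<and> d \<cdot> k = v"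
proof -
  note D = homotopy_sumD[OF s]
  have xj: "Cod C x = Cod C j" using x D by simp
  obtain a c where ac: "is_homotopy_pullback C i x a c" "a \<in> Arr C" "c \<in> Arr C" "Dom C a = Dom C c"
    "Cod C a = Dom C i" "Cod C c = Dom C x" "homotopic C (i \<cdot> a) (x \<cdot> c)"
    "\<And>u v. \<lbrakk>u \<in> Arr C; v \<in> Arr C; Dom C v = Dom C u; Cod C u = Dom C i; Cod C v = Dom C x; homotopic C (i \<cdot> u) (x \<cdot> v)\<rbrakk> \<Longrightarrow>
      \<exists>k. k \<in> Arr C \<and> Dom C k = Dom C u \<and> Cod C k = Dom C c \<and> a \<cdot> k = u \<and> c \<cdot> k = v"
    by (rule homotopy_pullback_ex[OF D(1) x(1,2)], rule that)
  obtain b d where bd: "is_homotopy_pullback C j x b d" "b \<in> Arr C" "d \<in> Arr C" "Dom C b = Dom C d"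
    "Cod C b = Dom C j" "Cod C d = Dom C x" "homotopic C (j \<cdot> b) (x \<cdot> d)"
    "\<And>u v. \<lbrakk>u \<in> Arr C; v \<in> Arr C; Dom C v = Dom C u; Cod C u = Dom C j; Cod C v = Dom C x; homotopic C (j \<cdot> u) (x \<cdot> v)\<rbrakk> \<Longrightarrow>
      \<exists>k. k \<in> Arr C \<and> Dom C k = Dom C u \<and> Cod C k = Dom C d \<and> b \<cdot> k = u \<and> d \<cdot> k = v"
    by (rule homotopy_pullback_ex[OF D(2) x(1) xj], rule that)
  have "is_homotopy_sum C (Dom C c) (Dom C d) c d"
    using extensive s ac(1) bd(1) unfolding homotopy_extensive_def stable_homotopy_sum_def by blast
  then show thesis
    by (rule that[OF _ ac(6) ac(2,4) ac(5)[unfolded D(3)] ac(7) bd(2,4) bd(5)[unfolded D(4)] bd(7)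
        ac(8)[unfolded D(3)] bd(8)[unfolded D(4)]])
qed

text \<open>
  A homotopy initial object \<open>Z\<close> is its own double, so a map \<open>Y \<rightarrow> Z\<close> exhibits an object over
  \<open>Y\<close>, with a section, as its own double as well; then any two maps out of \<open>Y\<close> agree.
\<close>

lemma homotopy_initial_strict:
  assumes Z: "homotopy_initial C Z" and x: "x \<in> Arr C" "Cod C x = Z"
  shows "homotopy_initial C (Dom C x)"
proof -
  note I = homotopy_initialD[OF Z]
  have s: "is_homotopy_sum C Z Z (Ident C Z) (Ident C Z)"
    unfolding is_homotopy_sum_def
  proof (intro conjI allI ballI impI)
    fix X f g assume fg: "f \<in> Hom C Z X" "g \<in> Hom C Z X"
    show "\<exists>h \<in> Hom C (Cod C (Ident C Z)) X. homotopic C (h \<cdot> Ident C Z) f \<and> homotopic C (h \<cdot> Ident C Z) g"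
      using fg I(1) I(3)[of f g] by (intro bexI[of _ f]) (auto simp: Hom_iff homotopic_refl)
    fix h h' assume "h \<in> Hom C (Cod C (Ident C Z)) X" "h' \<in> Hom C (Cod C (Ident C Z)) X"
    then show "homotopic C h h'" using I(1) I(3)[of h h'] by (auto simp: Hom_iff)
  qed (use I in \<open>simp_all add: Hom_iff\<close>)
  obtain a c where ac: "is_homotopy_pullback C (Ident C Z) x a c" "a \<in> Arr C" "c \<in> Arr C" "Dom C a = Dom C c"
    "Cod C c = Dom C x"
    "\<And>u v. \<lbrakk>u \<in> Arr C; v \<in> Arr C; Dom C v = Dom C u; Cod C u = Dom C (Ident C Z); Cod C v = Dom C x;
      homotopic C (Ident C Z \<cdot> u) (x \<cdot> v)\<rbrakk> \<Longrightarrow>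
      \<exists>k. k \<in> Arr C \<and> Dom C k = Dom C u \<and> Cod C k = Dom C c \<and> a \<cdot> k = u \<and> c \<cdot> k = v"
    by (rule homotopy_pullback_ex[of "Ident C Z" x]) (use x I(1) in auto)
  have cc: "is_homotopy_sum C (Dom C c) (Dom C c) c c"
    using extensive s ac(1) unfolding homotopy_extensive_def stable_homotopy_sum_def by blast
  obtain k where k: "k \<in> Arr C" "Dom C k = Dom C x" "Cod C k = Dom C c" "c \<cdot> k = Ident C (Dom C x)"
    using ac(6)[of x "Ident C (Dom C x)"] x I(1) by (auto simp: homotopic_refl)
  have "homotopic C f g" if fg: "f \<in> Arr C" "g \<in> Arr C" "Dom C f = Dom C x" "Dom C g = Dom C x" "Cod C g = Cod C f"
    for f g
  proof -
    obtain h where h: "h \<in> Arr C" "Dom C h = Cod C c" "Cod C h = Cod C (f \<cdot> c)"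
      "homotopic C (h \<cdot> c) (f \<cdot> c)" "homotopic C (h \<cdot> c) (g \<cdot> c)"
      by (rule homotopy_sum_copair[OF cc, of "f \<cdot> c" "g \<cdot> c"]) (use fg ac in auto)
    have "homotopic C (f \<cdot> c) (g \<cdot> c)" using homotopic_trans[OF homotopic_sym[OF h(4)] h(5)] .
    then have "homotopic C ((f \<cdot> c) \<cdot> k) ((g \<cdot> c) \<cdot> k)" by - (rule homotopic_comp, use k fg ac in simp_all)
    then show ?thesis using k fg ac by simp
  qed
  moreover have "Hom C (Dom C x) A \<noteq> {}" if A: "A \<in> Obj C" for A
  proof -
    obtain f where "f \<in> Arr C" "Dom C f = Z" "Cod C f = A" using I(2)[OF A] by blast
    then have "f \<cdot> x \<in> Hom C (Dom C x) A" using x by (simp add: Hom_iff)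
    then show ?thesis by blast
  qed
  ultimately show ?thesis
    using x unfolding homotopy_initial_def by (auto simp: Hom_iff)
qed

lemma homotopy_sum_disjoint:
  assumes s: "is_homotopy_sum C A B i j"
    and uv: "u \<in> Arr C" "v \<in> Arr C" "Dom C v = Dom C u" "Cod C u = A" "Cod C v = B"
    and h: "homotopic C (i \<cdot> u) (j \<cdot> v)"
  shows "homotopy_initial C (Dom C u)"
proof -
  note D = homotopy_sumD[OF s]
  obtain a b where ab: "homotopy_initial C (Dom C a)" "is_homotopy_pullback C i j a b"
    using extensive s unfolding homotopy_extensive_def disjoint_homotopy_sum_def by blast
  obtain k where "k \<in> Arr C" "Dom C k = Dom C u" "Cod C k = Dom C a"
    by (rule homotopy_pullback_map[OF ab(2) uv(1,2,3)]) (use uv D h in auto)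
  then show ?thesis using homotopy_initial_strict[OF ab(1), of k] by simp
qed

text \<open>
  Splitting \<open>i\<close> along its own sum leaves nothing over \<open>B\<close>, so the homotopy kernel pair of \<open>i\<close>
  already is all of \<open>A\<close>: its diagonal is inverse to the projection.
\<close>

lemma homotopy_sum_monic:
  assumes s: "is_homotopy_sum C A B i j"
    and uv: "u \<in> Arr C" "v \<in> Arr C" "Dom C v = Dom C u" "Cod C u = A" "Cod C v = A"
    and h: "homotopic C (i \<cdot> u) (i \<cdot> v)"
  shows "homotopic C u v"
proof -
  note D = homotopy_sumD[OF s]
  have A: "A \<in> Obj C" using D by auto
  obtain a c b d where sp: "is_homotopy_sum C (Dom C c) (Dom C d) c d" "Cod C c = Dom C i"
    "a \<in> Arr C" "Dom C a = Dom C c" "Cod C a = A" "homotopic C (i \<cdot> a) (i \<cdot> c)"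
    "b \<in> Arr C" "Dom C b = Dom C d" "Cod C b = B" "homotopic C (j \<cdot> b) (i \<cdot> d)"
    "\<And>u v. \<lbrakk>u \<in> Arr C; v \<in> Arr C; Dom C v = Dom C u; Cod C u = A; Cod C v = Dom C i; homotopic C (i \<cdot> u) (i \<cdot> v)\<rbrakk> \<Longrightarrow>
      \<exists>k. k \<in> Arr C \<and> Dom C k = Dom C u \<and> Cod C k = Dom C c \<and> a \<cdot> k = u \<and> c \<cdot> k = v"
    by (rule homotopy_sum_split[OF s D(1) refl], rule that)
  note E = homotopy_sumD[OF sp(1)]
  have cA: "Cod C c = A" "Cod C d = A" using sp(2) E D by simp_all
  have dI: "homotopy_initial C (Dom C d)"
    using homotopy_sum_disjoint[OF s, of d b] homotopic_sym[OF sp(10)] E cA sp(7-9) by simp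
  obtain \<delta> where \<delta>: "\<delta> \<in> Arr C" "Dom C \<delta> = A" "Cod C \<delta> = Dom C c" "a \<cdot> \<delta> = Ident C A" "c \<cdot> \<delta> = Ident C A"
    using sp(11)[of "Ident C A" "Ident C A"] D A homotopic_refl[of i] by auto
  obtain e where e: "e \<in> Arr C" "Dom C e = Dom C d" "Cod C e = Dom C c"
    using homotopy_initialD(2)[OF dI, of "Dom C c"] E by auto
  obtain q where q: "q \<in> Arr C" "Dom C q = Cod C c" "Cod C q = Cod C (Ident C (Dom C c))"
    "homotopic C (q \<cdot> c) (Ident C (Dom C c))"
    by (rule homotopy_sum_copair[OF sp(1), of "Ident C (Dom C c)" e]) (use E e in auto)
  have q': "Cod C q = Dom C c" "Dom C q = A" using q(2,3) E cA by simp_all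
  have "q \<cdot> c \<cdot> \<delta> \<cdot> c = q \<cdot> c"
    using Comp_eq_comp[OF \<delta>(5), of c] \<delta>(1-3) E cA by simp
  moreover have "homotopic C ((q \<cdot> c) \<cdot> \<delta> \<cdot> c) (Ident C (Dom C c) \<cdot> \<delta> \<cdot> c)"
    by (rule homotopic_comp) (use q(1,4) q' \<delta>(1-3) E cA in simp_all)
  ultimately have "homotopic C (q \<cdot> c) (\<delta> \<cdot> c)" using q(1) q' \<delta>(1-3) E cA by simp
  then have "homotopic C (\<delta> \<cdot> c) (Ident C (Dom C c))" using homotopic_trans[OF homotopic_sym q(4)] by blast
  then have "homotopic C (a \<cdot> \<delta> \<cdot> c) (a \<cdot> Ident C (Dom C c))"
    by - (rule homotopic_postcomp, use sp(3-5) E cA \<delta>(1-3) in simp_all)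
  then have ca: "homotopic C c a"
    using Comp_eq_comp[OF \<delta>(4), of c] sp(3-5) E cA \<delta>(1-3) by simp
  obtain k where k: "k \<in> Arr C" "Dom C k = Dom C u" "Cod C k = Dom C c" "a \<cdot> k = u" "c \<cdot> k = v"
    using sp(11)[OF uv(1-4) _ h] uv(5) D by auto
  have "homotopic C (c \<cdot> k) (a \<cdot> k)" by (rule homotopic_comp[OF ca]) (use k(1-3) E in simp_all)
  then show ?thesis using k homotopic_sym by simp
qed

lemma homotopy_initial_sum:
  assumes s: "is_homotopy_sum C A B i j" and A: "homotopy_initial C A" and B: "homotopy_initial C B"
  shows "homotopy_initial C (Cod C i)"
proof -
  note D = homotopy_sumD[OF s] and IA = homotopy_initialD[OF A] and IB = homotopy_initialD[OF B]
  obtain e where e: "e \<in> Arr C" "Dom C e = B" "Cod C e = A" using IB(2)[OF IA(1)] by blast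
  obtain q where q: "q \<in> Arr C" "Dom C q = Cod C i" "Cod C q = Cod C (Ident C A)"
    by (rule homotopy_sum_copair[OF s, of "Ident C A" e]) (use IA(1) e in auto)
  then show ?thesis using homotopy_initial_strict[OF A, of q] IA(1) by simp
qed

section \<open>Sums in the homotopy exact completion\<close>

definition split_eqv where
  "split_eqv A B i j a b \<longleftrightarrow> (\<exists>c d x x' y y'.
    is_homotopy_sum C (Dom C c) (Dom C d) c d \<and> Cod C c = Dom C a \<and>
    homotopic C (a \<cdot> c) (i \<cdot> x) \<and> homotopic C (b \<cdot> c) (i \<cdot> x') \<and> eqv A x x' \<and>
    homotopic C (a \<cdot> d) (j \<cdot> y) \<and> homotopic C (b \<cdot> d) (j \<cdot> y') \<and> eqv B y y')"

text \<open>
  The relation carried by a sum is axiomatised in a way that is symmetric in the two summands: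
  its pairs are locally pairs from one of the two relations.
\<close>

definition sum_rel where
  "sum_rel A B i j p \<longleftrightarrow> obj A \<and> obj B \<and> is_homotopy_sum C (fst A) (fst B) i j \<and> fibred (Cod C i, p) \<and>
    (\<forall>x x'. eqv A x x' \<longrightarrow> eqv (Cod C i, p) (i \<cdot> x) (i \<cdot> x')) \<and>
    (\<forall>y y'. eqv B y y' \<longrightarrow> eqv (Cod C i, p) (j \<cdot> y) (j \<cdot> y')) \<and>
    (\<forall>a a' b b'. homotopic C a' a \<longrightarrow> homotopic C b' b \<longrightarrow> eqv (Cod C i, p) a b \<longrightarrow> eqv (Cod C i, p) a' b') \<and>
    (\<forall>a b. eqv (Cod C i, p) a b \<longrightarrow> split_eqv A B i j a b)"

lemma split_eqv_sym: "split_eqv A B i j a b \<Longrightarrow> split_eqv B A j i a b"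
proof -
  assume "split_eqv A B i j a b"
  then obtain c d x x' y y' where *: "is_homotopy_sum C (Dom C c) (Dom C d) c d" "Cod C c = Dom C a"
    "homotopic C (a \<cdot> c) (i \<cdot> x)" "homotopic C (b \<cdot> c) (i \<cdot> x')" "eqv A x x'"
    "homotopic C (a \<cdot> d) (j \<cdot> y)" "homotopic C (b \<cdot> d) (j \<cdot> y')" "eqv B y y'"
    unfolding split_eqv_def by blast
  have "Cod C d = Dom C a" using *(2) homotopy_sumD(5)[OF *(1)] by simp
  with * homotopy_sum_sym[OF *(1)] show ?thesis unfolding split_eqv_def by blast
qed

lemma sum_relD:
  assumes "sum_rel A B i j p"
  shows "obj A" "obj B" "is_homotopy_sum C (fst A) (fst B) i j" "fibred (Cod C i, p)"
    "\<And>x x'. eqv A x x' \<Longrightarrow> eqv (Cod C i, p) (i \<cdot> x) (i \<cdot> x')"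
    "\<And>y y'. eqv B y y' \<Longrightarrow> eqv (Cod C i, p) (j \<cdot> y) (j \<cdot> y')"
    "\<And>a a' b b'. homotopic C a' a \<Longrightarrow> homotopic C b' b \<Longrightarrow> eqv (Cod C i, p) a b \<Longrightarrow> eqv (Cod C i, p) a' b'"
    "\<And>a b. eqv (Cod C i, p) a b \<Longrightarrow> split_eqv A B i j a b"
  using assms unfolding sum_rel_def by blast+

lemma sum_rel_sym: "sum_rel A B i j p \<Longrightarrow> sum_rel B A j i p"
proof -
  assume S: "sum_rel A B i j p"
  note D = sum_relD[OF S]
  have "Cod C j = Cod C i" using homotopy_sumD(5)[OF D(3)] .
  then show ?thesis
    using D(1-6) D(7) split_eqv_sym[OF D(8)] homotopy_sum_sym[OF D(3)] unfolding sum_rel_def by (metis (no_types))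
qed

text \<open>
  The pairs of this relation are the images of the elements of a homotopy sum of the two given
  relations, and stability splits any such element.
\<close>

lemma sum_rel_ex:
  assumes A: "obj A" and B: "obj B" and s: "is_homotopy_sum C (fst A) (fst B) i j"
  obtains p where "sum_rel A B i j p"
proof -
  obtain X r where AX: "A = (X, r)" by (cases A)
  obtain Y t where BY: "B = (Y, t)" by (cases B)
  note OA = objD[OF A, unfolded AX, simplified] and OB = objD[OF B, unfolded BY, simplified]
  note D = homotopy_sumD[OF s, unfolded AX BY, simplified]
  define V where "V = Cod C i"
  have V: "V \<in> Obj C" "Cod C i = V" "Cod C j = V" using D by (simp_all add: V_def)
  have rt: "r \<in> Arr C" "t \<in> Arr C" using OA OB by simp_all
  define r1 r2 t1 t2 where "r1 = pr1 C X X \<cdot> r" and "r2 = pr2 C X X \<cdot> r"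
    and "t1 = pr1 C Y Y \<cdot> t" and "t2 = pr2 C Y Y \<cdot> t"
  have RT: "r1 \<in> Arr C" "r2 \<in> Arr C" "Dom C r1 = Dom C r" "Dom C r2 = Dom C r" "Cod C r1 = X" "Cod C r2 = X"
    "t1 \<in> Arr C" "t2 \<in> Arr C" "Dom C t1 = Dom C t" "Dom C t2 = Dom C t" "Cod C t1 = Y" "Cod C t2 = Y"
    using OA OB by (simp_all add: r1_def r2_def t1_def t2_def)
  have iffA: "eqv A x x' \<longleftrightarrow> (\<exists>h. h \<in> Arr C \<and> Cod C h = Dom C r \<and> r1 \<cdot> h = x \<and> r2 \<cdot> h = x')" for x x'
    unfolding AX eqv_iff[OF rt(1) OA(3,1)] r1_def r2_def using OA by (metis Comp_assoc' Fib_ArrD pr_simps)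
  have iffB: "eqv B x x' \<longleftrightarrow> (\<exists>h. h \<in> Arr C \<and> Cod C h = Dom C t \<and> t1 \<cdot> h = x \<and> t2 \<cdot> h = x')" for x x'
    unfolding BY eqv_iff[OF rt(2) OB(3,1)] t1_def t2_def using OB by (metis Comp_assoc' Fib_ArrD pr_simps)
  obtain c d where cd: "is_homotopy_sum C (Dom C r) (Dom C t) c d"
    by (rule homotopy_sum_ex[of "Dom C r" "Dom C t"]) (use rt in auto)
  note E = homotopy_sumD[OF cd]
  obtain k1 where k1: "k1 \<in> Arr C" "Dom C k1 = Cod C c" "Cod C k1 = Cod C (i \<cdot> r1)"
    "homotopic C (k1 \<cdot> c) (i \<cdot> r1)" "homotopic C (k1 \<cdot> d) (j \<cdot> t1)"
    by (rule homotopy_sum_copair[OF cd, of "i \<cdot> r1" "j \<cdot> t1"]) (use D RT in simp_all)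
  obtain k2 where k2: "k2 \<in> Arr C" "Dom C k2 = Cod C c" "Cod C k2 = Cod C (i \<cdot> r2)"
    "homotopic C (k2 \<cdot> c) (i \<cdot> r2)" "homotopic C (k2 \<cdot> d) (j \<cdot> t2)"
    by (rule homotopy_sum_copair[OF cd, of "i \<cdot> r2" "j \<cdot> t2"]) (use D RT in simp_all)
  have K: "Cod C k1 = V" "Cod C k2 = V" using k1(3) k2(3) D RT V by simp_all
  obtain p where p: "p \<in> Fib C" "Cod C p = Prod C (fst (disc V)) (fst (disc V))"
    "\<And>a b. eqv (fst (disc V), p) a b \<longleftrightarrow>
      (\<exists>n. n \<in> Arr C \<and> Cod C n = Dom C k1 \<and> eqv (disc V) a (k1 \<cdot> n) \<and> eqv (disc V) b (k2 \<cdot> n))"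
    by (rule span_relation[of "disc V" k1 k2]) (use V K k1 k2 in auto)
  have homV: "eqv (disc V) a (k \<cdot> n) \<longleftrightarrow> homotopic C a (k \<cdot> n)"
    if "k \<in> Arr C" "Dom C k = Cod C c" "Cod C k = V" "n \<in> Arr C" "Cod C n = Cod C c" for a k n
  proof (cases "Cod C a = V")
    case False
    have "Cod C (k \<cdot> n) = V" using that by simp
    then show ?thesis using False eqv_arrD(4)[of "disc V" a "k \<cdot> n"] homotopic_arrD(4)[of a "k \<cdot> n"] by auto
  qed (simp add: homotopic_iff)
  have T: "eqv (V, p) a b \<longleftrightarrow>
      (\<exists>n. n \<in> Arr C \<and> Cod C n = Cod C c \<and> homotopic C a (k1 \<cdot> n) \<and> homotopic C b (k2 \<cdot> n))" for a b
    using p(3)[of a b] homV[OF k1(1,2) K(1)] homV[OF k2(1,2) K(2)] k1(2) by auto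
  have "sum_rel A B i j p"
    unfolding sum_rel_def V(2)
  proof (intro conjI allI impI A B s)
    show "fibred (V, p)" using p(1,2) by (simp add: fibred_def)
  next
    fix x x' assume "eqv A x x'"
    then obtain h where h: "h \<in> Arr C" "Cod C h = Dom C r" "r1 \<cdot> h = x" "r2 \<cdot> h = x'" unfolding iffA by blast
    have "homotopic C ((k1 \<cdot> c) \<cdot> h) ((i \<cdot> r1) \<cdot> h)"
      by (rule homotopic_comp[OF k1(4)]) (use h(1,2) k1(1,2) E in simp_all)
    moreover have "homotopic C ((k2 \<cdot> c) \<cdot> h) ((i \<cdot> r2) \<cdot> h)"
      by (rule homotopic_comp[OF k2(4)]) (use h(1,2) k2(1,2) E in simp_all)
    ultimately have "homotopic C (i \<cdot> x) (k1 \<cdot> c \<cdot> h)" "homotopic C (i \<cdot> x') (k2 \<cdot> c \<cdot> h)"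
      using homotopic_sym h k1(1,2) k2(1,2) E D RT by simp_all
    then show "eqv (V, p) (i \<cdot> x) (i \<cdot> x')" unfolding T using h E by (intro exI[of _ "c \<cdot> h"]) simp
  next
    fix x x' assume "eqv B x x'"
    then obtain h where h: "h \<in> Arr C" "Cod C h = Dom C t" "t1 \<cdot> h = x" "t2 \<cdot> h = x'" unfolding iffB by blast
    have "homotopic C ((k1 \<cdot> d) \<cdot> h) ((j \<cdot> t1) \<cdot> h)"
      by (rule homotopic_comp[OF k1(5)]) (use h(1,2) k1(1,2) E in simp_all)
    moreover have "homotopic C ((k2 \<cdot> d) \<cdot> h) ((j \<cdot> t2) \<cdot> h)"
      by (rule homotopic_comp[OF k2(5)]) (use h(1,2) k2(1,2) E in simp_all)
    ultimately have "homotopic C (j \<cdot> x) (k1 \<cdot> d \<cdot> h)" "homotopic C (j \<cdot> x') (k2 \<cdot> d \<cdot> h)"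
      using homotopic_sym h k1(1,2) k2(1,2) E D RT by simp_all
    then show "eqv (V, p) (j \<cdot> x) (j \<cdot> x')" unfolding T using h E by (intro exI[of _ "d \<cdot> h"]) simp
  next
    fix a a' b b' assume "homotopic C a' a" "homotopic C b' b" "eqv (V, p) a b"
    then show "eqv (V, p) a' b'" unfolding T using homotopic_trans by blast
  next
    fix a b assume "eqv (V, p) a b"
    then obtain n where n: "n \<in> Arr C" "Cod C n = Cod C c" "homotopic C a (k1 \<cdot> n)" "homotopic C b (k2 \<cdot> n)"
      unfolding T by blast
    note HA = homotopic_arrD[OF n(3)] and HB = homotopic_arrD[OF n(4)]
    have dn: "Dom C a = Dom C n" "Dom C b = Dom C n" using HA(3) HB(3) n(1,2) k1(1,2) k2(1,2) by simp_all
    obtain a' c' b' d' where sp: "is_homotopy_sum C (Dom C c') (Dom C d') c' d'" "Cod C c' = Dom C n"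
      "a' \<in> Arr C" "Dom C a' = Dom C c'" "Cod C a' = Dom C r" "homotopic C (c \<cdot> a') (n \<cdot> c')"
      "b' \<in> Arr C" "Dom C b' = Dom C d'" "Cod C b' = Dom C t" "homotopic C (d \<cdot> b') (n \<cdot> d')"
      by (rule homotopy_sum_split[OF cd n(1,2)], rule that)
    note F = homotopy_sumD[OF sp(1)]
    have glue: "homotopic C (z \<cdot> l) (m \<cdot> q \<cdot> e)"
      if "homotopic C z (k \<cdot> n)" "homotopic C (f \<cdot> e) (n \<cdot> l)" "homotopic C (k \<cdot> f) (m \<cdot> q)"
        "k \<in> Arr C" "Dom C k = Cod C c" "f \<in> Arr C" "Cod C f = Cod C c" "e \<in> Arr C" "Cod C e = Dom C f"
        "l \<in> Arr C" "Cod C l = Dom C n" "m \<in> Arr C" "q \<in> Arr C" "Cod C q = Dom C m" "Dom C q = Dom C f"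
      for z l m q e k f
    proof -
      have 1: "homotopic C (z \<cdot> l) (k \<cdot> n \<cdot> l)"
        using homotopic_comp[OF that(1), of l] that(4-) homotopic_arrD(3)[OF that(1)] n(1,2) by simp
      have 2: "homotopic C (k \<cdot> n \<cdot> l) (k \<cdot> f \<cdot> e)"
        by (rule homotopic_postcomp[OF homotopic_sym[OF that(2)]]) (use that(4-) n(1,2) in simp_all)
      have 3: "homotopic C (k \<cdot> f \<cdot> e) (m \<cdot> q \<cdot> e)"
        using homotopic_comp[OF that(3), of e] that(4-) by simp
      show ?thesis by (rule homotopic_trans[OF 1 homotopic_trans[OF 2 3]])
    qed
    have "homotopic C (a \<cdot> c') (i \<cdot> r1 \<cdot> a')" "homotopic C (b \<cdot> c') (i \<cdot> r2 \<cdot> a')"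
      "homotopic C (a \<cdot> d') (j \<cdot> t1 \<cdot> b')" "homotopic C (b \<cdot> d') (j \<cdot> t2 \<cdot> b')"
      using glue[OF n(3) sp(6) k1(4)] glue[OF n(4) sp(6) k2(4)] glue[OF n(3) sp(10) k1(5)] glue[OF n(4) sp(10) k2(5)]
        k1(1,2) k2(1,2) E F sp(2-5,7-9) D RT V by simp_all
    moreover have "eqv A (r1 \<cdot> a') (r2 \<cdot> a')" "eqv B (t1 \<cdot> b') (t2 \<cdot> b')"
      unfolding iffA iffB using sp by blast+
    moreover have "Cod C c' = Dom C a" using sp(2) dn by simp
    ultimately show "split_eqv A B i j a b" unfolding split_eqv_def using sp(1) by blast
  qed
  then show thesis by (rule that)
qed

lemma sum_rel_splitE:
  assumes S: "sum_rel A B i j p" and e: "eqv (Cod C i, p) a b"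
  obtains c d x x' y y' where "is_homotopy_sum C (Dom C c) (Dom C d) c d" "Cod C c = Dom C a" "Cod C d = Dom C a"
    "Cod C c = Dom C b" "Cod C d = Dom C b"
    "homotopic C (a \<cdot> c) (i \<cdot> x)" "homotopic C (b \<cdot> c) (i \<cdot> x')" "eqv A x x'"
    "homotopic C (a \<cdot> d) (j \<cdot> y)" "homotopic C (b \<cdot> d) (j \<cdot> y')" "eqv B y y'"
    "Dom C x = Dom C c" "Dom C x' = Dom C c" "Dom C y = Dom C d" "Dom C y' = Dom C d"
proof -
  note D = sum_relD[OF S] and E = eqv_arrD[OF e]
  note IJ = homotopy_sumD[OF D(3)]
  obtain c d x x' y y' where *: "is_homotopy_sum C (Dom C c) (Dom C d) c d" "Cod C c = Dom C a"
    "homotopic C (a \<cdot> c) (i \<cdot> x)" "homotopic C (b \<cdot> c) (i \<cdot> x')" "eqv A x x'"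
    "homotopic C (a \<cdot> d) (j \<cdot> y)" "homotopic C (b \<cdot> d) (j \<cdot> y')" "eqv B y y'"
    using D(8)[OF e] unfolding split_eqv_def by blast
  note F = homotopy_sumD[OF *(1)] and X = eqv_arrD[OF *(5)] and Y = eqv_arrD[OF *(8)]
  have "Dom C (i \<cdot> x) = Dom C (a \<cdot> c)" "Dom C (j \<cdot> y) = Dom C (a \<cdot> d)"
    using homotopic_arrD(3)[OF *(3)] homotopic_arrD(3)[OF *(6)] .
  then have "Dom C x = Dom C c" "Dom C y = Dom C d" using F *(2) X Y IJ E by simp_all
  then show thesis by - (rule that[OF *(1,2) _ _ _ *(3-8)], use *(2) F X Y E in simp_all)
qed

text \<open>
  On the first piece of a splitting \<open>i\<close> can be cancelled, and the second piece is homotopy initial.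
\<close>

lemma sum_rel_reflects:
  assumes S: "sum_rel A B i j p"
    and uv: "u \<in> Arr C" "v \<in> Arr C" "Cod C u = fst A" "Cod C v = fst A"
    and e: "eqv (Cod C i, p) (i \<cdot> u) (i \<cdot> v)"
  shows "eqv A u v"
proof -
  note D = sum_relD[OF S]
  note IJ = homotopy_sumD[OF D(3)]
  have duv: "Dom C v = Dom C u" using eqv_arrD(3)[OF e] uv IJ by simp
  obtain c d x x' y y' where sp: "is_homotopy_sum C (Dom C c) (Dom C d) c d" "Cod C c = Dom C (i \<cdot> u)" "Cod C d = Dom C (i \<cdot> u)"
    "homotopic C ((i \<cdot> u) \<cdot> c) (i \<cdot> x)" "homotopic C ((i \<cdot> v) \<cdot> c) (i \<cdot> x')" "eqv A x x'"
    "homotopic C ((i \<cdot> u) \<cdot> d) (j \<cdot> y)" "eqv B y y'"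
    "Dom C x = Dom C c" "Dom C x' = Dom C c" "Dom C y = Dom C d"
    by (rule sum_rel_splitE[OF S e], rule that)
  note F = homotopy_sumD[OF sp(1)] and X = eqv_arrD[OF sp(6)] and Y = eqv_arrD[OF sp(8)]
  have cu: "Cod C c = Dom C u" "Cod C d = Dom C u" using sp(2,3) uv IJ by simp_all
  have "homotopic C (u \<cdot> c) x" "homotopic C (v \<cdot> c) x'"
    using sp(4,5) cu F uv duv X IJ sp(9,10) by (auto intro!: homotopy_sum_monic[OF D(3)])
  then have "eqv A (u \<cdot> c) (v \<cdot> c)" by (rule eqv_homotopic[OF D(1) sp(6)])
  moreover have "homotopy_initial C (Dom C d)"
    using homotopy_sum_disjoint[OF D(3), of "u \<cdot> d" y] sp(7) cu F uv IJ Y sp(11) by simp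
  then have "eqv A (u \<cdot> d) (v \<cdot> d)"
    using cu F uv duv obj_fibred[OF D(1)] by (intro eqv_homotopy_initial) simp_all
  ultimately show ?thesis
    by - (rule eqv_local[OF obj_fibred[OF D(1)] sp(1)], use cu uv duv F in simp_all)
qed

text \<open>On either piece of a splitting one of the two elements comes from both summands.\<close>

lemma sum_rel_disjoint:
  assumes S: "sum_rel A B i j p"
    and uv: "u \<in> Arr C" "v \<in> Arr C" "Cod C u = fst A" "Cod C v = fst B"
    and e: "eqv (Cod C i, p) (i \<cdot> u) (j \<cdot> v)"
  shows "homotopy_initial C (Dom C u)"
proof -
  note D = sum_relD[OF S]
  note IJ = homotopy_sumD[OF D(3)]
  have duv: "Dom C v = Dom C u" using eqv_arrD(3)[OF e] uv IJ by simp
  obtain c d x x' y y' where sp: "is_homotopy_sum C (Dom C c) (Dom C d) c d" "Cod C c = Dom C (i \<cdot> u)" "Cod C d = Dom C (i \<cdot> u)"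
    "homotopic C ((j \<cdot> v) \<cdot> c) (i \<cdot> x')" "eqv A x x'" "homotopic C ((i \<cdot> u) \<cdot> d) (j \<cdot> y)" "eqv B y y'"
    "Dom C x' = Dom C c" "Dom C y = Dom C d"
    by (rule sum_rel_splitE[OF S e], rule that)
  note F = homotopy_sumD[OF sp(1)] and X = eqv_arrD[OF sp(5)] and Y = eqv_arrD[OF sp(7)]
  have cu: "Cod C c = Dom C u" "Cod C d = Dom C u" using sp(2,3) uv IJ by simp_all
  have "homotopy_initial C (Dom C d)"
    using homotopy_sum_disjoint[OF D(3), of "u \<cdot> d" y] sp(6) cu F uv IJ Y sp(9) by simp
  moreover have "homotopy_initial C (Dom C c)"
    using homotopy_sum_disjoint[OF D(3), of x' "v \<cdot> c"] homotopic_sym[OF sp(4)] cu F uv duv IJ X sp(8) by simp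
  ultimately show ?thesis using homotopy_initial_sum[OF sp(1)] cu by simp
qed

text \<open>
  Transitivity on the part of the domain where the middle element comes from \<open>A\<close>: there the
  third element comes from \<open>A\<close> too, except on a homotopy initial piece.
\<close>

lemma sum_rel_extend:
  assumes S: "sum_rel A B i j p" and xx: "eqv A x x'" and a: "homotopic C a (i \<cdot> x)" and b: "homotopic C b (i \<cdot> x')"
    and e: "eqv (Cod C i, p) b z"
  shows "eqv (Cod C i, p) a z"
proof -
  note D = sum_relD[OF S]
  note IJ = homotopy_sumD[OF D(3)]
  note X = eqv_arrD[OF xx] and HA = homotopic_arrD[OF a] and HB = homotopic_arrD[OF b] and E = eqv_arrD[OF e]
  have doms: "Dom C a = Dom C x" "Dom C b = Dom C x" using HA(3) HB(3) X IJ by simp_all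
  have cods: "Cod C a = Cod C i" "Cod C b = Cod C i" "Cod C z = Cod C i" using HA(4) HB(4) X IJ E by simp_all
  obtain c d u v y y' where sp: "is_homotopy_sum C (Dom C c) (Dom C d) c d" "Cod C c = Dom C b" "Cod C d = Dom C b"
    "homotopic C (b \<cdot> c) (i \<cdot> u)" "homotopic C (z \<cdot> c) (i \<cdot> v)" "eqv A u v" "homotopic C (b \<cdot> d) (j \<cdot> y)" "eqv B y y'"
    "Dom C u = Dom C c" "Dom C y = Dom C d"
    by (rule sum_rel_splitE[OF S e], rule that)
  note F = homotopy_sumD[OF sp(1)] and U = eqv_arrD[OF sp(6)] and Y = eqv_arrD[OF sp(8)]
  have bx: "homotopic C (b \<cdot> k) (i \<cdot> x' \<cdot> k)" "homotopic C (a \<cdot> k) (i \<cdot> x \<cdot> k)" if "k \<in> Arr C" "Cod C k = Dom C b" for k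
    using homotopic_comp[OF b, of k] homotopic_comp[OF a, of k] that doms X IJ by simp_all
  have "homotopic C (i \<cdot> x' \<cdot> c) (i \<cdot> u)"
    using homotopic_trans[OF homotopic_sym[OF bx(1)] sp(4)] F sp(2) by simp
  then have "homotopic C (x' \<cdot> c) u"
    by - (rule homotopy_sum_monic[OF D(3)], use F sp(2,9) doms X U in simp_all)
  then have "eqv A (x' \<cdot> c) v"
    using eqv_homotopic[OF D(1) sp(6) _ homotopic_refl] U by blast
  moreover have "eqv A (x \<cdot> c) (x' \<cdot> c)" using eqv_comp'[OF D(1) xx, of c] F sp(2) doms by simp
  ultimately have "eqv A (x \<cdot> c) v" using eqv_trans[OF D(1)] by blast
  then have "eqv (Cod C i, p) (i \<cdot> x \<cdot> c) (i \<cdot> v)" by (rule D(5))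
  then have 1: "eqv (Cod C i, p) (a \<cdot> c) (z \<cdot> c)" using D(7)[OF bx(2) sp(5)] F sp(2) by simp
  have "homotopic C (i \<cdot> x' \<cdot> d) (j \<cdot> y)"
    using homotopic_trans[OF homotopic_sym[OF bx(1)] sp(7)] F sp(3) by simp
  then have "homotopy_initial C (Dom C d)"
    using homotopy_sum_disjoint[OF D(3), of "x' \<cdot> d" y] F sp(3,10) doms X Y by simp
  then have 2: "eqv (Cod C i, p) (a \<cdot> d) (z \<cdot> d)"
    using F sp(3) doms X HA E cods by (intro eqv_homotopy_initial[OF D(4)]) simp_all
  show ?thesis
    by (rule eqv_local[OF D(4) sp(1) _ _ _ _ _ _ 1 2]) (use F sp(2) doms HA E cods in simp_all)
qed

lemma sum_rel_obj:
  assumes S: "sum_rel A B i j p"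
  shows "obj (Cod C i, p)"
proof (rule objI)
  note D = sum_relD[OF S]
  note IJ = homotopy_sumD[OF D(3)]
  show "p \<in> Fib C" "Cod C p = Prod C (Cod C i) (Cod C i)" using D(4) by (simp_all add: fibred_def)
  show O: "Cod C i \<in> Obj C" using IJ by simp
  have "eqv A (Ident C (fst A)) (Ident C (fst A))" "eqv B (Ident C (fst B)) (Ident C (fst B))"
    using objD(1)[OF D(1)] objD(1)[OF D(2)] by (auto intro: eqv_refl[OF D(1)] eqv_refl[OF D(2)])
  from D(5)[OF this(1)] D(6)[OF this(2)]
  have "eqv (Cod C i, p) i i" "eqv (Cod C i, p) j j" using IJ by simp_all
  then show "eqv (Cod C i, p) (Ident C (Cod C i)) (Ident C (Cod C i))"
    by - (rule eqv_local[OF D(4) D(3)], use O IJ in simp_all)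
  show "eqv (Cod C i, p) b a" if ab: "eqv (Cod C i, p) a b" for a b
  proof -
    note E = eqv_arrD[OF ab]
    obtain c d x x' y y' where sp: "is_homotopy_sum C (Dom C c) (Dom C d) c d" "Cod C c = Dom C a"
      "homotopic C (a \<cdot> c) (i \<cdot> x)" "homotopic C (b \<cdot> c) (i \<cdot> x')" "eqv A x x'"
      "homotopic C (a \<cdot> d) (j \<cdot> y)" "homotopic C (b \<cdot> d) (j \<cdot> y')" "eqv B y y'"
      by (rule sum_rel_splitE[OF S ab], rule that)
    have 1: "eqv (Cod C i, p) (b \<cdot> c) (a \<cdot> c)"
      using D(7)[OF sp(4,3) D(5)[OF eqv_sym[OF D(1) sp(5)]]] .
    have 2: "eqv (Cod C i, p) (b \<cdot> d) (a \<cdot> d)"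
      using D(7)[OF sp(7,6) D(6)[OF eqv_sym[OF D(2) sp(8)]]] .
    show ?thesis
      by (rule eqv_local[OF D(4) sp(1) _ _ _ _ _ _ 1 2]) (use sp(2) E in simp_all)
  qed
  show "eqv (Cod C i, p) a z" if ab: "eqv (Cod C i, p) a b" and bz: "eqv (Cod C i, p) b z" for a b z
  proof -
    note E = eqv_arrD[OF ab] and Z = eqv_arrD[OF bz]
    have pA: "p \<in> Arr C" using D(4) by (simp add: fibred_def)
    obtain c d x x' y y' where sp: "is_homotopy_sum C (Dom C c) (Dom C d) c d" "Cod C c = Dom C a"
      "homotopic C (a \<cdot> c) (i \<cdot> x)" "homotopic C (b \<cdot> c) (i \<cdot> x')" "eqv A x x'"
      "homotopic C (a \<cdot> d) (j \<cdot> y)" "homotopic C (b \<cdot> d) (j \<cdot> y')" "eqv B y y'"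
      by (rule sum_rel_splitE[OF S ab], rule that)
    note F = homotopy_sumD[OF sp(1)]
    have "eqv (Cod C i, p) (b \<cdot> c) (z \<cdot> c)" "eqv (Cod C i, p) (b \<cdot> d) (z \<cdot> d)"
      using eqv_comp[OF bz, of c] eqv_comp[OF bz, of d] pA F sp(2) E by simp_all
    moreover have cj: "Cod C i = Cod C j" using IJ by simp
    ultimately have 1: "eqv (Cod C i, p) (a \<cdot> c) (z \<cdot> c)" and 2: "eqv (Cod C i, p) (a \<cdot> d) (z \<cdot> d)"
      using sum_rel_extend[OF S sp(5,3,4)] sum_rel_extend[OF sum_rel_sym[OF S] sp(8,6,7)] by simp_all
    show ?thesis
      by (rule eqv_local[OF D(4) sp(1) _ _ _ _ _ _ 1 2]) (use sp(2) E Z in simp_all)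
  qed
qed

text \<open>
  Every element of \<open>A\<close> has a homotopy initial domain, so all conditions on elements hold trivially.
\<close>

lemma Hex_initial:
  assumes A: "obj A" and Z: "homotopy_initial C (fst A)"
  shows "initial (Hex C) A"
proof -
  note I = homotopy_initialD[OF Z]
  have "\<exists>!\<alpha>. \<alpha> \<in> Hom (Hex C) A B" if B: "obj B" for B
  proof -
    obtain f where f: "f \<in> Arr C" "Dom C f = fst A" "Cod C f = fst B"
      using I(2)[OF objD(1)[OF B]] by blast
    have t: "tracked A B f"
    proof (rule trackedI[OF A B f])
      fix x y assume e: "eqv A x y"
      note E = eqv_arrD[OF e]
      have "homotopy_initial C (Dom C x)" by (rule homotopy_initial_strict[OF Z E(1,4)])
      then show "eqv B (f \<cdot> x) (f \<cdot> y)"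
        using E f by (intro eqv_homotopy_initial[OF obj_fibred[OF B]]) simp_all
    qed
    show ?thesis
    proof (rule ex1I)
      show "cls A B f \<in> Hom (Hex C) A B" using t Hex_Hom_iff by blast
      fix \<alpha> assume "\<alpha> \<in> Hom (Hex C) A B"
      then obtain g where g: "tracked A B g" "\<alpha> = cls A B g" using Hex_Hom_iff by blast
      have "eqv B g f"
        using Z f trackedD(3-5)[OF g(1)] by (intro eqv_homotopy_initial[OF obj_fibred[OF B]]) simp_all
      then show "\<alpha> = cls A B f" using g cls_eq_iff[OF g(1) t] by simp
    qed
  qed
  then show ?thesis unfolding initial_def using A by (intro conjI ballI) (simp_all add: Hex_Obj)
qed

lemma Hex_initial_ex:
  obtains A where "obj A" "homotopy_initial C (fst A)" "initial (Hex C) A"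
proof -
  obtain Z where Z: "homotopy_initial C Z" using extensive unfolding homotopy_extensive_def by blast
  have "obj (disc Z)" using homotopy_initialD(1)[OF Z] by simp
  then show thesis using Z Hex_initial[of "disc Z"] by (intro that[of "disc Z"]) simp_all
qed

lemma Hex_initial_strict:
  assumes Z: "initial (Hex C) Z" and Y: "Y \<in> Obj (Hex C)" "Hom (Hex C) Y Z \<noteq> {}"
  shows "initial (Hex C) Y"
proof -
  obtain A where A: "obj A" "homotopy_initial C (fst A)" by (rule Hex_initial_ex)
  have "\<exists>\<alpha>. \<alpha> \<in> Hom (Hex C) Z A" using Z A(1) Hex_Obj unfolding initial_def by blast
  then obtain g where g: "tracked Z A g" using Hex_Hom_iff by blast
  obtain f where f: "tracked Y Z f" using Y(2) Hex_Hom_iff by blast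
  note D = trackedD(3-5)[OF tracked_comp[OF f g]]
  have "homotopy_initial C (fst Y)" using homotopy_initial_strict[OF A(2) D(1,3)] D(2) by simp
  then show ?thesis using Y(1) Hex_Obj Hex_initial by blast
qed

lemma Hex_coproductI:
  assumes i: "tracked A V i" and j: "tracked B V j"
    and ex: "\<And>Y f g. tracked A Y f \<Longrightarrow> tracked B Y g \<Longrightarrow>
      \<exists>h. tracked V Y h \<and> eqv Y (h \<cdot> i) f \<and> eqv Y (h \<cdot> j) g"
    and un: "\<And>Y h k. tracked V Y h \<Longrightarrow> tracked V Y k \<Longrightarrow> eqv Y (h \<cdot> i) (k \<cdot> i) \<Longrightarrow>
      eqv Y (h \<cdot> j) (k \<cdot> j) \<Longrightarrow> eqv Y h k"
  shows "is_coproduct (Hex C) A B (cls A V i) (cls B V j)"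
  unfolding is_coproduct_def cls_simps(3)[OF i]
proof (intro conjI allI ballI)
  show "cls A V i \<in> Hom (Hex C) A V" "cls B V j \<in> Hom (Hex C) B V" using i j by (simp_all add: Hom_def)
  fix Y F G assume "F \<in> Hom (Hex C) A Y" "G \<in> Hom (Hex C) B Y"
  then obtain f g where f: "tracked A Y f" "F = cls A Y f" and g: "tracked B Y g" "G = cls B Y g"
    unfolding Hex_Hom_iff by (elim exE conjE)
  have *: "cls V Y h \<cdot>\<^bsub>Hex C\<^esub> cls A V i = F \<and> cls V Y h \<cdot>\<^bsub>Hex C\<^esub> cls B V j = G \<longleftrightarrow>
      eqv Y (h \<cdot> i) f \<and> eqv Y (h \<cdot> j) g" if h: "tracked V Y h" for h
    using h i j f g cls_eq_iff[OF tracked_comp[OF i h] f(1)] cls_eq_iff[OF tracked_comp[OF j h] g(1)] by simp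
  obtain h where h: "tracked V Y h" "eqv Y (h \<cdot> i) f" "eqv Y (h \<cdot> j) g" using ex[OF f(1) g(1)] by blast
  show "\<exists>!\<eta>. \<eta> \<in> Hom (Hex C) V Y \<and> \<eta> \<cdot>\<^bsub>Hex C\<^esub> cls A V i = F \<and> \<eta> \<cdot>\<^bsub>Hex C\<^esub> cls B V j = G"
  proof (rule ex1I)
    show "cls V Y h \<in> Hom (Hex C) V Y \<and> cls V Y h \<cdot>\<^bsub>Hex C\<^esub> cls A V i = F \<and> cls V Y h \<cdot>\<^bsub>Hex C\<^esub> cls B V j = G"
      using *[OF h(1)] h by (simp add: Hom_def)
    fix \<eta> assume \<eta>: "\<eta> \<in> Hom (Hex C) V Y \<and> \<eta> \<cdot>\<^bsub>Hex C\<^esub> cls A V i = F \<and> \<eta> \<cdot>\<^bsub>Hex C\<^esub> cls B V j = G"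
    then obtain k where k: "tracked V Y k" "\<eta> = cls V Y k" unfolding Hex_Hom_iff by (elim exE conjE)
    have "eqv Y (k \<cdot> i) f" "eqv Y (k \<cdot> j) g" using *[OF k(1)] \<eta> k(2) by simp_all
    then have "eqv Y k h"
      using un[OF k(1) h(1)] h(2,3) eqv_trans[OF trackedD(2)[OF h(1)]] eqv_sym[OF trackedD(2)[OF h(1)]] by blast
    then show "\<eta> = cls V Y h" using k cls_eq_iff[OF k(1) h(1)] by simp
  qed
qed

lemma sum_rel_tracked:
  assumes S: "sum_rel A B i j p"
  shows "tracked A (Cod C i, p) i" "tracked B (Cod C i, p) j"
  using sum_relD(1,2,5,6)[OF S] homotopy_sumD[OF sum_relD(3)[OF S]] sum_rel_obj[OF S]
  by (auto intro!: trackedI)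

text \<open>
  A homotopy copairing respects the relation because it does so on each piece of a splitting;
  uniqueness up to equivalence is locality along the coprojections.
\<close>

lemma sum_rel_coproduct:
  assumes S: "sum_rel A B i j p"
  shows "is_coproduct (Hex C) A B (cls A (Cod C i, p) i) (cls B (Cod C i, p) j)"
proof (rule Hex_coproductI[OF sum_rel_tracked[OF S]])
  note D = sum_relD[OF S] and O = sum_rel_obj[OF S]
  note IJ = homotopy_sumD[OF D(3)]
  fix Y f g assume f: "tracked A Y f" and g: "tracked B Y g"
  note F = trackedD[OF f] and G = trackedD[OF g]
  obtain h where h: "h \<in> Arr C" "Dom C h = Cod C i" "Cod C h = Cod C f" "homotopic C (h \<cdot> i) f" "homotopic C (h \<cdot> j) g"
    by (rule homotopy_sum_copair[OF D(3), of f g]) (use F G in simp_all)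
  have hi: "eqv Y (h \<cdot> i) f" "eqv Y (h \<cdot> j) g"
    using homotopic_eqv[OF F(2)] h F(5) IJ by simp_all
  \<comment> \<open>On a piece coming from one summand \<open>E\<close>, with coprojection \<open>k\<close>, the copairing \<open>h\<close> acts as the given \<open>m\<close>.\<close>
  have part: "eqv Y (h \<cdot> a) (h \<cdot> b)"
    if e: "homotopic C a (k \<cdot> x)" "homotopic C b (k \<cdot> x')" "eqv E x x'" and k: "tracked E Y m" "homotopic C (h \<cdot> k) m"
      "k \<in> Arr C" "Dom C k = fst E" "Cod C k = Cod C i" for a b k x x' E m
  proof -
    note X = eqv_arrD[OF e(3)] and M = trackedD[OF k(1)]
    have *: "homotopic C (h \<cdot> a) (m \<cdot> x)" if "homotopic C a (k \<cdot> x)" "x \<in> Arr C" "Cod C x = fst E" for a x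
    proof -
      have "homotopic C (h \<cdot> a) (h \<cdot> k \<cdot> x)"
        by (rule homotopic_postcomp[OF that(1)]) (use homotopic_arrD(4)[OF that(1)] that h k(3-5) in simp_all)
      moreover have "homotopic C (h \<cdot> k \<cdot> x) (m \<cdot> x)"
        using homotopic_comp[OF k(2), of x] that h k(3-5) by simp
      ultimately show ?thesis by (rule homotopic_trans)
    qed
    show ?thesis
      by (rule eqv_homotopic[OF F(2) M(6)[OF e(3)]]) (use * e X in blast)+
  qed
  have "tracked (Cod C i, p) Y h"
  proof (rule trackedI[OF O F(2) h(1)])
    fix a b assume ab: "eqv (Cod C i, p) a b"
    note E = eqv_arrD[OF ab]
    obtain c d x x' y y' where sp: "is_homotopy_sum C (Dom C c) (Dom C d) c d" "Cod C c = Dom C a"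
      "homotopic C (a \<cdot> c) (i \<cdot> x)" "homotopic C (b \<cdot> c) (i \<cdot> x')" "eqv A x x'"
      "homotopic C (a \<cdot> d) (j \<cdot> y)" "homotopic C (b \<cdot> d) (j \<cdot> y')" "eqv B y y'"
      by (rule sum_rel_splitE[OF S ab], rule that)
    note CD = homotopy_sumD[OF sp(1)]
    have "eqv Y (h \<cdot> a \<cdot> c) (h \<cdot> b \<cdot> c)" "eqv Y (h \<cdot> a \<cdot> d) (h \<cdot> b \<cdot> d)"
      using part[OF sp(3-5) f h(4)] part[OF sp(6-8) g h(5)] IJ by simp_all
    then show "eqv Y (h \<cdot> a) (h \<cdot> b)"
      by - (rule eqv_local[OF obj_fibred[OF F(2)] sp(1)], use E h(1-3) F(5) CD sp(2) in simp_all)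
  qed (use h F in simp_all)
  with hi show "\<exists>h. tracked (Cod C i, p) Y h \<and> eqv Y (h \<cdot> i) f \<and> eqv Y (h \<cdot> j) g" by blast
next
  note D = sum_relD[OF S]
  fix Y h k assume h: "tracked (Cod C i, p) Y h" and k: "tracked (Cod C i, p) Y k"
    and e: "eqv Y (h \<cdot> i) (k \<cdot> i)" "eqv Y (h \<cdot> j) (k \<cdot> j)"
  show "eqv Y h k"
    by (rule eqv_local[OF obj_fibred[OF trackedD(2)[OF h]] D(3) _ _ _ _ _ _ e])
      (use trackedD(3-5)[OF h] trackedD(3-5)[OF k] in simp_all)
qed

lemma sum_rel_monic:
  assumes S: "sum_rel A B i j p"
  shows "monic (Hex C) (cls A (Cod C i, p) i)"
proof -
  note t = sum_rel_tracked(1)[OF S]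
  have "U = V" if UV: "U \<in> Hom (Hex C) Y A" "V \<in> Hom (Hex C) Y A"
    and eq: "cls A (Cod C i, p) i \<cdot>\<^bsub>Hex C\<^esub> U = cls A (Cod C i, p) i \<cdot>\<^bsub>Hex C\<^esub> V" for Y U V
  proof -
    obtain u v where u: "tracked Y A u" "U = cls Y A u" and v: "tracked Y A v" "V = cls Y A v"
      using UV unfolding Hex_Hom_iff by (elim exE conjE)
    have "eqv (Cod C i, p) (i \<cdot> u) (i \<cdot> v)"
      using eq u v t cls_eq_iff[OF tracked_comp[OF u(1) t] tracked_comp[OF v(1) t]] by simp
    then have "eqv A u v" using sum_rel_reflects[OF S] trackedD[OF u(1)] trackedD[OF v(1)] by simp
    then show ?thesis using u v cls_eq_iff[OF u(1) v(1)] by simp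
  qed
  then show ?thesis unfolding monic_def using t by auto
qed

lemma sum_rel_disjoint_sum:
  assumes S: "sum_rel A B i j p"
  shows "disjoint_sum (Hex C) (cls A (Cod C i, p) i) (cls B (Cod C i, p) j)"
proof -
  note t = sum_rel_tracked[OF S]
  have cod: "Cod C j = Cod C i" using homotopy_sumD(5)[OF sum_relD(3)[OF S]] .
  obtain W a b where W: "tracked W A a" "tracked W B b" and pb: "el_pullback A B (Cod C i, p) W i j a b"
    by (rule Hex_pullback_ex[OF t])
  have "homotopy_initial C (Dom C a)"
    using sum_rel_disjoint[OF S, of a b] el_pullbackD(1)[OF pb] trackedD[OF W(1)] trackedD[OF W(2)] by simp
  then have "initial (Hex C) W" using Hex_initial[of W] trackedD[OF W(1)] by simp
  moreover have "is_pullback (Hex C) (cls A (Cod C i, p) i) (cls B (Cod C i, p) j) (cls W A a) (cls W B b)"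
    using Hex_pullback_iff[OF t W] pb by simp
  ultimately have "\<exists>\<alpha> \<beta>. initial (Hex C) (Dom (Hex C) \<alpha>) \<and>
      is_pullback (Hex C) (cls A (Cod C i, p) i) (cls B (Cod C i, p) j) \<alpha> \<beta>"
    using W by (intro exI[of _ "cls W A a"] exI[of _ "cls W B b"]) simp
  then show ?thesis
    using sum_rel_monic[OF S] sum_rel_monic[OF sum_rel_sym[OF S]] unfolding disjoint_sum_def cod by simp
qed

text \<open>
  One half of stability: \<open>W\<close> is the pullback in the completion of \<open>i\<close> along \<open>x\<close>, while \<open>c'\<close>,
  \<open>a'\<close> form its counterpart before completion.  The comparison map \<open>m\<close> turns a map \<open>f\<close> out of
  \<open>W\<close> into a map out of the domain of \<open>c'\<close>, and \<open>h\<close> is any extension of that along \<open>c'\<close>.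
\<close>

lemma stable_half:
  assumes S: "sum_rel A B i j p" and x: "tracked Y (Cod C i, p) x"
    and a: "tracked W A a" and c: "tracked W Y c" and pb: "el_pullback A Y (Cod C i, p) W i x a c"
    and ac: "a' \<in> Arr C" "c' \<in> Arr C" "Dom C a' = Dom C c'" "Cod C a' = fst A" "Cod C c' = fst Y"
      "homotopic C (i \<cdot> a') (x \<cdot> c')"
    and weak: "\<And>u v. \<lbrakk>u \<in> Arr C; v \<in> Arr C; Dom C v = Dom C u; Cod C u = fst A; Cod C v = Dom C x;
      homotopic C (i \<cdot> u) (x \<cdot> v)\<rbrakk> \<Longrightarrow>
      \<exists>k. k \<in> Arr C \<and> Dom C k = Dom C u \<and> Cod C k = Dom C c' \<and> a' \<cdot> k = u \<and> c' \<cdot> k = v"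
  obtains m where "m \<in> Arr C" "Dom C m = Dom C c'" "Cod C m = fst W" "eqv Y (c \<cdot> m) c'"
    "\<And>K f h v v' z z'. \<lbrakk>tracked W K f; h \<in> Arr C; Dom C h = fst Y; Cod C h = fst K; homotopic C (h \<cdot> c') (f \<cdot> m);
      eqv Y v v'; eqv A z z'; homotopic C (x \<cdot> v) (i \<cdot> z); homotopic C (x \<cdot> v') (i \<cdot> z')\<rbrakk> \<Longrightarrow> eqv K (h \<cdot> v) (h \<cdot> v')"
    "\<And>K f h. \<lbrakk>tracked W K f; h \<in> Arr C; Dom C h = fst Y; Cod C h = fst K; homotopic C (h \<cdot> c') (f \<cdot> m)\<rbrakk> \<Longrightarrow>
      eqv K (h \<cdot> c) f"
proof -
  note D = sum_relD[OF S] and O = sum_rel_obj[OF S]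
  note IJ = homotopy_sumD[OF D(3)]
  note X = trackedD[OF x, unfolded fst_conv] and AD = trackedD[OF a] and CD = trackedD[OF c]
  have "eqv (Cod C i, p) (i \<cdot> a') (x \<cdot> c')" using homotopic_eqv[OF O ac(6)] ac IJ by simp
  then obtain m where m: "m \<in> Arr C" "Dom C m = Dom C a'" "Cod C m = fst W" "eqv A (a \<cdot> m) a'" "eqv Y (c \<cdot> m) c'"
    using el_pullbackD(2)[OF pb, of a' c'] ac by auto
  \<comment> \<open>A point of \<open>Y\<close> over \<open>A\<close> comes from the domain of \<open>c'\<close>, hence is sent by \<open>h\<close> to a value of \<open>f\<close>.\<close>
  have value_f: "\<exists>w. w \<in> Arr C \<and> Dom C w = Dom C v \<and> Cod C w = fst W \<and> eqv A (a \<cdot> w) z \<and> eqv Y (c \<cdot> w) v \<and> homotopic C (h \<cdot> v) (f \<cdot> w)"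
    if f: "tracked W K f" and h: "h \<in> Arr C" "Dom C h = fst Y" "Cod C h = fst K" "homotopic C (h \<cdot> c') (f \<cdot> m)"
      and v: "v \<in> Arr C" "Cod C v = fst Y" and z: "z \<in> Arr C" "Cod C z = fst A" "Dom C z = Dom C v"
      and xv: "homotopic C (x \<cdot> v) (i \<cdot> z)" for K f h v z
  proof -
    note F = trackedD[OF f]
    obtain k where k: "k \<in> Arr C" "Dom C k = Dom C z" "Cod C k = Dom C c'" "a' \<cdot> k = z" "c' \<cdot> k = v"
      using weak[of z v] homotopic_sym[OF xv] v z X(4) by auto
    have "eqv A (a \<cdot> m \<cdot> k) z" using eqv_comp'[OF AD(2) m(4), of k] k(1-4) m(1-3) ac AD(3-5) by simp
    moreover have "eqv Y (c \<cdot> m \<cdot> k) v" using eqv_comp'[OF CD(2) m(5), of k] k(1-3,5) m(1-3) ac CD(3-5) by simp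
    moreover have "homotopic C (h \<cdot> v) (f \<cdot> m \<cdot> k)"
      using homotopic_comp[OF h(4), of k] k(1-3,5) m(1-3) ac h(1-3) F(3-5) by simp
    ultimately show ?thesis using k(1-3) z(3) m(1-3) ac by (intro exI[of _ "m \<cdot> k"]) simp
  qed
  have 1: "eqv K (h \<cdot> v) (h \<cdot> v')"
    if f: "tracked W K f" and h: "h \<in> Arr C" "Dom C h = fst Y" "Cod C h = fst K" "homotopic C (h \<cdot> c') (f \<cdot> m)"
      and v: "eqv Y v v'" and z: "eqv A z z'" and xv: "homotopic C (x \<cdot> v) (i \<cdot> z)" "homotopic C (x \<cdot> v') (i \<cdot> z')"
    for K f h v v' z z'
  proof -
    note V = eqv_arrD[OF v] and Z = eqv_arrD[OF z] and F = trackedD[OF f]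
    have zv: "Dom C z = Dom C v" using homotopic_arrD(3)[OF xv(1)] V Z X(3,4) IJ by simp
    obtain w where w: "w \<in> Arr C" "Dom C w = Dom C v" "Cod C w = fst W" "eqv A (a \<cdot> w) z" "eqv Y (c \<cdot> w) v"
      "homotopic C (h \<cdot> v) (f \<cdot> w)"
      using value_f[OF f h V(1,4) Z(1,4) zv xv(1)] by blast
    obtain w' where w': "w' \<in> Arr C" "Dom C w' = Dom C v'" "Cod C w' = fst W" "eqv A (a \<cdot> w') z'" "eqv Y (c \<cdot> w') v'"
      "homotopic C (h \<cdot> v') (f \<cdot> w')"
      using value_f[OF f h V(2,5) Z(2,5) _ xv(2)] V(3) Z(3) zv by auto
    have "eqv A (a \<cdot> w) (a \<cdot> w')"
      by (rule eqv_trans[OF AD(2) w(4) eqv_trans[OF AD(2) z eqv_sym[OF AD(2) w'(4)]]])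
    moreover have "eqv Y (c \<cdot> w) (c \<cdot> w')"
      by (rule eqv_trans[OF CD(2) w(5) eqv_trans[OF CD(2) v eqv_sym[OF CD(2) w'(5)]]])
    ultimately have "eqv W w w'" using el_pullbackD(3)[OF pb w(1) w'(1) _ w(3) w'(3)] w(2) w'(2) V(3) by simp
    then show ?thesis using eqv_homotopic[OF F(2) F(6) w(6) w'(6)] by blast
  qed
  have 2: "eqv K (h \<cdot> c) f"
    if f: "tracked W K f" and h: "h \<in> Arr C" "Dom C h = fst Y" "Cod C h = fst K" "homotopic C (h \<cdot> c') (f \<cdot> m)"
    for K f h
  proof -
    note F = trackedD[OF f]
    have e: "eqv (Cod C i, p) (x \<cdot> c) (i \<cdot> a)" by (rule eqv_sym[OF O el_pullbackD(1)[OF pb]])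
    obtain c1 d1 z z' y y' where sp: "is_homotopy_sum C (Dom C c1) (Dom C d1) c1 d1" "Cod C c1 = Dom C (x \<cdot> c)"
      "Cod C d1 = Dom C (x \<cdot> c)"
      "homotopic C ((x \<cdot> c) \<cdot> c1) (i \<cdot> z)" "homotopic C ((i \<cdot> a) \<cdot> c1) (i \<cdot> z')" "eqv A z z'"
      "homotopic C ((i \<cdot> a) \<cdot> d1) (j \<cdot> y')" "eqv B y y'"
      "Dom C z = Dom C c1" "Dom C z' = Dom C c1" "Dom C y' = Dom C d1"
      by (rule sum_rel_splitE[OF S e], rule that)
    note CC = homotopy_sumD[OF sp(1)] and Z = eqv_arrD[OF sp(6)] and YY = eqv_arrD[OF sp(8)]
    have cod: "Cod C c1 = fst W" "Cod C d1 = fst W" using sp(2,3) X(3-5) CD(3-5) by simp_all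
    have xz: "homotopic C (x \<cdot> c \<cdot> c1) (i \<cdot> z)" using sp(4) cod CC X(3-5) CD(3-5) by simp
    obtain w where w: "w \<in> Arr C" "Dom C w = Dom C (c \<cdot> c1)" "Cod C w = fst W" "eqv A (a \<cdot> w) z" "eqv Y (c \<cdot> w) (c \<cdot> c1)"
      "homotopic C (h \<cdot> c \<cdot> c1) (f \<cdot> w)"
      using value_f[OF f h _ _ Z(1,4) _ xz] cod CC CD(3-5) sp(9) by auto
    have "homotopic C (i \<cdot> a \<cdot> c1) (i \<cdot> z')" using sp(5) cod CC AD(3-5) IJ by simp
    then have "homotopic C (a \<cdot> c1) z'"
      by - (rule homotopy_sum_monic[OF D(3)], use cod CC AD(3-5) Z sp(10) in simp_all)
    then have "eqv A (a \<cdot> c1) z'" using homotopic_eqv[OF AD(2)] cod CC AD(3-5) by simp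
    then have "eqv A (a \<cdot> w) (a \<cdot> c1)"
      using eqv_trans[OF AD(2) w(4) eqv_trans[OF AD(2) sp(6) eqv_sym[OF AD(2)]]] by blast
    then have "eqv W w c1" using el_pullbackD(3)[OF pb w(1) CC(1) _ w(3) cod(1) _ w(5)] w(2) cod CC CD(3-5) by simp
    then have e1: "eqv K ((h \<cdot> c) \<cdot> c1) (f \<cdot> c1)"
      using eqv_homotopic[OF F(2) F(6)[OF \<open>eqv W w c1\<close>] w(6) homotopic_refl] cod CC CD(3-5) F(3-5) h by simp
    have "homotopic C (i \<cdot> a \<cdot> d1) (j \<cdot> y')" using sp(7) cod CC AD(3-5) IJ by simp
    then have "homotopy_initial C (Dom C d1)"
      using homotopy_sum_disjoint[OF D(3), of "a \<cdot> d1" y'] cod CC AD(3-5) YY sp(11) by simp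
    then have e2: "eqv K ((h \<cdot> c) \<cdot> d1) (f \<cdot> d1)"
      using cod CC CD(3-5) F(3-5) h by (intro eqv_homotopy_initial[OF obj_fibred[OF F(2)]]) simp_all
    show ?thesis
      by (rule eqv_local[OF obj_fibred[OF F(2)] sp(1) _ _ _ _ _ _ e1 e2]) (use cod CD(3-5) F(3-5) h in simp_all)
  qed
  show thesis by (rule that[OF m(1) _ m(3,5) 1 2]) (use m(2) ac(3) in auto)
qed

lemma sum_rel_stable:
  assumes S: "sum_rel A B i j p" and x: "tracked Y (Cod C i, p) x"
    and ac: "tracked W1 A a" "tracked W1 Y c" "el_pullback A Y (Cod C i, p) W1 i x a c"
    and bd: "tracked W2 B b" "tracked W2 Y d" "el_pullback B Y (Cod C i, p) W2 j x b d"
  shows "is_coproduct (Hex C) W1 W2 (cls W1 Y c) (cls W2 Y d)"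
proof -
  note D = sum_relD[OF S] and O = sum_rel_obj[OF S]
  note IJ = homotopy_sumD[OF D(3)]
  note X = trackedD[OF x, unfolded fst_conv] and CD = trackedD[OF ac(2)] and DD = trackedD[OF bd(2)]
  obtain a' c' b' d' where sp: "is_homotopy_sum C (Dom C c') (Dom C d') c' d'" "Cod C c' = Dom C x"
    "a' \<in> Arr C" "Dom C a' = Dom C c'" "Cod C a' = fst A" "homotopic C (i \<cdot> a') (x \<cdot> c')"
    "b' \<in> Arr C" "Dom C b' = Dom C d'" "Cod C b' = fst B" "homotopic C (j \<cdot> b') (x \<cdot> d')"
    and weak1: "\<And>u v. \<lbrakk>u \<in> Arr C; v \<in> Arr C; Dom C v = Dom C u; Cod C u = fst A; Cod C v = Dom C x; homotopic C (i \<cdot> u) (x \<cdot> v)\<rbrakk> \<Longrightarrow>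
      \<exists>k. k \<in> Arr C \<and> Dom C k = Dom C u \<and> Cod C k = Dom C c' \<and> a' \<cdot> k = u \<and> c' \<cdot> k = v"
    and weak2: "\<And>u v. \<lbrakk>u \<in> Arr C; v \<in> Arr C; Dom C v = Dom C u; Cod C u = fst B; Cod C v = Dom C x; homotopic C (j \<cdot> u) (x \<cdot> v)\<rbrakk> \<Longrightarrow>
      \<exists>k. k \<in> Arr C \<and> Dom C k = Dom C u \<and> Cod C k = Dom C d' \<and> b' \<cdot> k = u \<and> d' \<cdot> k = v"
    by (rule homotopy_sum_split[OF D(3) X(3,5)], rule that)
  note E = homotopy_sumD[OF sp(1)]
  have cod: "Cod C c' = fst Y" "Cod C d' = fst Y" using sp(2) E X(4) by simp_all
  have x': "tracked Y (Cod C j, p) x" and bd3: "el_pullback B Y (Cod C j, p) W2 j x b d"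
    using x bd(3) IJ by simp_all
  obtain m where m: "m \<in> Arr C" "Dom C m = Dom C c'" "Cod C m = fst W1" "eqv Y (c \<cdot> m) c'"
    "\<And>K f h v v' z z'. \<lbrakk>tracked W1 K f; h \<in> Arr C; Dom C h = fst Y; Cod C h = fst K; homotopic C (h \<cdot> c') (f \<cdot> m);
      eqv Y v v'; eqv A z z'; homotopic C (x \<cdot> v) (i \<cdot> z); homotopic C (x \<cdot> v') (i \<cdot> z')\<rbrakk> \<Longrightarrow> eqv K (h \<cdot> v) (h \<cdot> v')"
    "\<And>K f h. \<lbrakk>tracked W1 K f; h \<in> Arr C; Dom C h = fst Y; Cod C h = fst K; homotopic C (h \<cdot> c') (f \<cdot> m)\<rbrakk> \<Longrightarrow>
      eqv K (h \<cdot> c) f"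
    by (rule stable_half[OF S x ac sp(3) E(1) sp(4,5) cod(1) sp(6) weak1], assumption+, rule that)
  obtain n where n: "n \<in> Arr C" "Dom C n = Dom C d'" "Cod C n = fst W2" "eqv Y (d \<cdot> n) d'"
    "\<And>K f h v v' z z'. \<lbrakk>tracked W2 K f; h \<in> Arr C; Dom C h = fst Y; Cod C h = fst K; homotopic C (h \<cdot> d') (f \<cdot> n);
      eqv Y v v'; eqv B z z'; homotopic C (x \<cdot> v) (j \<cdot> z); homotopic C (x \<cdot> v') (j \<cdot> z')\<rbrakk> \<Longrightarrow> eqv K (h \<cdot> v) (h \<cdot> v')"
    "\<And>K f h. \<lbrakk>tracked W2 K f; h \<in> Arr C; Dom C h = fst Y; Cod C h = fst K; homotopic C (h \<cdot> d') (f \<cdot> n)\<rbrakk> \<Longrightarrow>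
      eqv K (h \<cdot> d) f"
    by (rule stable_half[OF sum_rel_sym[OF S] x' bd(1,2) bd3 sp(7) E(2) sp(8,9) cod(2) sp(10) weak2], assumption+, rule that)
  show ?thesis
  proof (rule Hex_coproductI[OF ac(2) bd(2)])
    fix K f g assume f: "tracked W1 K f" and g: "tracked W2 K g"
    note F = trackedD[OF f] and G = trackedD[OF g]
    obtain h where h: "h \<in> Arr C" "Dom C h = Cod C c'" "Cod C h = Cod C (f \<cdot> m)"
      "homotopic C (h \<cdot> c') (f \<cdot> m)" "homotopic C (h \<cdot> d') (g \<cdot> n)"
      by (rule homotopy_sum_copair[OF sp(1), of "f \<cdot> m" "g \<cdot> n"]) (use F(3-5) G(3-5) m(1-3) n(1-3) in simp_all)
    have h': "Dom C h = fst Y" "Cod C h = fst K" using h(2,3) cod F(3-5) m(1-3) by simp_all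
    have "tracked Y K h"
    proof (rule trackedI[OF X(1) F(2) h(1) h'])
      fix v v' assume v: "eqv Y v v'"
      note V = eqv_arrD[OF v]
      have e: "eqv (Cod C i, p) (x \<cdot> v) (x \<cdot> v')" by (rule X(6)[OF v])
      obtain c1 d1 z z' y y' where sp1: "is_homotopy_sum C (Dom C c1) (Dom C d1) c1 d1" "Cod C c1 = Dom C (x \<cdot> v)"
        "Cod C d1 = Dom C (x \<cdot> v)"
        "homotopic C ((x \<cdot> v) \<cdot> c1) (i \<cdot> z)" "homotopic C ((x \<cdot> v') \<cdot> c1) (i \<cdot> z')" "eqv A z z'"
        "homotopic C ((x \<cdot> v) \<cdot> d1) (j \<cdot> y)" "homotopic C ((x \<cdot> v') \<cdot> d1) (j \<cdot> y')" "eqv B y y'"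
        by (rule sum_rel_splitE[OF S e], rule that)
      note CC = homotopy_sumD[OF sp1(1)]
      have cc: "Cod C c1 = Dom C v" "Cod C d1 = Dom C v" using sp1(2,3) X(3,4) V by simp_all
      have vc: "eqv Y (v \<cdot> c1) (v' \<cdot> c1)" "eqv Y (v \<cdot> d1) (v' \<cdot> d1)"
        using eqv_comp'[OF X(1) v] cc CC by simp_all
      have hx: "homotopic C (x \<cdot> v \<cdot> c1) (i \<cdot> z)" "homotopic C (x \<cdot> v' \<cdot> c1) (i \<cdot> z')"
        "homotopic C (x \<cdot> v \<cdot> d1) (j \<cdot> y)" "homotopic C (x \<cdot> v' \<cdot> d1) (j \<cdot> y')"
        using sp1(4,5,7,8) cc CC X(3,4) V by simp_all
      have "eqv K (h \<cdot> v \<cdot> c1) (h \<cdot> v' \<cdot> c1)" by (rule m(5)[OF f h(1) h' h(4) vc(1) sp1(6) hx(1,2)])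
      moreover have "eqv K (h \<cdot> v \<cdot> d1) (h \<cdot> v' \<cdot> d1)" by (rule n(5)[OF g h(1) h' h(5) vc(2) sp1(9) hx(3,4)])
      ultimately have e12: "eqv K ((h \<cdot> v) \<cdot> c1) ((h \<cdot> v') \<cdot> c1)" "eqv K ((h \<cdot> v) \<cdot> d1) ((h \<cdot> v') \<cdot> d1)"
        using cc CC h(1) h' V by simp_all
      show "eqv K (h \<cdot> v) (h \<cdot> v')"
        by (rule eqv_local[OF obj_fibred[OF F(2)] sp1(1) _ _ _ _ _ _ e12]) (use cc h(1) h' V in simp_all)
    qed
    moreover have "eqv K (h \<cdot> c) f" by (rule m(6)[OF f h(1) h' h(4)])
    moreover have "eqv K (h \<cdot> d) g" by (rule n(6)[OF g h(1) h' h(5)])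
    ultimately show "\<exists>h. tracked Y K h \<and> eqv K (h \<cdot> c) f \<and> eqv K (h \<cdot> d) g" by blast
  next
    fix K h k assume h: "tracked Y K h" and k: "tracked Y K k" and e: "eqv K (h \<cdot> c) (k \<cdot> c)" "eqv K (h \<cdot> d) (k \<cdot> d)"
    note H = trackedD[OF h] and KD = trackedD[OF k]
    have cmp: "eqv K (h \<cdot> q') (k \<cdot> q')"
      if "eqv K (h \<cdot> q) (k \<cdot> q)" "eqv Y (q \<cdot> l) q'" "q \<in> Arr C" "Cod C q = fst Y" "l \<in> Arr C" "Cod C l = Dom C q" for q l q'
    proof -
      have "eqv K (h \<cdot> q \<cdot> l) (k \<cdot> q \<cdot> l)"
        using eqv_comp'[OF H(2) that(1), of l] that(3-) H(3-5) KD(3-5) by simp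
      then show ?thesis
        using eqv_trans[OF H(2) eqv_sym[OF H(2) H(6)[OF that(2)]] eqv_trans[OF H(2) _ KD(6)[OF that(2)]]] by blast
    qed
    have "eqv K (h \<cdot> c') (k \<cdot> c')" "eqv K (h \<cdot> d') (k \<cdot> d')"
      using cmp[OF e(1) m(4)] cmp[OF e(2) n(4)] m(1-3) n(1-3) CD(3-5) DD(3-5) by simp_all
    then show "eqv K h k"
      by - (rule eqv_local[OF obj_fibred[OF H(2)] sp(1)], use H(3-5) KD(3-5) cod in simp_all)
  qed
qed

lemma Hex_sum_rel_ex:
  assumes "A \<in> Obj (Hex C)" "B \<in> Obj (Hex C)"
  obtains i j p where "sum_rel A B i j p"
proof -
  have A: "obj A" and B: "obj B" using assms Hex_Obj by auto
  obtain i j where s: "is_homotopy_sum C (fst A) (fst B) i j"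
    by (rule homotopy_sum_ex[OF objD(1)[OF A] objD(1)[OF B]])
  obtain p where "sum_rel A B i j p" by (rule sum_rel_ex[OF A B s])
  then show thesis by (rule that)
qed

text \<open>
  Disjointness and stability of an arbitrary sum are transported along the comparison with the
  constructed one.
\<close>

lemma Hex_coproduct_disjoint_stable:
  assumes cop: "is_coproduct (Hex C) A B I J"
  shows "disjoint_sum (Hex C) I J" "stable_sum (Hex C) I J"
proof -
  note H = category_Hex
  have IJ: "I \<in> Arr (Hex C)" "J \<in> Arr (Hex C)" "Dom (Hex C) I = A" "Dom (Hex C) J = B" "Cod (Hex C) J = Cod (Hex C) I"
    using cop by (auto simp: is_coproduct_def Hom_def)
  have "A \<in> Obj (Hex C)" "B \<in> Obj (Hex C)" using category.Dom_Obj[OF H] IJ by blast+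
  then obtain i j p where S: "sum_rel A B i j p" by (rule Hex_sum_rel_ex)
  define V where "V = (Cod C i, p)"
  note t = sum_rel_tracked[OF S, folded V_def]
  obtain \<theta> \<theta>' where \<theta>: "\<theta> \<in> Arr (Hex C)" "Dom (Hex C) \<theta> = Cod (Hex C) (cls A V i)" "Cod (Hex C) \<theta> = Cod (Hex C) I"
    "\<theta>' \<in> Arr (Hex C)" "Dom (Hex C) \<theta>' = Cod (Hex C) I" "Cod (Hex C) \<theta>' = Cod (Hex C) (cls A V i)"
    "\<theta> \<cdot>\<^bsub>Hex C\<^esub> cls A V i = I" "\<theta> \<cdot>\<^bsub>Hex C\<^esub> cls B V j = J" "\<theta>' \<cdot>\<^bsub>Hex C\<^esub> I = cls A V i" "\<theta>' \<cdot>\<^bsub>Hex C\<^esub> J = cls B V j"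
    "\<theta>' \<cdot>\<^bsub>Hex C\<^esub> \<theta> = Ident (Hex C) (Cod (Hex C) (cls A V i))" "\<theta> \<cdot>\<^bsub>Hex C\<^esub> \<theta>' = Ident (Hex C) (Cod (Hex C) I)"
    by (rule category.coproduct_iso[OF H sum_rel_coproduct[OF S, folded V_def] cop], rule that)
  have \<theta>V: "Dom (Hex C) \<theta> = V" "Cod (Hex C) \<theta>' = V" using \<theta>(2,6) t by simp_all
  have dis: "disjoint_sum (Hex C) (cls A V i) (cls B V j)" using sum_rel_disjoint_sum[OF S] by (simp add: V_def)
  have mono: "monic (Hex C) M"
    if "monic (Hex C) (\<theta>' \<cdot>\<^bsub>Hex C\<^esub> M)" "M \<in> Arr (Hex C)" "Cod (Hex C) M = Cod (Hex C) I" for M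
    by (rule category.monic_of_comp[OF H that(1,2) \<theta>(4)]) (simp add: that(3) \<theta>(5))
  obtain \<alpha> \<beta> where ab: "initial (Hex C) (Dom (Hex C) \<alpha>)" "is_pullback (Hex C) (cls A V i) (cls B V j) \<alpha> \<beta>"
    using dis unfolding disjoint_sum_def by blast
  have "is_pullback (Hex C) (\<theta> \<cdot>\<^bsub>Hex C\<^esub> cls A V i) (\<theta> \<cdot>\<^bsub>Hex C\<^esub> cls B V j) \<alpha> \<beta>"
    by (rule category.pullback_postcomp[OF H ab(2) \<theta>(1,2,4)]) (use \<theta> in simp_all)
  then have "is_pullback (Hex C) I J \<alpha> \<beta>" using \<theta>(7,8) by simp
  then show "disjoint_sum (Hex C) I J"
    using mono[of I] mono[of J] dis ab(1) IJ \<theta>(9,10) unfolding disjoint_sum_def by auto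
  have "is_coproduct (Hex C) (Dom (Hex C) c) (Dom (Hex C) d) c d"
    if pb: "is_pullback (Hex C) I x a c" "is_pullback (Hex C) J x b d" for a x b c d
  proof -
    note P1 = category.pullback_arrD[OF H pb(1)] and P2 = category.pullback_arrD[OF H pb(2)]
    have "is_pullback (Hex C) (\<theta>' \<cdot>\<^bsub>Hex C\<^esub> I) (\<theta>' \<cdot>\<^bsub>Hex C\<^esub> x) a c"
      by (rule category.pullback_postcomp[OF H pb(1) \<theta>(4,5,1)]) (use \<theta> in simp_all)
    then have pb1: "is_pullback (Hex C) (cls A V i) (\<theta>' \<cdot>\<^bsub>Hex C\<^esub> x) a c" using \<theta>(9) by simp
    have "is_pullback (Hex C) (\<theta>' \<cdot>\<^bsub>Hex C\<^esub> J) (\<theta>' \<cdot>\<^bsub>Hex C\<^esub> x) b d"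
      by (rule category.pullback_postcomp[OF H pb(2) \<theta>(4) _ \<theta>(1)]) (use \<theta> IJ in simp_all)
    then have pb2: "is_pullback (Hex C) (cls B V j) (\<theta>' \<cdot>\<^bsub>Hex C\<^esub> x) b d" using \<theta>(10) by simp
    have "\<theta>' \<cdot>\<^bsub>Hex C\<^esub> x \<in> Arr (Hex C)" "Cod (Hex C) (\<theta>' \<cdot>\<^bsub>Hex C\<^esub> x) = V"
      using category.Comp_simps[OF H P1(2) \<theta>(4)] P1(5) \<theta>(5) \<theta>V by simp_all
    then obtain Y y where y: "tracked Y V y" "\<theta>' \<cdot>\<^bsub>Hex C\<^esub> x = cls Y V y"
      using Hex_ArrE[OF _ refl] by metis
    obtain W1 a' c' where 1: "tracked W1 A a'" "tracked W1 Y c'" "c = cls W1 Y c'" "el_pullback A Y V W1 i y a' c'"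
      by (rule Hex_pullbackE[OF pb1[unfolded y(2)] t(1) y(1)], rule that)
    obtain W2 b' d' where 2: "tracked W2 B b'" "tracked W2 Y d'" "d = cls W2 Y d'" "el_pullback B Y V W2 j y b' d'"
      by (rule Hex_pullbackE[OF pb2[unfolded y(2)] t(2) y(1)], rule that)
    show ?thesis
      using sum_rel_stable[OF S y(1)[unfolded V_def] 1(1,2) 1(4)[unfolded V_def] 2(1,2) 2(4)[unfolded V_def]] 1 2 by simp
  qed
  then show "stable_sum (Hex C) I J"
    using Hex_finitely_complete IJ unfolding stable_sum_def finitely_complete_def by (metis (no_types))
qed

lemma Hex_extensive: "extensive_category (Hex C)"
  unfolding extensive_category_def
proof (intro conjI allI impI ballI)
  show "\<exists>Z. initial (Hex C) Z" using Hex_initial_ex by blast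
  show "initial (Hex C) Y" if "initial (Hex C) Z \<and> Y \<in> Obj (Hex C) \<and> Hom (Hex C) Y Z \<noteq> {}" for Z Y
    using Hex_initial_strict that by blast
  show "\<exists>i j. is_coproduct (Hex C) A B i j" if AB: "A \<in> Obj (Hex C)" "B \<in> Obj (Hex C)" for A B
  proof -
    obtain i j p where "sum_rel A B i j p" by (rule Hex_sum_rel_ex[OF AB])
    from sum_rel_coproduct[OF this] show ?thesis by blast
  qed
qed (use category_Hex Hex_coproduct_disjoint_stable in blast)+

end

section \<open>The pretopos\<close>

theorem theorem4p10:
  fixes C :: "('o, 'm) path_cat"
  assumes "path_category C" and "homotopy_extensive C"
  shows "pretopos (Hex C)"
proof -
  interpret path_category C by (rule assms(1))
  interpret homotopy_extensive_category C by unfold_locales (rule assms(2))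
  show ?thesis unfolding pretopos_def using Hex_exact Hex_extensive by blast
qed

end
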